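(* Let $(M,g)$ be a closed Riemannian manifold with terminator value $\beta_{Ter}\in[0,\infty]$. If $\beta_{Ter}<\infty$, then $(M,g)$ is free of $\beta_{Ter}$-conjugate points. Moreover, $\beta_{Ter}=\infty$ if and only if $(M,g)$ has non-positive sectional curvature.
   Context: $\dim M\ge2$; closed means compact without boundary. With $R$ the Riemann curvature tensor (sign convention: $\langle R(w,v)v,w\rangle$ is the sectional curvature of the plane spanned by orthonormal $v,w$), $(M,g)$ is free of $\beta$-conjugate points ($\beta\in\mathbb R$) if for every unit speed geodesic $\gamma$, every nontrivial solution $J$, orthogonal to $\dot\gamma$, of $\ddot J+\beta R(J,\dot\gamma)\dot\gamma=0$ with $J(0)=0$ vanishes only at $t=0$. The terminator value $\beta_{Ter}\in[0,\infty]$ is the supremum of all $\beta\ge0$ such that $(M,g)$ is free of $\beta$-conjugate points. *)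

theory Defs
  imports "HOL-Analysis.Analysis"
begin

section \<open>Smooth maps between open subsets of normed spaces\<close>

text \<open>Meant for open sets \<open>S\<close>. On finite-dimensional spaces, asking for all directional
  derivatives of order \<open>k\<close> to be differentiable is the usual notion of class \<open>C\<^sup>k\<close>.\<close>

primrec Ck_on :: "nat \<Rightarrow> 'a::real_normed_vector set \<Rightarrow> ('a \<Rightarrow> 'b::real_normed_vector) \<Rightarrow> bool" where
  "Ck_on 0 S f \<longleftrightarrow> continuous_on S f"
| "Ck_on (Suc k) S f \<longleftrightarrow> (\<forall>x\<in>S. f differentiable (at x)) \<and>
     (\<forall>v. Ck_on k S (\<lambda>x. frechet_derivative f (at x) v))"

definition smooth_on :: "'a::real_normed_vector set \<Rightarrow> ('a \<Rightarrow> 'b::real_normed_vector) \<Rightarrow> bool" where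
  "smooth_on S f \<longleftrightarrow> (\<forall>k. Ck_on k S f)"


section \<open>Smooth manifolds\<close>

type_synonym ('a, 'e) chart = "'a set \<times> ('a \<Rightarrow> 'e)"

abbreviation cdom :: "('a, 'e) chart \<Rightarrow> 'a set" where
  "cdom c \<equiv> fst c"

abbreviation cmap :: "('a, 'e) chart \<Rightarrow> 'a \<Rightarrow> 'e" where
  "cmap c \<equiv> snd c"

abbreviation cinv :: "('a, 'e) chart \<Rightarrow> 'e \<Rightarrow> 'a" where
  "cinv c \<equiv> inv_into (cdom c) (cmap c)"

abbreviation transition :: "('a, 'e) chart \<Rightarrow> ('a, 'e) chart \<Rightarrow> 'e \<Rightarrow> 'e" where
  "transition c d \<equiv> cmap d \<circ> cinv c"

text \<open>A manifold without boundary of dimension \<open>DIM('e)\<close>; the Hausdorff property and second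
  countability come from the type class constraints on the ambient type, of which \<open>M\<close> is an
  arbitrary subset with the subspace topology.\<close>

definition smooth_manifold ::
  "'a::{t2_space, second_countable_topology} set \<Rightarrow> ('a, 'e::euclidean_space) chart set \<Rightarrow> bool" where
  "smooth_manifold M A \<longleftrightarrow>
     (\<Union>c\<in>A. cdom c) = M \<and>
     (\<forall>c\<in>A. openin (top_of_set M) (cdom c) \<and> open (cmap c ` cdom c) \<and>
        homeomorphism (cdom c) (cmap c ` cdom c) (cmap c) (cinv c)) \<and>
     (\<forall>c\<in>A. \<forall>d\<in>A. smooth_on (cmap c ` (cdom c \<inter> cdom d)) (transition c d))"


section \<open>Tangent vectors\<close>

text \<open>A tangent vector at \<open>p\<close> is the family of its coordinate vectors in all charts around \<open>p\<close>,
  related by the differentials of the transition maps. At charts that are not charts around \<open>p\<close>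
  the family is \<open>0\<close>, so that equality of tangent vectors is equality of functions.
  The vector space operations are pointwise.\<close>

type_synonym ('a, 'e) tvec = "('a, 'e) chart \<Rightarrow> 'e"

definition charts_at :: "('a, 'e) chart set \<Rightarrow> 'a \<Rightarrow> ('a, 'e) chart set" where
  "charts_at A p = {c \<in> A. p \<in> cdom c}"

definition tangent_space :: "('a, 'e::euclidean_space) chart set \<Rightarrow> 'a \<Rightarrow> ('a, 'e) tvec set" where
  "tangent_space A p = {v.
     (\<forall>c \<in> charts_at A p. \<forall>d \<in> charts_at A p.
        v d = frechet_derivative (transition c d) (at (cmap c p)) (v c)) \<and>
     (\<forall>c. c \<notin> charts_at A p \<longrightarrow> v c = 0)}"

text \<open>The tangent vector at \<open>p\<close> whose coordinate vector in the chart \<open>c\<close> is \<open>x\<close>.\<close>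

definition tvec_of :: "('a, 'e::euclidean_space) chart set \<Rightarrow> ('a, 'e) chart \<Rightarrow> 'a \<Rightarrow> 'e \<Rightarrow> ('a, 'e) tvec" where
  "tvec_of A c p x = (\<lambda>d. if d \<in> charts_at A p
     then frechet_derivative (transition c d) (at (cmap c p)) x else 0)"


section \<open>Riemannian metrics\<close>

type_synonym ('a, 'e) metric = "'a \<Rightarrow> ('a, 'e) tvec \<Rightarrow> ('a, 'e) tvec \<Rightarrow> real"

definition metric_coord ::
  "('a, 'e::euclidean_space) chart set \<Rightarrow> ('a, 'e) metric \<Rightarrow> ('a, 'e) chart \<Rightarrow> 'e \<Rightarrow> 'e \<Rightarrow> 'e \<Rightarrow> real" where
  "metric_coord A g c x u v = g (cinv c x) (tvec_of A c (cinv c x) u) (tvec_of A c (cinv c x) v)"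

definition inner_product_on_tangent_space ::
  "('a, 'e::euclidean_space) chart set \<Rightarrow> 'a \<Rightarrow> (('a, 'e) tvec \<Rightarrow> ('a, 'e) tvec \<Rightarrow> real) \<Rightarrow> bool" where
  "inner_product_on_tangent_space A p b \<longleftrightarrow>
     (\<forall>u \<in> tangent_space A p. \<forall>v \<in> tangent_space A p. b u v = b v u) \<and>
     (\<forall>u \<in> tangent_space A p. \<forall>v \<in> tangent_space A p. \<forall>w \<in> tangent_space A p. \<forall>r s.
        b (\<lambda>c. r *\<^sub>R u c + s *\<^sub>R v c) w = r * b u w + s * b v w) \<and>
     (\<forall>u \<in> tangent_space A p. u \<noteq> (\<lambda>c. 0) \<longrightarrow> b u u > 0)"

definition riemannian_metric ::
  "'a set \<Rightarrow> ('a, 'e::euclidean_space) chart set \<Rightarrow> ('a, 'e) metric \<Rightarrow> bool" where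
  "riemannian_metric M A g \<longleftrightarrow>
     (\<forall>p\<in>M. inner_product_on_tangent_space A p (g p)) \<and>
     (\<forall>c\<in>A. \<forall>u v. smooth_on (cmap c ` cdom c) (\<lambda>x. metric_coord A g c x u v))"

definition closed_riemannian_manifold ::
  "'a::{t2_space, second_countable_topology} set \<Rightarrow> ('a, 'e::euclidean_space) chart set \<Rightarrow>
     ('a, 'e) metric \<Rightarrow> bool" where
  "closed_riemannian_manifold M A g \<longleftrightarrow>
     smooth_manifold M A \<and> riemannian_metric M A g \<and> compact M"


section \<open>Levi-Civita connection and curvature\<close>

text \<open>The Christoffel symbols of the Levi-Civita connection as a vector-valued bilinear form:
  the Koszul formula for coordinate fields \<open>u\<close>, \<open>v\<close>, \<open>w\<close>, whose brackets vanish.\<close>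

definition christoffel ::
  "('a, 'e::euclidean_space) chart set \<Rightarrow> ('a, 'e) metric \<Rightarrow> ('a, 'e) chart \<Rightarrow> 'e \<Rightarrow> 'e \<Rightarrow> 'e \<Rightarrow> 'e" where
  "christoffel A g c x u v = (THE z. \<forall>w. 2 * metric_coord A g c x z w =
       frechet_derivative (\<lambda>y. metric_coord A g c y v w) (at x) u
     + frechet_derivative (\<lambda>y. metric_coord A g c y u w) (at x) v
     - frechet_derivative (\<lambda>y. metric_coord A g c y u v) (at x) w)"

text \<open>The coordinate expression of
  \<open>R(u,v)w = \<nabla>\<^sub>u\<nabla>\<^sub>v w - \<nabla>\<^sub>v\<nabla>\<^sub>u w - \<nabla>\<^bsub>[u,v]\<^esub> w\<close> for coordinate fields. With this sign
  convention \<open>\<langle>R(w,v)v,w\<rangle>\<close> is the sectional curvature for orthonormal \<open>v\<close>, \<open>w\<close>.\<close>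

definition curvature_coord ::
  "('a, 'e::euclidean_space) chart set \<Rightarrow> ('a, 'e) metric \<Rightarrow> ('a, 'e) chart \<Rightarrow> 'e \<Rightarrow> 'e \<Rightarrow> 'e \<Rightarrow> 'e \<Rightarrow> 'e" where
  "curvature_coord A g c x u v w =
       frechet_derivative (\<lambda>y. christoffel A g c y v w) (at x) u
     - frechet_derivative (\<lambda>y. christoffel A g c y u w) (at x) v
     + christoffel A g c x u (christoffel A g c x v w)
     - christoffel A g c x v (christoffel A g c x u w)"

definition curvature ::
  "('a, 'e::euclidean_space) chart set \<Rightarrow> ('a, 'e) metric \<Rightarrow> 'a \<Rightarrow>
     ('a, 'e) tvec \<Rightarrow> ('a, 'e) tvec \<Rightarrow> ('a, 'e) tvec \<Rightarrow> ('a, 'e) tvec" where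
  "curvature A g p u v w = (\<lambda>c. if c \<in> charts_at A p
     then curvature_coord A g c (cmap c p) (u c) (v c) (w c) else 0)"

definition nonpositive_sectional_curvature ::
  "'a set \<Rightarrow> ('a, 'e::euclidean_space) chart set \<Rightarrow> ('a, 'e) metric \<Rightarrow> bool" where
  "nonpositive_sectional_curvature M A g \<longleftrightarrow>
     (\<forall>p\<in>M. \<forall>v \<in> tangent_space A p. \<forall>w \<in> tangent_space A p.
        g p v v = 1 \<and> g p w w = 1 \<and> g p v w = 0 \<longrightarrow> g p (curvature A g p w v v) w \<le> 0)"


section \<open>Geodesics and vector fields along curves\<close>

definition smooth_curve ::
  "'a::topological_space set \<Rightarrow> ('a, 'e::euclidean_space) chart set \<Rightarrow> (real \<Rightarrow> 'a) \<Rightarrow> bool" where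
  "smooth_curve M A \<gamma> \<longleftrightarrow> range \<gamma> \<subseteq> M \<and> continuous_on UNIV \<gamma> \<and>
     (\<forall>c\<in>A. smooth_on (\<gamma> -` cdom c) (cmap c \<circ> \<gamma>))"

definition velocity ::
  "('a, 'e::euclidean_space) chart set \<Rightarrow> (real \<Rightarrow> 'a) \<Rightarrow> real \<Rightarrow> ('a, 'e) tvec" where
  "velocity A \<gamma> t = (\<lambda>c. if c \<in> charts_at A (\<gamma> t)
     then vector_derivative (cmap c \<circ> \<gamma>) (at t) else 0)"

definition smooth_field_along ::
  "('a, 'e::euclidean_space) chart set \<Rightarrow> (real \<Rightarrow> 'a) \<Rightarrow> (real \<Rightarrow> ('a, 'e) tvec) \<Rightarrow> bool" where
  "smooth_field_along A \<gamma> J \<longleftrightarrow> (\<forall>t. J t \<in> tangent_space A (\<gamma> t)) \<and>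
     (\<forall>c\<in>A. smooth_on (\<gamma> -` cdom c) (\<lambda>t. J t c))"

definition covariant_derivative ::
  "('a, 'e::euclidean_space) chart set \<Rightarrow> ('a, 'e) metric \<Rightarrow> (real \<Rightarrow> 'a) \<Rightarrow>
     (real \<Rightarrow> ('a, 'e) tvec) \<Rightarrow> real \<Rightarrow> ('a, 'e) tvec" where
  "covariant_derivative A g \<gamma> J t = (\<lambda>c. if c \<in> charts_at A (\<gamma> t)
     then vector_derivative (\<lambda>s. J s c) (at t)
            + christoffel A g c (cmap c (\<gamma> t)) (velocity A \<gamma> t c) (J t c)
     else 0)"

text \<open>Geodesics are parametrized by the whole real line; this is no loss for compact \<open>M\<close>, where
  every geodesic extends to one.\<close>

definition unit_speed_geodesic ::
  "'a::topological_space set \<Rightarrow> ('a, 'e::euclidean_space) chart set \<Rightarrow> ('a, 'e) metric \<Rightarrow>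
     (real \<Rightarrow> 'a) \<Rightarrow> bool" where
  "unit_speed_geodesic M A g \<gamma> \<longleftrightarrow> smooth_curve M A \<gamma> \<and>
     (\<forall>t. covariant_derivative A g \<gamma> (velocity A \<gamma>) t = (\<lambda>c. 0)) \<and>
     (\<forall>t. g (\<gamma> t) (velocity A \<gamma> t) (velocity A \<gamma> t) = 1)"


section \<open>Conjugate points and the terminator value\<close>

definition beta_jacobi_field ::
  "('a, 'e::euclidean_space) chart set \<Rightarrow> ('a, 'e) metric \<Rightarrow> real \<Rightarrow> (real \<Rightarrow> 'a) \<Rightarrow>
     (real \<Rightarrow> ('a, 'e) tvec) \<Rightarrow> bool" where
  "beta_jacobi_field A g \<beta> \<gamma> J \<longleftrightarrow> smooth_field_along A \<gamma> J \<and>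
     (\<forall>t c. covariant_derivative A g \<gamma> (covariant_derivative A g \<gamma> J) t c
        + \<beta> *\<^sub>R curvature A g (\<gamma> t) (J t) (velocity A \<gamma> t) (velocity A \<gamma> t) c = 0)"

definition free_of_conjugate_points ::
  "'a::topological_space set \<Rightarrow> ('a, 'e::euclidean_space) chart set \<Rightarrow> ('a, 'e) metric \<Rightarrow>
     real \<Rightarrow> bool" where
  "free_of_conjugate_points M A g \<beta> \<longleftrightarrow>
     (\<forall>\<gamma> J. unit_speed_geodesic M A g \<gamma> \<and> beta_jacobi_field A g \<beta> \<gamma> J \<and>
        (\<forall>t. g (\<gamma> t) (J t) (velocity A \<gamma> t) = 0) \<and>
        (\<exists>t. J t \<noteq> (\<lambda>c. 0)) \<and> J 0 = (\<lambda>c. 0) \<longrightarrow>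
        (\<forall>t. J t = (\<lambda>c. 0) \<longrightarrow> t = 0))"

definition terminator_value ::
  "'a::topological_space set \<Rightarrow> ('a, 'e::euclidean_space) chart set \<Rightarrow> ('a, 'e) metric \<Rightarrow> ennreal" where
  "terminator_value M A g = Sup {ennreal \<beta> |\<beta>. 0 \<le> \<beta> \<and> free_of_conjugate_points M A g \<beta>}"

end

theory Submission
  imports Defs
begin

text \<open>In a parallel orthonormal frame along a unit speed geodesic the \<open>\<beta>\<close>-Jacobi equation becomes
  \<open>y'' + \<beta> K y = 0\<close> with a symmetric matrix function \<open>K\<close>. If no nontrivial solution vanishes twice,
  the index form \<open>\<integral> \<bar>W'\<bar>\<^sup>2 - \<beta> K W \<bullet> W\<close> is nonnegative on all \<open>W\<close> vanishing at the ends of an interval;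
  a pair of conjugate points, on the other hand, gives a \<open>W\<close> on which it is negative. For fixed \<open>W\<close> the
  index form is affine in \<open>\<beta>\<close>, so negativity at \<open>\<beta>\<^sub>T\<^sub>e\<^sub>r\<close> would persist for slightly smaller
  parameters, which contradicts the definition of \<open>\<beta>\<^sub>T\<^sub>e\<^sub>r\<close>. A plane of positive curvature makes
  \<open>\<integral> K W \<bullet> W\<close> positive for some \<open>W\<close> along the geodesic tangent to it, so the index form becomes
  negative for large \<open>\<beta>\<close>. If the curvature is nonpositive, \<open>y' \<bullet> y\<close> is nondecreasing, and \<open>y\<close>
  cannot vanish twice.\<close>

section \<open>Calculus of \<open>C\<^sup>k\<close> maps\<close>

text \<open>The matrix function \<open>K\<close> depends on the geodesic only, so a test field found
  at one parameter constrains every other parameter along the same geodesic; this makes the affine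
  dependence on \<beta> usable at the supremum. Two mismatches shape the argument. A conjugate pair
  on [a,b] gives index exactly 0 there, hence the passage to the longer interval [a,b+1].
  Disconjugacy speaks of all solutions and all pairs of zeros, freeness only of orthogonal fields
  vanishing at time 0: two zeros force orthogonality, and a shift of time moves one of them to 0.
  Since tangent vectors are families over all charts and the Christoffel symbols are a definite
  description, parallel transport, smoothness and complete geodesics have to be derived from
  coordinate equations. Compactness of M enters there, as a uniform existence time for unit speed
  geodesics.\<close>

abbreviation dd :: "('a::real_normed_vector \<Rightarrow> 'b::real_normed_vector) \<Rightarrow> 'a \<Rightarrow> 'a \<Rightarrow> 'b" where
  "dd f x v \<equiv> frechet_derivative f (at x) v"

lemma has_derivative_dd: "f differentiable at x \<Longrightarrow> (f has_derivative (\<lambda>v. dd f x v)) (at x)"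
  by (metis frechet_derivative_works)

lemma dd_eq: "(f has_derivative f') (at x) \<Longrightarrow> dd f x v = f' v"
  using frechet_derivative_at by metis

lemma linear_dd: "f differentiable at x \<Longrightarrow> linear (\<lambda>v. dd f x v)"
  using has_derivative_dd has_derivative_linear by blast

text \<open>The predicate under the choice operator is the same for both functions, so the chosen
  maps agree even where neither function is differentiable.\<close>

lemma dd_cong:
  assumes "open S" "x \<in> S" "\<And>y. y \<in> S \<Longrightarrow> f y = g y"
  shows "frechet_derivative f (at x) = frechet_derivative g (at x)"
proof -
  have "(f has_derivative f') (at x) \<longleftrightarrow> (g has_derivative f') (at x)" for f'
    using has_derivative_transform_within_open[OF _ assms(1,2), of f f' UNIV g]
      has_derivative_transform_within_open[OF _ assms(1,2), of g f' UNIV f] assms(3) by force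
  then show ?thesis unfolding frechet_derivative_def by simp
qed

lemma differentiable_cong_open:
  assumes "open S" "x \<in> S" "\<And>y. y \<in> S \<Longrightarrow> f y = g y"
  shows "f differentiable at x \<longleftrightarrow> g differentiable at x"
  using has_derivative_transform_within_open[OF _ assms(1,2), of f _ UNIV g]
      has_derivative_transform_within_open[OF _ assms(1,2), of g _ UNIV f] assms(3)
  unfolding differentiable_def by metis

lemma dd_cong_at:
  assumes "open S" "x \<in> S" "\<And>y. y \<in> S \<Longrightarrow> f y = g y"
  shows "dd f x v = dd g x v"
  using dd_cong[OF assms] by simp

lemma Ck_on_cong:
  assumes "open S" "\<And>x. x \<in> S \<Longrightarrow> f x = g x"
  shows "Ck_on k S f \<longleftrightarrow> Ck_on k S g"
  using assms(2)
proof (induction k arbitrary: f g)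
  case 0 then show ?case by (simp cong: continuous_on_cong)
next
  case (Suc k)
  have 1: "f differentiable at x \<longleftrightarrow> g differentiable at x" if "x \<in> S" for x
    using differentiable_cong_open[OF assms(1) that] Suc.prems by blast
  have "Ck_on k S (\<lambda>x. dd f x v) \<longleftrightarrow> Ck_on k S (\<lambda>x. dd g x v)" for v
    by (rule Suc.IH) (rule dd_cong_at[OF assms(1)], use Suc.prems in auto)
  with 1 show ?case by auto
qed

lemma Ck_on_eqI:
  assumes "open S" "Ck_on k S h" "\<And>x. x \<in> S \<Longrightarrow> f x = h x" shows "Ck_on k S f"
  using assms Ck_on_cong by blast

lemma Ck_on_imp_continuous_on: "Ck_on k S f \<Longrightarrow> continuous_on S f"
  by (cases k) (auto simp: continuous_at_imp_continuous_on differentiable_imp_continuous_within)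

lemma Ck_on_Suc_imp: "Ck_on (Suc k) S f \<Longrightarrow> Ck_on k S f"
proof (induction k arbitrary: f)
  case 0 then show ?case using Ck_on_imp_continuous_on by (metis Ck_on.simps(1))
next
  case (Suc k) then show ?case by (metis Ck_on.simps(2))
qed

lemma Ck_on_subset: "Ck_on k S f \<Longrightarrow> T \<subseteq> S \<Longrightarrow> Ck_on k T f"
  by (induction k arbitrary: f) (auto intro: continuous_on_subset)

text \<open>Carries smoothness from the chart domains along a curve to a globally defined scalar
  function.\<close>

lemma Ck_on_local:
  assumes "\<And>x. x \<in> S \<Longrightarrow> \<exists>U. open U \<and> x \<in> U \<and> Ck_on k U f"
  shows "Ck_on k S f"
  using assms
proof (induction k arbitrary: f)
  case 0
  have "continuous (at x within S) f" if x: "x \<in> S" for x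
  proof -
    obtain U where "open U" "x \<in> U" "continuous_on U f" using 0[OF x] by auto
    then show ?thesis using continuous_at_imp_continuous_within continuous_on_eq_continuous_at by blast
  qed
  then show ?case by (simp add: continuous_on_eq_continuous_within)
next
  case (Suc k)
  show ?case
  proof (simp, intro conjI ballI allI)
    fix x assume "x \<in> S" then show "f differentiable at x" using Suc.prems by fastforce
  next
    fix v show "Ck_on k S (\<lambda>x. dd f x v)"
    proof (rule Suc.IH)
      fix x assume "x \<in> S"
      then show "\<exists>U. open U \<and> x \<in> U \<and> Ck_on k U (\<lambda>x. dd f x v)" using Suc.prems by fastforce
    qed
  qed
qed

section \<open>Closure of \<open>Ck_on\<close> under algebraic operations and composition\<close>

lemma Ck_on_const [simp]: "Ck_on k S (\<lambda>x. c)"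
  by (induction k arbitrary: c) (auto simp: frechet_derivative_const)

lemma Ck_on_bounded_linear:
  assumes "bounded_linear f" shows "Ck_on k S f"
proof (cases k)
  case 0 then show ?thesis using assms by (simp add: linear_continuous_on)
next
  case (Suc j)
  have "dd f x v = f v" for x v using dd_eq[OF bounded_linear_imp_has_derivative[OF assms]] by simp
  then show ?thesis using Suc bounded_linear_imp_differentiable[OF assms] by (simp add: assms)
qed

lemma Ck_on_add:
  assumes "Ck_on k S f" "Ck_on k S g" "open S"
  shows "Ck_on k S (\<lambda>x. f x + g x)"
  using assms(1,2)
proof (induction k arbitrary: f g)
  case 0 then show ?case by (auto intro: continuous_intros)
next
  case (Suc k)
  have "dd (\<lambda>x. f x + g x) x v = dd f x v + dd g x v" if "x \<in> S" for x v
    using Suc.prems that by (intro dd_eq has_derivative_add has_derivative_dd) auto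
  then have "Ck_on k S (\<lambda>x. dd (\<lambda>x. f x + g x) x v) \<longleftrightarrow> Ck_on k S (\<lambda>x. dd f x v + dd g x v)" for v
    by (intro Ck_on_cong assms(3))
  then show ?case using Suc by (auto simp: differentiable_add)
qed

lemma Ck_on_bilinear:
  assumes "bounded_bilinear prd" "open S" "Ck_on k S f" "Ck_on k S g"
  shows "Ck_on k S (\<lambda>x. prd (f x) (g x))"
  using assms(3,4)
proof (induction k arbitrary: f g)
  case 0 then show ?case using bounded_bilinear.continuous_on[OF assms(1)] by auto
next
  case (Suc k)
  interpret bounded_bilinear prd by fact
  have D: "((\<lambda>x. prd (f x) (g x)) has_derivative (\<lambda>v. prd (f x) (dd g x v) + prd (dd f x v) (g x))) (at x)"
    if "x \<in> S" for x
    using Suc.prems that by (intro FDERIV has_derivative_dd) auto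
  have fg: "Ck_on k S f" "Ck_on k S g" using Suc.prems Ck_on_Suc_imp by blast+
  have "Ck_on k S (\<lambda>x. dd (\<lambda>x. prd (f x) (g x)) x v)
     \<longleftrightarrow> Ck_on k S (\<lambda>x. prd (f x) (dd g x v) + prd (dd f x v) (g x))" for v
    by (intro Ck_on_cong assms(2) dd_eq D)
  moreover have "Ck_on k S (\<lambda>x. prd (f x) (dd g x v) + prd (dd f x v) (g x))" for v
    using Suc fg by (intro Ck_on_add assms(2)) auto
  ultimately show ?case using D by (auto simp: differentiable_def)
qed

lemmas Ck_on_scaleR = Ck_on_bilinear[OF bounded_bilinear_scaleR]
lemmas Ck_on_mult = Ck_on_bilinear[OF bounded_bilinear_mult]
lemmas Ck_on_inner = Ck_on_bilinear[OF bounded_bilinear_inner]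

lemma Ck_on_linear_comp:
  assumes "bounded_linear L" "open S" "Ck_on k S f"
  shows "Ck_on k S (\<lambda>x. L (f x))"
  using assms(3)
proof (induction k arbitrary: f)
  case 0 then show ?case using bounded_linear.continuous_on[OF assms(1)] by auto
next
  case (Suc k)
  have D: "((\<lambda>x. L (f x)) has_derivative (\<lambda>v. L (dd f x v))) (at x)"
    if "x \<in> S" for x
    using Suc.prems that by (intro bounded_linear.has_derivative[OF assms(1)] has_derivative_dd) auto
  then have "Ck_on k S (\<lambda>x. dd (\<lambda>x. L (f x)) x v) \<longleftrightarrow> Ck_on k S (\<lambda>x. L (dd f x v))" for v
    by (intro Ck_on_cong assms(2) dd_eq D)
  then show ?case using D Suc by (auto simp: differentiable_def)
qed

lemma Ck_on_uminus: "open S \<Longrightarrow> Ck_on k S f \<Longrightarrow> Ck_on k S (\<lambda>x. - f x)"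
  by (rule Ck_on_linear_comp[OF bounded_linear_minus[OF bounded_linear_ident]])

lemma Ck_on_diff:
  assumes "Ck_on k S f" "Ck_on k S g" "open S"
  shows "Ck_on k S (\<lambda>x. f x - g x)"
  using Ck_on_add[OF assms(1) Ck_on_uminus[OF assms(3,2)] assms(3)] by simp

lemma Ck_on_sum:
  assumes "\<And>i. i \<in> I \<Longrightarrow> Ck_on k S (f i)" "open S"
  shows "Ck_on k S (\<lambda>x. \<Sum>i\<in>I. f i x)"
  using assms(1) by (induction I rule: infinite_finite_induct) (auto intro: Ck_on_add assms(2))

lemma linear_basis_expand:
  fixes L :: "'a::euclidean_space \<Rightarrow> 'b::real_vector"
  assumes "linear L" shows "L v = (\<Sum>b\<in>Basis. (v \<bullet> b) *\<^sub>R L b)"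
  using linear_sum[OF assms, of "\<lambda>b. (v \<bullet> b) *\<^sub>R b" Basis]
  by (simp add: euclidean_representation linear_scale[OF assms])

text \<open>The chain rule differentiates \<open>g\<close> in the direction \<open>dd f x v\<close>,
  which moves with \<open>x\<close>, whereas \<open>Ck_on\<close> controls fixed directions only.
  Expanding the direction in \<open>Basis\<close> separates the two dependences; hence the Euclidean
  middle space.\<close>

lemma Ck_on_compose:
  fixes g :: "'b::euclidean_space \<Rightarrow> 'c::real_normed_vector"
  assumes "open S" "Ck_on k S f" "Ck_on k T g" "open T" "f ` S \<subseteq> T"
  shows "Ck_on k S (\<lambda>x. g (f x))"
  using assms(2,3)
proof (induction k arbitrary: g)
  case 0 then show ?case using assms(5) by (auto intro: continuous_on_compose2)
next
  case (Suc k)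
  have D: "((\<lambda>x. g (f x)) has_derivative (\<lambda>v. dd g (f x) (dd f x v))) (at x)" if "x \<in> S" for x
    by (rule has_derivative_compose[OF has_derivative_dd has_derivative_dd]) (use Suc.prems that assms(5) in auto)
  have e: "dd g (f x) (dd f x v) = (\<Sum>b\<in>Basis. (dd f x v \<bullet> b) *\<^sub>R dd g (f x) b)" if "x \<in> S" for x v
    by (rule linear_basis_expand[OF linear_dd]) (use that Suc.prems assms(5) in auto)
  have "Ck_on k S (\<lambda>x. dd (\<lambda>x. g (f x)) x v)
     \<longleftrightarrow> Ck_on k S (\<lambda>x. (\<Sum>b\<in>Basis. (dd f x v \<bullet> b) *\<^sub>R dd g (f x) b))" for v
    by (intro Ck_on_cong assms(1)) (simp add: dd_eq[OF D] e)
  moreover have "Ck_on k S (\<lambda>x. (\<Sum>b\<in>Basis. (dd f x v \<bullet> b) *\<^sub>R dd g (f x) b))" for v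
    using Suc.prems Suc.IH[OF Ck_on_Suc_imp[OF Suc.prems(1)], of "\<lambda>x. dd g x _"]
    by (intro Ck_on_sum Ck_on_scaleR Ck_on_inner assms(1)) auto
  ultimately show ?case using D by (auto simp: differentiable_def)
qed

lemma smooth_onD: "smooth_on S f \<Longrightarrow> Ck_on k S f" by (simp add: smooth_on_def)
lemma smooth_onI: "(\<And>k. Ck_on k S f) \<Longrightarrow> smooth_on S f" by (simp add: smooth_on_def)

lemma smooth_on_differentiable: "smooth_on S f \<Longrightarrow> x \<in> S \<Longrightarrow> f differentiable at x"
  using smooth_onD[of S f "Suc 0"] by simp

lemma smooth_on_dd: "smooth_on S f \<Longrightarrow> smooth_on S (\<lambda>x. dd f x v)"
  using smooth_onD[of S f] by (auto intro!: smooth_onI) (metis Ck_on.simps(2))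

text \<open>Tensors in coordinates appear as functions \<open>F x v\<close> linear in
  \<open>v\<close> and known to be smooth in \<open>x\<close> for constant \<open>v\<close>.
  Expansion in a basis gives smoothness when \<open>v\<close> varies with \<open>x\<close> as
  well.\<close>

lemma Ck_on_family:
  fixes F :: "'a::real_normed_vector \<Rightarrow> 'e::euclidean_space \<Rightarrow> 'b::real_normed_vector"
  assumes "open S" "\<And>x. x \<in> S \<Longrightarrow> linear (F x)" "\<And>v. Ck_on k S (\<lambda>x. F x v)" "Ck_on k S u"
  shows "Ck_on k S (\<lambda>x. F x (u x))"
proof (rule Ck_on_eqI[OF assms(1) _ linear_basis_expand[OF assms(2)]])
  show "Ck_on k S (\<lambda>x. \<Sum>b\<in>Basis. (u x \<bullet> b) *\<^sub>R F x b)"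
    using assms by (intro Ck_on_sum Ck_on_scaleR Ck_on_inner) auto
qed

lemma Ck_on_family2:
  fixes F :: "'a::real_normed_vector \<Rightarrow> 'e::euclidean_space \<Rightarrow> 'f::euclidean_space \<Rightarrow> 'b::real_normed_vector"
  assumes "open S" "\<And>x v. x \<in> S \<Longrightarrow> linear (F x v)" "\<And>x w. x \<in> S \<Longrightarrow> linear (\<lambda>v. F x v w)"
    "\<And>v w. Ck_on k S (\<lambda>x. F x v w)" "Ck_on k S u" "Ck_on k S w"
  shows "Ck_on k S (\<lambda>x. F x (u x) (w x))"
  by (rule Ck_on_family[where F="\<lambda>x. F x (u x)", OF assms(1)])
    (use assms in \<open>auto intro: Ck_on_family[where F="\<lambda>x v. F x v _"]\<close>)

section \<open>Symmetry of second derivatives\<close>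

lemma mixed_difference:
  fixes f :: "'a::real_normed_vector \<Rightarrow> real"
  assumes "Ck_on 2 U f" and h: "0 < h"
    and in_U: "\<And>s t. 0 \<le> s \<Longrightarrow> s \<le> h \<Longrightarrow> 0 \<le> t \<Longrightarrow> t \<le> h \<Longrightarrow> x + s *\<^sub>R u + t *\<^sub>R v \<in> U"
  shows "\<exists>s t. 0 \<le> s \<and> s \<le> h \<and> 0 \<le> t \<and> t \<le> h \<and>
    f (x + h *\<^sub>R u + h *\<^sub>R v) - f (x + h *\<^sub>R u) - f (x + h *\<^sub>R v) + f x
      = h\<^sup>2 * dd (\<lambda>y. dd f y u) (x + s *\<^sub>R u + t *\<^sub>R v) v"
proof -
  have d1: "f differentiable at y" if "y \<in> U" for y using assms(1) that by (simp add: numeral_2_eq_2)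
  have d2: "(\<lambda>y. dd f y u) differentiable at y" if "y \<in> U" for y using assms(1) that by (simp add: numeral_2_eq_2)
  \<comment> \<open>The second difference is a first difference of \<open>p\<close>, so the mean
    value theorem applies once in direction \<open>u\<close> and then, to \<open>q\<close>, in
    direction \<open>v\<close>.\<close>
  define p where "p = (\<lambda>s. f (x + s *\<^sub>R u + h *\<^sub>R v) - f (x + s *\<^sub>R u))"
  have in0: "x + s *\<^sub>R u \<in> U" if "0 \<le> s" "s \<le> h" for s using in_U[of s 0] that h by simp
  have fs: "((\<lambda>s. f (x + s *\<^sub>R u + w)) has_real_derivative dd f (x + s *\<^sub>R u + w) u) (at s)"
    if "x + s *\<^sub>R u + w \<in> U" for s w
  proof -
    have "((\<lambda>s. x + s *\<^sub>R u + w) has_derivative (\<lambda>k. k *\<^sub>R u)) (at s)"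
      by (auto intro!: derivative_eq_intros)
    from diff_chain_at[OF this has_derivative_dd[OF d1[OF that]]] show ?thesis
      using linear_scale[OF linear_dd[OF d1[OF that]]]
      by (simp add: o_def has_field_derivative_def mult_commute_abs)
  qed
  have "(p has_real_derivative dd f (x + s *\<^sub>R u + h *\<^sub>R v) u - dd f (x + s *\<^sub>R u) u) (at s)"
    if "0 \<le> s" "s \<le> h" for s
    unfolding p_def using fs[of s "h *\<^sub>R v"] fs[of s 0] in_U[of s h] in0[of s] that h
    by (auto intro: DERIV_diff)
  then obtain s where s: "0 < s" "s < h"
    "p h - p 0 = (h - 0) * (dd f (x + s *\<^sub>R u + h *\<^sub>R v) u - dd f (x + s *\<^sub>R u) u)"
    using MVT2[OF h, of p "\<lambda>s. dd f (x + s *\<^sub>R u + h *\<^sub>R v) u - dd f (x + s *\<^sub>R u) u"] by blast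
  define q where "q = (\<lambda>t. dd f (x + s *\<^sub>R u + t *\<^sub>R v) u)"
  have "(q has_real_derivative dd (\<lambda>y. dd f y u) (x + s *\<^sub>R u + t *\<^sub>R v) v) (at t)"
    if "0 \<le> t" "t \<le> h" for t
  proof -
    have 1: "((\<lambda>t. x + s *\<^sub>R u + t *\<^sub>R v) has_derivative (\<lambda>k. k *\<^sub>R v)) (at t)"
      by (auto intro!: derivative_eq_intros)
    have 2: "x + s *\<^sub>R u + t *\<^sub>R v \<in> U" using in_U s that by simp
    show ?thesis unfolding q_def
      using has_derivative_compose[OF 1 has_derivative_dd[OF d2[OF 2]]]
      by (simp add: has_field_derivative_def mult_commute_abs linear_scale[OF linear_dd[OF d2[OF 2]]])
  qed
  then obtain t where t: "0 < t" "t < h"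
    "q h - q 0 = (h - 0) * dd (\<lambda>y. dd f y u) (x + s *\<^sub>R u + t *\<^sub>R v) v"
    using MVT2[OF h, of q "\<lambda>t. dd (\<lambda>y. dd f y u) (x + s *\<^sub>R u + t *\<^sub>R v) v"] by blast
  have "f (x + h *\<^sub>R u + h *\<^sub>R v) - f (x + h *\<^sub>R u) - f (x + h *\<^sub>R v) + f x = p h - p 0"
    by (simp add: p_def)
  also have "\<dots> = h * (q h - q 0)" using s by (simp add: q_def)
  also have "\<dots> = h\<^sup>2 * dd (\<lambda>y. dd f y u) (x + s *\<^sub>R u + t *\<^sub>R v) v" using t by (simp add: power2_eq_square)
  finally show ?thesis using s t by (intro exI[of _ s] exI[of _ t]) auto
qed

text \<open>The second difference is symmetric in \<open>u\<close> and \<open>v\<close>. Divided by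
  the square of h it is a value of \<open>?A\<close> at one point near \<open>x\<close> and a value
  of \<open>?B\<close> at another, and continuity of both brings these values to
  \<open>x\<close>.\<close>

lemma dd_symmetric_real:
  fixes f :: "'a::real_normed_vector \<Rightarrow> real"
  assumes "Ck_on 2 U f" "open U" "x \<in> U"
  shows "dd (\<lambda>y. dd f y u) x v = dd (\<lambda>y. dd f y v) x u"
proof (rule ccontr)
  let ?A = "\<lambda>z. dd (\<lambda>y. dd f y u) z v" and ?B = "\<lambda>z. dd (\<lambda>y. dd f y v) z u"
  assume "?A x \<noteq> ?B x"
  define e where "e = \<bar>?A x - ?B x\<bar> / 2"
  have e: "e > 0" using \<open>?A x \<noteq> ?B x\<close> by (simp add: e_def)
  have "continuous_on U ?A" "continuous_on U ?B" using assms(1) by (auto simp: numeral_2_eq_2)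
  then have "continuous (at x) ?A" "continuous (at x) ?B" using assms(2,3) continuous_on_eq_continuous_at by blast+
  then obtain d1 d2 where d: "d1 > 0" "d2 > 0" "\<And>z. dist z x < d1 \<Longrightarrow> dist (?A z) (?A x) < e"
     "\<And>z. dist z x < d2 \<Longrightarrow> dist (?B z) (?B x) < e"
    using e unfolding continuous_at_eps_delta by metis
  obtain d3 where d3: "d3 > 0" "ball x d3 \<subseteq> U" using assms(2,3) openE by blast
  define d where "d = min d1 (min d2 d3)"
  have "d > 0" using d d3 by (simp add: d_def)
  \<comment> \<open>The summand 1 keeps \<open>N\<close> positive when both directions are zero, and
    makes the estimate in \<open>small\<close> strict.\<close>
  define N where "N = norm u + norm v + 1"
  have N: "N > 0" by (simp add: N_def add_nonneg_pos)
  define h where "h = d / N / 2"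
  have h: "h > 0" using \<open>d > 0\<close> N by (simp add: h_def)
  have small: "dist (x + s *\<^sub>R u' + t *\<^sub>R v') x < d"
    if "0 \<le> s" "s \<le> h" "0 \<le> t" "t \<le> h" "norm u' + norm v' = norm u + norm v" for s t u' v'
  proof -
    have "dist (x + s *\<^sub>R u' + t *\<^sub>R v') x \<le> norm (s *\<^sub>R u') + norm (t *\<^sub>R v')"
      using norm_triangle_ineq[of "s *\<^sub>R u'" "t *\<^sub>R v'"] by (simp add: dist_norm add.assoc)
    also have "\<dots> \<le> h * norm u' + h * norm v'" using that by (auto intro!: add_mono mult_right_mono)
    also have "\<dots> = h * (norm u + norm v)" using that(5) by (metis distrib_left)
    also have "\<dots> < h * N" using h by (simp add: N_def)
    also have "\<dots> < d" using N \<open>d > 0\<close> by (simp add: h_def)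
    finally show ?thesis .
  qed
  have dU: "z \<in> U" if "dist z x < d" for z using that d3 by (auto simp: d_def dist_commute)
  obtain s t where 1: "0 \<le> s" "s \<le> h" "0 \<le> t" "t \<le> h"
    "f (x + h *\<^sub>R u + h *\<^sub>R v) - f (x + h *\<^sub>R u) - f (x + h *\<^sub>R v) + f x = h\<^sup>2 * ?A (x + s *\<^sub>R u + t *\<^sub>R v)"
    using mixed_difference[OF assms(1) h, of x u v] dU small by blast
  obtain s' t' where 2: "0 \<le> s'" "s' \<le> h" "0 \<le> t'" "t' \<le> h"
    "f (x + h *\<^sub>R v + h *\<^sub>R u) - f (x + h *\<^sub>R v) - f (x + h *\<^sub>R u) + f x = h\<^sup>2 * ?B (x + s' *\<^sub>R v + t' *\<^sub>R u)"
    using mixed_difference[OF assms(1) h, of x v u] dU small by (metis add.commute)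
  have eq: "?A (x + s *\<^sub>R u + t *\<^sub>R v) = ?B (x + s' *\<^sub>R v + t' *\<^sub>R u)"
  proof -
    have "h\<^sup>2 * ?A (x + s *\<^sub>R u + t *\<^sub>R v) = h\<^sup>2 * ?B (x + s' *\<^sub>R v + t' *\<^sub>R u)"
      unfolding 1(5)[symmetric] 2(5)[symmetric] by (simp add: algebra_simps)
    then show ?thesis using h by simp
  qed
  have "dist (x + s *\<^sub>R u + t *\<^sub>R v) x < d1" "dist (x + s' *\<^sub>R v + t' *\<^sub>R u) x < d2"
    using small[OF 1(1-4), of u v] small[OF 2(1-4), of v u] by (auto simp: d_def)
  from d(3)[OF this(1)] d(4)[OF this(2)] have
    "\<bar>?A (x + s *\<^sub>R u + t *\<^sub>R v) - ?A x\<bar> < e" "\<bar>?A (x + s *\<^sub>R u + t *\<^sub>R v) - ?B x\<bar> < e"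
    unfolding dist_real_def eq by simp_all
  moreover have "\<bar>a - b\<bar> \<le> \<bar>c - a\<bar> + \<bar>c - b\<bar>" for a b c :: real by simp
  ultimately show False unfolding e_def by (smt (verit) field_sum_of_halves)
qed

lemma dd_symmetric:
  fixes f :: "'a::real_normed_vector \<Rightarrow> 'b::euclidean_space"
  assumes "Ck_on 2 U f" "open U" "x \<in> U"
  shows "dd (\<lambda>y. dd f y u) x v = dd (\<lambda>y. dd f y v) x u"
proof (rule euclidean_eqI)
  fix i :: 'b assume "i \<in> Basis"
  have bl: "bounded_linear (\<lambda>z. z \<bullet> i)" by (rule bounded_linear_inner_left)
  have d1: "f differentiable at y" if "y \<in> U" for y using assms(1) that by (simp add: numeral_2_eq_2)
  have d2: "(\<lambda>y. dd f y w) differentiable at x" for w using assms by (simp add: numeral_2_eq_2)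
  have *: "dd (\<lambda>y. f y \<bullet> i) y w = dd f y w \<bullet> i" if "y \<in> U" for y w
    using bounded_linear.has_derivative[OF bl has_derivative_dd[OF d1[OF that]]] by (rule dd_eq)
  have **: "dd (\<lambda>y. dd (\<lambda>y. f y \<bullet> i) y w) x z = dd (\<lambda>y. dd f y w) x z \<bullet> i" for w z
  proof -
    have "dd (\<lambda>y. dd (\<lambda>y. f y \<bullet> i) y w) x z = dd (\<lambda>y. dd f y w \<bullet> i) x z"
      by (rule dd_cong_at[OF assms(2,3)]) (simp add: *)
    also have "\<dots> = dd (\<lambda>y. dd f y w) x z \<bullet> i"
      by (rule dd_eq[OF bounded_linear.has_derivative[OF bl has_derivative_dd[OF d2]]])
    finally show ?thesis .
  qed
  show "dd (\<lambda>y. dd f y u) x v \<bullet> i = dd (\<lambda>y. dd f y v) x u \<bullet> i"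
    unfolding **[symmetric]
    by (rule dd_symmetric_real[OF Ck_on_linear_comp[OF bl assms(2,1)] assms(2,3)])
qed

text \<open>Differentiability of \<open>F\<close> is assumed for constant second arguments only;
  linearity supplies the rest through a basis expansion. The rule is relative to a set because
  solutions of differential equations are first obtained on closed intervals, with one-sided
  derivatives at the ends.\<close>

lemma has_derivative_family:
  fixes F :: "'a::real_normed_vector \<Rightarrow> 'e::euclidean_space \<Rightarrow> 'b::real_normed_vector"
  assumes U: "open U" "f t \<in> U" and lin: "\<And>y. y \<in> U \<Longrightarrow> linear (F y)"
    and diff: "\<And>v. (\<lambda>y. F y v) differentiable at (f t)"
    and f: "(f has_derivative f') (at t within S)" and u: "(u has_derivative u') (at t within S)"
    and t: "t \<in> S"
  shows "((\<lambda>s. F (f s) (u s)) has_derivative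
     (\<lambda>h. dd (\<lambda>y. F y (u t)) (f t) (f' h) + F (f t) (u' h))) (at t within S)"
proof -
  have F: "((\<lambda>s. F (f s) b) has_derivative (\<lambda>h. dd (\<lambda>y. F y b) (f t) (f' h))) (at t within S)" for b
    using has_derivative_compose[OF f has_derivative_dd[OF diff]] .
  have D: "((\<lambda>s. \<Sum>b\<in>Basis. (u s \<bullet> b) *\<^sub>R F (f s) b) has_derivative
    (\<lambda>h. \<Sum>b\<in>Basis. (u t \<bullet> b) *\<^sub>R dd (\<lambda>y. F y b) (f t) (f' h) + (u' h \<bullet> b) *\<^sub>R F (f t) b)) (at t within S)"
    by (intro has_derivative_sum has_derivative_scaleR has_derivative_inner_left u F)
  have lexp: "F y v = (\<Sum>b\<in>Basis. (v \<bullet> b) *\<^sub>R F y b)" if "y \<in> U" for y v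
    using linear_basis_expand[OF lin[OF that]] .
  have e1: "dd (\<lambda>y. F y v) (f t) w = (\<Sum>b\<in>Basis. (v \<bullet> b) *\<^sub>R dd (\<lambda>y. F y b) (f t) w)" for v w
  proof -
    have "dd (\<lambda>y. F y v) (f t) w = dd (\<lambda>y. \<Sum>b\<in>Basis. (v \<bullet> b) *\<^sub>R F y b) (f t) w"
      by (rule dd_cong_at[OF U]) (rule lexp)
    also have "\<dots> = (\<Sum>b\<in>Basis. (v \<bullet> b) *\<^sub>R dd (\<lambda>y. F y b) (f t) w)"
      by (rule dd_eq) (intro has_derivative_sum has_derivative_scaleR_right has_derivative_dd diff)
    finally show ?thesis .
  qed
  have "continuous (at t within S) f" using f has_derivative_continuous by blast
  then have "\<forall>\<^sub>F s in at t within S. f s \<in> U"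
    using U by (simp add: continuous_within topological_tendstoD)
  then have ev': "\<forall>\<^sub>F s in at t within S. (\<Sum>b\<in>Basis. (u s \<bullet> b) *\<^sub>R F (f s) b) = F (f s) (u s)"
    by eventually_elim (rule lexp[symmetric])
  have "((\<lambda>s. F (f s) (u s)) has_derivative
    (\<lambda>h. \<Sum>b\<in>Basis. (u t \<bullet> b) *\<^sub>R dd (\<lambda>y. F y b) (f t) (f' h) + (u' h \<bullet> b) *\<^sub>R F (f t) b)) (at t within S)"
    by (rule has_derivative_transform_eventually, rule D, rule ev', rule lexp[symmetric], rule U(2), rule t)
  then show ?thesis
    by (simp add: e1[of "u t"] sum.distrib lexp[OF U(2), of "u' _"])
qed

lemma has_derivative_family2:
  fixes F :: "'a::real_normed_vector \<Rightarrow> 'e::euclidean_space \<Rightarrow> 'f::euclidean_space \<Rightarrow> 'b::real_normed_vector"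
  assumes U: "open U" "f t \<in> U" and lin: "\<And>y v. y \<in> U \<Longrightarrow> linear (F y v)" "\<And>y w. y \<in> U \<Longrightarrow> linear (\<lambda>v. F y v w)"
    and diff: "\<And>v w. (\<lambda>y. F y v w) differentiable at (f t)"
    and f: "(f has_derivative f') (at t within S)" and u: "(u has_derivative u') (at t within S)"
    and w: "(w has_derivative w') (at t within S)"
    and t: "t \<in> S"
  shows "((\<lambda>s. F (f s) (u s) (w s)) has_derivative
     (\<lambda>h. dd (\<lambda>y. F y (u t) (w t)) (f t) (f' h) + F (f t) (u' h) (w t) + F (f t) (u t) (w' h))) (at t within S)"
proof -
  \<comment> \<open>Pairing the point with the first argument turns the bilinear family into a
    linear family over the product space, so the previous rule is used twice.\<close>
  have o: "open (U \<times> (UNIV :: 'e set))" using U(1) by (intro open_Times) auto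
  have F: "((\<lambda>p. F (fst p) (snd p) b) has_derivative
     (\<lambda>h. dd (\<lambda>y. F y (u t) b) (f t) (fst h) + F (f t) (snd h) b)) (at (f t, u t))" for b
    using has_derivative_family[where F="\<lambda>y v. F y v b" and f=fst and u=snd and f'=fst and u'=snd and t="(f t, u t)" and S=UNIV, OF U(1) _ lin(2)]
      U(2) diff has_derivative_fst[OF has_derivative_ident, of "at (f t, u t)"]
      has_derivative_snd[OF has_derivative_ident, of "at (f t, u t)"] by simp
  have "((\<lambda>s. F (fst (f s, u s)) (snd (f s, u s)) (w s)) has_derivative
     (\<lambda>h. dd (\<lambda>p. F (fst p) (snd p) (w t)) (f t, u t) (f' h, u' h) + F (fst (f t, u t)) (snd (f t, u t)) (w' h))) (at t within S)"
    by (rule has_derivative_family[where F="\<lambda>p. F (fst p) (snd p)" and f="\<lambda>s. (f s, u s)" and u=w, OF o])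
      (use U(2) lin(1) f u w t F in \<open>auto intro: has_derivative_Pair differentiableI\<close>)
  then show ?thesis by (simp add: dd_eq[OF F])
qed

section \<open>Regular dependence of solutions of linear equations on a parameter\<close>

lemma has_derivative_zero_scaleR:
  fixes c :: "'a::real_normed_vector \<Rightarrow> real"
  assumes d: "(d has_derivative d') (at x)" "d x = 0" and c: "continuous (at x) c" "c x = 0"
  shows "((\<lambda>y. c y *\<^sub>R d y) has_derivative (\<lambda>h. 0)) (at x)"
proof -
  obtain K where K: "K > 0" "\<And>h. norm (d' h) \<le> norm h * K"
    using bounded_linear.pos_bounded[OF has_derivative_bounded_linear[OF d(1)]] by blast
  have "\<exists>r>0. \<forall>y. norm (y - x) < r \<longrightarrow> norm (c y *\<^sub>R d y) \<le> e * norm (y - x)" if "e > 0" for e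
  proof -
    have "\<forall>e>0. \<exists>r>0. \<forall>y. norm (y - x) < r \<longrightarrow> norm (d y - d x - d' (y - x)) \<le> e * norm (y - x)"
      using d(1) unfolding has_derivative_at_alt by blast
    from this[rule_format, of 1]
    obtain r1 where r1: "r1 > 0" "\<And>y. norm (y - x) < r1 \<Longrightarrow> norm (d y - d' (y - x)) \<le> norm (y - x)"
      using d(2) by auto
    have "e / (1 + K) > 0" using that K(1) by simp
    with c(1) obtain r2 where "r2 > 0" "\<And>y. dist y x < r2 \<Longrightarrow> dist (c y) (c x) < e / (1 + K)"
      unfolding continuous_at_eps_delta by blast
    then have r2: "r2 > 0" "\<And>y. norm (y - x) < r2 \<Longrightarrow> \<bar>c y\<bar> < e / (1 + K)"
      using c(2) by (auto simp: dist_norm)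
    have "norm (c y *\<^sub>R d y) \<le> e * norm (y - x)" if y: "norm (y - x) < min r1 r2" for y
    proof -
      have "norm (d y) \<le> norm (d y - d' (y - x)) + norm (d' (y - x))"
        by (metis diff_add_cancel norm_triangle_ineq)
      also have "\<dots> \<le> (1 + K) * norm (y - x)" using r1(2)[of y] y K(2)[of "y - x"] by (simp add: algebra_simps)
      finally have "norm (d y) \<le> (1 + K) * norm (y - x)" .
      then have "\<bar>c y\<bar> * norm (d y) \<le> e / (1 + K) * ((1 + K) * norm (y - x))"
        using r2(2)[of y] y by (intro mult_mono) auto
      then show ?thesis using K(1) by simp
    qed
    then show ?thesis using r1(1) r2(1) by (metis min_less_iff_conj)
  qed
  then show ?thesis unfolding has_derivative_at_alt using c(2) by simp
qed

text \<open>Injectivity at \<open>x0\<close> bounds \<open>A x0\<close> below by \<open>m\<close>.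
  Nearby, the perturbation \<open>\<delta>\<close> of the operator is under \<open>m / 2\<close>, so
  \<open>A x\<close> is bounded below by \<open>m / 2\<close>, and \<open>z x - z x0\<close> is
  controlled by \<open>b x - A x (z x0)\<close>, which tends to 0.\<close>

lemma solve_continuous:
  fixes A :: "'x::real_normed_vector \<Rightarrow> 'e::euclidean_space \<Rightarrow> 'e"
  assumes S: "open S" "x0 \<in> S" and lin: "\<And>x. x \<in> S \<Longrightarrow> linear (A x)" and inj: "inj (A x0)"
    and A: "\<And>v. continuous (at x0) (\<lambda>x. A x v)" and b: "continuous (at x0) b"
    and eq: "\<And>x. x \<in> S \<Longrightarrow> A x (z x) = b x"
  shows "continuous (at x0) z"
proof -
  obtain m where m: "m > 0" "\<And>v. m * norm v \<le> norm (A x0 v)"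
    using linear_inj_bounded_below_pos[OF lin[OF S(2)] inj] by blast
  define \<delta> where "\<delta> = (\<lambda>x. \<Sum>i\<in>Basis. norm (A x i - A x0 i))"
  have "continuous (at x0) \<delta>" unfolding \<delta>_def by (intro continuous_intros A)
  then have "\<forall>\<^sub>F x in at x0. \<delta> x < m / 2"
    unfolding continuous_at using m(1) by (intro order_tendstoD(2)[where y="\<delta> x0"]) (auto simp: \<delta>_def)
  moreover have "\<forall>\<^sub>F x in at x0. x \<in> S" using S by (simp add: eventually_at_in_open')
  ultimately have ev: "\<forall>\<^sub>F x in at x0. norm (z x - z x0) \<le> 2 / m * norm (b x - A x (z x0))"
  proof eventually_elim
    case (elim x)
    have 1: "norm (A x v - A x0 v) \<le> \<delta> x * norm v" for v
    proof -
      have "A x v - A x0 v = (\<Sum>i\<in>Basis. (v \<bullet> i) *\<^sub>R (A x i - A x0 i))"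
        using linear_basis_expand[OF lin[OF elim(2)], of v] linear_basis_expand[OF lin[OF S(2)], of v]
        by (simp add: sum_subtractf scaleR_diff_right)
      also have "norm \<dots> \<le> (\<Sum>i\<in>Basis. norm (A x i - A x0 i) * norm v)"
        by (rule sum_norm_le) (simp add: mult.commute[of _ "norm v"] mult_right_mono Basis_le_norm)
      finally show ?thesis by (simp add: \<delta>_def sum_distrib_right)
    qed
    let ?v = "z x - z x0"
    have "m * norm ?v \<le> norm (A x0 ?v)" by (rule m)
    also have "\<dots> \<le> norm (A x ?v) + norm (A x ?v - A x0 ?v)"
      using norm_triangle_sub[of "A x0 ?v" "A x ?v"] by (simp add: norm_minus_commute)
    also have "\<dots> \<le> norm (A x ?v) + m / 2 * norm ?v"
      using 1[of ?v] elim(1) mult_right_mono[of "\<delta> x" "m/2" "norm ?v"] by simp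
    finally have "m / 2 * norm ?v \<le> norm (A x ?v)" by simp
    moreover have "A x ?v = b x - A x (z x0)" using linear_diff[OF lin[OF elim(2)]] eq[OF elim(2)] by simp
    ultimately show ?case using m(1) by (simp add: field_simps)
  qed
  have "((\<lambda>x. 2 / m * norm (b x - A x (z x0))) \<longlongrightarrow> 2 / m * norm (b x0 - A x0 (z x0))) (at x0)"
    using A b unfolding continuous_at by (intro tendsto_intros)
  then have "((\<lambda>x. 2 / m * norm (b x - A x (z x0))) \<longlongrightarrow> 0) (at x0)" unfolding eq[OF S(2)] by simp
  with ev have "((\<lambda>x. z x - z x0) \<longlongrightarrow> 0) (at x0)" by (rule Lim_null_comparison)
  then show ?thesis by (simp only: continuous_at LIM_zero_iff)
qed

text \<open>The equation is rewritten as \<open>A x0 (z x - z x0) = b x - A x (z x0) - e x\<close>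
  and solved with a fixed left inverse of \<open>A x0\<close>. The error \<open>e\<close> is built
  from products of a continuous and a differentiable factor, both vanishing at \<open>x0\<close>;
  such products have derivative 0, although \<open>z\<close> is so far only known to be
  continuous.\<close>

lemma solve_differentiable:
  fixes A :: "'x::real_normed_vector \<Rightarrow> 'e::euclidean_space \<Rightarrow> 'e"
  assumes S: "open S" "x0 \<in> S" and lin: "\<And>x. x \<in> S \<Longrightarrow> linear (A x)" and inj: "inj (A x0)"
    and A: "\<And>v. (\<lambda>x. A x v) differentiable at x0" and b: "b differentiable at x0"
    and eq: "\<And>x. x \<in> S \<Longrightarrow> A x (z x) = b x"
  shows "z differentiable at x0"
proof -
  have cz: "continuous (at x0) z"
    by (rule solve_continuous[where A=A and b=b and z=z and S=S, OF S lin inj _ _ eq])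
      (use A b differentiable_imp_continuous_within in auto)
  obtain B where B: "linear B" "\<And>v. B (A x0 v) = v"
    using linear_injective_left_inverse[OF lin[OF S(2)] inj] by (metis comp_apply id_apply)
  define e where "e = (\<lambda>x. \<Sum>i\<in>Basis. ((z x - z x0) \<bullet> i) *\<^sub>R (A x i - A x0 i))"
  have e: "(e has_derivative (\<lambda>h. \<Sum>i\<in>(Basis :: 'e set). 0)) (at x0)" unfolding e_def
  proof (intro has_derivative_sum)
    fix i :: 'e
    have "((\<lambda>x. A x i - A x0 i) has_derivative (\<lambda>v. dd (\<lambda>x. A x i) x0 v - 0)) (at x0)"
      by (intro has_derivative_diff has_derivative_dd A has_derivative_const)
    then show "((\<lambda>x. ((z x - z x0) \<bullet> i) *\<^sub>R (A x i - A x0 i)) has_derivative (\<lambda>h. 0)) (at x0)"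
      by (rule has_derivative_zero_scaleR) (auto intro!: continuous_intros cz)
  qed
  let ?f = "\<lambda>x. z x0 + B (b x - A x (z x0) - e x)"
  have "?f x = z x" if x: "x \<in> S" for x
  proof -
    have "e x = A x (z x - z x0) - A x0 (z x - z x0)"
      using linear_basis_expand[OF lin[OF x], of "z x - z x0"] linear_basis_expand[OF lin[OF S(2)], of "z x - z x0"]
      by (simp add: e_def sum_subtractf scaleR_diff_right)
    then have "b x - A x (z x0) - e x = A x0 (z x - z x0)"
      using eq[OF x] linear_diff[OF lin[OF x]] by simp
    then show ?thesis using B(2) by simp
  qed
  moreover have "?f differentiable at x0"
  proof -
    have "(\<lambda>x. b x - A x (z x0) - e x) differentiable at x0"
      using e by (intro differentiable_diff A b) (auto simp: differentiable_def)
    then obtain D where "((\<lambda>x. b x - A x (z x0) - e x) has_derivative D) (at x0)" unfolding differentiable_def ..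
    from has_derivative_add[OF has_derivative_const bounded_linear.has_derivative[OF linear_conv_bounded_linear[THEN iffD1, OF B(1)] this]]
    show ?thesis by (rule differentiableI)
  qed
  ultimately show ?thesis using differentiable_cong_open[OF S, of ?f z] by blast
qed

lemma linear_dd_family:
  fixes F :: "'a::real_normed_vector \<Rightarrow> 'e::real_normed_vector \<Rightarrow> 'b::real_normed_vector"
  assumes "open U" "x \<in> U" "\<And>y. y \<in> U \<Longrightarrow> linear (F y)" "\<And>v. (\<lambda>y. F y v) differentiable at x"
  shows "linear (\<lambda>v. dd (\<lambda>y. F y v) x h)"
proof (rule linearI)
  fix a c :: 'e and r :: real
  have "dd (\<lambda>y. F y (a + c)) x h = dd (\<lambda>y. F y a + F y c) x h"
    by (rule dd_cong_at[OF assms(1,2)]) (simp add: assms(3) linear_add)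
  also have "\<dots> = dd (\<lambda>y. F y a) x h + dd (\<lambda>y. F y c) x h"
    by (rule dd_eq) (intro has_derivative_add has_derivative_dd assms(4))
  finally show "dd (\<lambda>y. F y (a + c)) x h = dd (\<lambda>y. F y a) x h + dd (\<lambda>y. F y c) x h" .
  have "dd (\<lambda>y. F y (r *\<^sub>R a)) x h = dd (\<lambda>y. r *\<^sub>R F y a) x h"
    by (rule dd_cong_at[OF assms(1,2)]) (simp add: assms(3) linear_scale)
  also have "\<dots> = r *\<^sub>R dd (\<lambda>y. F y a) x h"
    by (rule dd_eq) (intro has_derivative_scaleR_right has_derivative_dd assms(4))
  finally show "dd (\<lambda>y. F y (r *\<^sub>R a)) x h = r *\<^sub>R dd (\<lambda>y. F y a) x h" .
qed

text \<open>Differentiating \<open>A x (z x) = b x\<close> gives an equation for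
  \<open>dd z x v\<close> with the same operator and a right-hand side containing \<open>z\<close>
  itself. The induction therefore varies \<open>b\<close> and \<open>z\<close>, and first secures
  the lower regularity of \<open>z\<close>.\<close>

lemma Ck_on_solve:
  fixes A :: "'x::real_normed_vector \<Rightarrow> 'e::euclidean_space \<Rightarrow> 'e"
  assumes S: "open S" and lin: "\<And>x. x \<in> S \<Longrightarrow> linear (A x)" and inj: "\<And>x. x \<in> S \<Longrightarrow> inj (A x)"
    and A: "\<And>v. Ck_on k S (\<lambda>x. A x v)" and b: "Ck_on k S b"
    and eq: "\<And>x. x \<in> S \<Longrightarrow> A x (z x) = b x"
  shows "Ck_on k S z"
  using A b eq
proof (induction k arbitrary: b z)
  case 0
  have "continuous (at x) z" if "x \<in> S" for x
  proof (rule solve_continuous[where A=A and b=b and z=z and S=S, OF S that lin inj[OF that] _ _ 0(3)])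
    show "continuous (at x) (\<lambda>x. A x v)" for v
      using 0(1)[of v] that S by (simp add: continuous_on_eq_continuous_at)
    show "continuous (at x) b" using 0(2) that S by (simp add: continuous_on_eq_continuous_at)
  qed
  then show ?case by (simp add: continuous_at_imp_continuous_on)
next
  case (Suc k)
  have dA: "(\<lambda>x. A x v) differentiable at x" and db: "b differentiable at x" if "x \<in> S" for x v
    using Suc.prems(1)[of v] Suc.prems(2) that by auto
  have dz: "z differentiable at x" if "x \<in> S" for x
    by (rule solve_differentiable[where A=A and b=b and z=z and S=S, OF S that lin inj[OF that] dA[OF that] db[OF that] Suc.prems(3)])
  have A': "Ck_on k S (\<lambda>x. A x v)" for v using Ck_on_Suc_imp[OF Suc.prems(1)] .
  have zk: "Ck_on k S z" by (rule Suc.IH[OF A' Ck_on_Suc_imp[OF Suc.prems(2)] Suc.prems(3)])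
  have "Ck_on k S (\<lambda>x. dd z x v)" for v
  proof (rule Suc.IH[OF A'])
    have "linear (\<lambda>w. dd (\<lambda>y. A y w) x v)" if "x \<in> S" for x
      by (rule linear_dd_family[OF S that lin dA[OF that]])
    moreover have "Ck_on k S (\<lambda>x. dd (\<lambda>y. A y w) x v)" for w using Suc.prems(1)[of w] by simp
    ultimately have "Ck_on k S (\<lambda>x. dd (\<lambda>y. A y (z x)) x v)"
      using Ck_on_family[OF S, of "\<lambda>x w. dd (\<lambda>y. A y w) x v" k z] zk by blast
    then show "Ck_on k S (\<lambda>x. dd b x v - dd (\<lambda>y. A y (z x)) x v)"
      using Suc.prems(2) by (intro Ck_on_diff S) auto
  next
    fix x assume x: "x \<in> S"
    have "((\<lambda>s. A s (z s)) has_derivative (\<lambda>h. dd (\<lambda>y. A y (z x)) x h + A x (dd z x h))) (at x)"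
      using has_derivative_family[where f="\<lambda>s. s" and S=UNIV, OF S x lin dA[OF x] has_derivative_ident has_derivative_dd[OF dz[OF x]]]
      by simp
    from dd_eq[OF this] have "dd (\<lambda>s. A s (z s)) x v = dd (\<lambda>y. A y (z x)) x v + A x (dd z x v)" .
    moreover have "dd (\<lambda>s. A s (z s)) x v = dd b x v" by (rule dd_cong_at[OF S x Suc.prems(3)])
    ultimately show "A x (dd z x v) = dd b x v - dd (\<lambda>y. A y (z x)) x v" by simp
  qed
  then show ?case using dz by simp
qed

section \<open>Riemannian metrics in coordinates\<close>

text \<open>The Christoffel symbols of an arbitrary function \<open>G\<close> in place of
  \<open>metric_coord A g c\<close>, so that the tensor calculus can be done without charts;
  \<open>christoffel_eq\<close> makes the link.\<close>

definition chris :: "('e::euclidean_space \<Rightarrow> 'e \<Rightarrow> 'e \<Rightarrow> real) \<Rightarrow> 'e \<Rightarrow> 'e \<Rightarrow> 'e \<Rightarrow> 'e" where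
  "chris G x u v = (THE z. \<forall>w. 2 * G x z w =
     dd (\<lambda>y. G y v w) x u + dd (\<lambda>y. G y u w) x v - dd (\<lambda>y. G y u v) x w)"

definition riem :: "('e::euclidean_space \<Rightarrow> 'e \<Rightarrow> 'e \<Rightarrow> 'e) \<Rightarrow> 'e \<Rightarrow> 'e \<Rightarrow> 'e \<Rightarrow> 'e \<Rightarrow> 'e" where
  "riem \<Gamma> x u v w = dd (\<lambda>y. \<Gamma> y v w) x u - dd (\<lambda>y. \<Gamma> y u w) x v
     + \<Gamma> x u (\<Gamma> x v w) - \<Gamma> x v (\<Gamma> x u w)"

locale coord_metric =
  fixes U :: "'e::euclidean_space set" and G :: "'e \<Rightarrow> 'e \<Rightarrow> 'e \<Rightarrow> real"
  assumes open_U: "open U"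
    and smooth_G: "smooth_on U (\<lambda>x. G x u v)"
    and G_sym: "x \<in> U \<Longrightarrow> G x u v = G x v u"
    and G_linear: "x \<in> U \<Longrightarrow> linear (\<lambda>u. G x u v)"
    and G_pos: "x \<in> U \<Longrightarrow> u \<noteq> 0 \<Longrightarrow> G x u u > 0"
begin

abbreviation \<Gamma> where "\<Gamma> \<equiv> chris G"
abbreviation R where "R \<equiv> riem (chris G)"

lemma G_linear2: "x \<in> U \<Longrightarrow> linear (\<lambda>v. G x u v)"
  using G_linear[of x u] G_sym[of x u] by simp

lemmas G_add = linear_add[OF G_linear] linear_add[OF G_linear2]
lemmas G_diff = linear_diff[OF G_linear] linear_diff[OF G_linear2]
lemmas G_scale = linear_scale[OF G_linear] linear_scale[OF G_linear2]
lemmas G_zero = linear_0[OF G_linear] linear_0[OF G_linear2]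
lemmas G_neg = linear_neg[OF G_linear] linear_neg[OF G_linear2]

lemma G_diffable: "x \<in> U \<Longrightarrow> (\<lambda>y. G y u v) differentiable at x"
  using smooth_G smooth_on_differentiable by blast

lemma G_eqI:
  assumes "x \<in> U" "\<And>w. G x z w = G x z' w" shows "z = z'"
proof (rule ccontr)
  assume "z \<noteq> z'"
  then have "G x (z - z') (z - z') > 0" using G_pos assms(1) by simp
  then show False using assms(2)[of "z - z'"] G_diff(1)[OF assms(1)] by simp
qed

text \<open>The vector representing the form \<open>G x u\<close> in the standard inner product,
  that is, the Gram matrix applied to \<open>u\<close>. Its invertibility solves the Koszul formula,
  and its smoothness in \<open>x\<close> passes to the solution.\<close>

definition flat :: "'e \<Rightarrow> 'e \<Rightarrow> 'e" where "flat x u = (\<Sum>i\<in>Basis. G x u i *\<^sub>R i)"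

lemma flat_inner: "x \<in> U \<Longrightarrow> flat x u \<bullet> w = G x u w"
  unfolding flat_def inner_sum_left
  by (subst linear_basis_expand[OF G_linear2, of x u w]) (auto simp: mult.commute inner_commute)

lemma flat_linear: "x \<in> U \<Longrightarrow> linear (flat x)"
  unfolding flat_def
  by (intro linearI) (auto simp: G_add G_scale scaleR_left_distrib sum.distrib scaleR_sum_right)

lemma flat_inj: "x \<in> U \<Longrightarrow> inj (flat x)"
  by (rule injI) (metis G_eqI flat_inner)

lemma sharp_ex:
  assumes x: "x \<in> U" and l: "linear l"
  obtains z where "\<And>w. G x z w = l w"
proof -
  have "surj (flat x)" using linear_inj_imp_surj[OF flat_linear flat_inj] x by blast
  then obtain z where z: "flat x z = (\<Sum>i\<in>Basis. l i *\<^sub>R i)" by (metis surjD)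
  have "G x z w = l w" for w
    unfolding flat_inner[OF x, symmetric] z inner_sum_left
    by (subst linear_basis_expand[OF l, of w]) (auto simp: mult.commute inner_commute)
  then show thesis using that by blast
qed

definition dG :: "'e \<Rightarrow> 'e \<Rightarrow> 'e \<Rightarrow> 'e \<Rightarrow> real" where "dG x u v w = dd (\<lambda>y. G y v w) x u"

lemma dG_linear:
  assumes "x \<in> U"
  shows "linear (\<lambda>u. dG x u v w)" "linear (\<lambda>v. dG x u v w)" "linear (\<lambda>w. dG x u v w)"
  unfolding dG_def
  using linear_dd[OF G_diffable] linear_dd_family[OF open_U assms, of "\<lambda>y v. G y v w"]
    linear_dd_family[OF open_U assms, of "\<lambda>y. G y v"] G_linear G_linear2 G_diffable assms by auto

lemmas dG_add = dG_linear[THEN linear_add]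
lemmas dG_scale = dG_linear[THEN linear_scale]

lemma dG_sym: "x \<in> U \<Longrightarrow> dG x u v w = dG x u w v"
  unfolding dG_def by (rule dd_cong_at[OF open_U]) (auto intro: G_sym)

text \<open>Discharges the definite description: the right-hand side is linear in \<open>w\<close>,
  so it is represented by a vector, and positivity makes that vector unique.\<close>

lemma koszul:
  assumes x: "x \<in> U"
  shows "2 * G x (\<Gamma> x u v) w = dG x u v w + dG x v u w - dG x w u v"
proof -
  have "linear (\<lambda>w. (dG x u v w + dG x v u w - dG x w u v) / 2)"
    by (intro linearI) (simp_all add: dG_add[OF x] dG_scale[OF x] field_simps)
  then obtain z where z: "\<And>w. G x z w = (dG x u v w + dG x v u w - dG x w u v) / 2"
    using sharp_ex[OF x] by blast
  have "\<Gamma> x u v = z" unfolding chris_def dG_def[symmetric]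
  proof (rule the_equality)
    show "\<forall>w. 2 * G x z w = dG x u v w + dG x v u w - dG x w u v" unfolding z by simp
    fix z' assume "\<forall>w. 2 * G x z' w = dG x u v w + dG x v u w - dG x w u v"
    then show "z' = z" by (intro G_eqI[OF x]) (simp add: z field_simps)
  qed
  then show ?thesis unfolding z by (simp add: z)
qed

lemma \<Gamma>_sym: "x \<in> U \<Longrightarrow> \<Gamma> x u v = \<Gamma> x v u"
proof (rule G_eqI)
  fix w assume "x \<in> U"
  then show "G x (\<Gamma> x u v) w = G x (\<Gamma> x v u) w"
    using koszul[of x u v w] koszul[of x v u w] dG_sym[of x w v u] by simp
qed

lemma \<Gamma>_linear: assumes x: "x \<in> U" shows "linear (\<lambda>u. \<Gamma> x u v)"
proof (rule linearI; rule G_eqI[OF x])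
  fix a b w
  have "2 * G x (\<Gamma> x (a + b) v) w = 2 * G x (\<Gamma> x a v + \<Gamma> x b v) w"
    unfolding G_add(1)[OF x] distrib_left koszul[OF x] by (simp add: dG_add[OF x])
  then show "G x (\<Gamma> x (a + b) v) w = G x (\<Gamma> x a v + \<Gamma> x b v) w" by simp
next
  fix r a w
  have "2 * G x (\<Gamma> x (r *\<^sub>R a) v) w = r * (2 * G x (\<Gamma> x a v) w)"
    unfolding koszul[OF x] by (simp add: dG_scale[OF x] algebra_simps)
  then show "G x (\<Gamma> x (r *\<^sub>R a) v) w = G x (r *\<^sub>R \<Gamma> x a v) w" using G_scale(1)[OF x] by simp
qed

lemma \<Gamma>_linear2: "x \<in> U \<Longrightarrow> linear (\<lambda>v. \<Gamma> x u v)"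
  using \<Gamma>_linear[of x u] \<Gamma>_sym[of x u] by simp

lemmas \<Gamma>_add = linear_add[OF \<Gamma>_linear] linear_add[OF \<Gamma>_linear2]
lemmas \<Gamma>_diff = linear_diff[OF \<Gamma>_linear] linear_diff[OF \<Gamma>_linear2]
lemmas \<Gamma>_scale = linear_scale[OF \<Gamma>_linear] linear_scale[OF \<Gamma>_linear2]

text \<open>The symbols solve the linear system with operator \<open>flat x\<close> and half the
  Koszul expression as right-hand side; smooth coefficients give smooth solutions.\<close>

lemma Ck_\<Gamma>: "Ck_on k U (\<lambda>x. \<Gamma> x u v)"
proof (rule Ck_on_solve[OF open_U flat_linear flat_inj])
  show "Ck_on k U (\<lambda>x. flat x w)" for w unfolding flat_def
    by (intro Ck_on_sum Ck_on_scaleR open_U smooth_onD[OF smooth_G] Ck_on_const)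
  show "Ck_on k U (\<lambda>x. \<Sum>i\<in>Basis. ((1/2) * (dG x u v i + dG x v u i - dG x i u v)) *\<^sub>R i)" unfolding dG_def
    by (intro Ck_on_sum Ck_on_scaleR Ck_on_mult Ck_on_add Ck_on_diff open_U Ck_on_const smooth_onD[OF smooth_on_dd[OF smooth_G]])
  show "flat x (\<Gamma> x u v) = (\<Sum>i\<in>Basis. ((1/2) * (dG x u v i + dG x v u i - dG x i u v)) *\<^sub>R i)" if "x \<in> U" for x
    unfolding flat_def koszul[OF that, symmetric] by simp
qed

lemma smooth_\<Gamma>: "smooth_on U (\<lambda>x. \<Gamma> x u v)"
  by (rule smooth_onI[OF Ck_\<Gamma>])

lemma \<Gamma>_diffable: "x \<in> U \<Longrightarrow> (\<lambda>y. \<Gamma> y u v) differentiable at x"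
  using smooth_\<Gamma> smooth_on_differentiable by blast

text \<open>Metric compatibility of the connection: in the sum of the Koszul formulas for
  \<open>(u, v, w)\<close> and \<open>(u, w, v)\<close> the terms differentiated along
  \<open>v\<close> and \<open>w\<close> cancel.\<close>

lemma compat:
  assumes "x \<in> U" shows "dG x u v w = G x (\<Gamma> x u v) w + G x v (\<Gamma> x u w)"
  using koszul[OF assms, of u v w] koszul[OF assms, of u w v] G_sym[OF assms, of v "\<Gamma> x u w"]
    dG_sym[OF assms, of u v w] dG_sym[OF assms, of v u w] dG_sym[OF assms, of w u v] by linarith

definition d\<Gamma> :: "'e \<Rightarrow> 'e \<Rightarrow> 'e \<Rightarrow> 'e \<Rightarrow> 'e" where "d\<Gamma> x u v w = dd (\<lambda>y. \<Gamma> y v w) x u"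

lemma d\<Gamma>_linear:
  assumes "x \<in> U"
  shows "linear (\<lambda>u. d\<Gamma> x u v w)" "linear (\<lambda>v. d\<Gamma> x u v w)" "linear (\<lambda>w. d\<Gamma> x u v w)"
  unfolding d\<Gamma>_def
  using linear_dd[OF \<Gamma>_diffable] linear_dd_family[OF open_U assms, of "\<lambda>y v. \<Gamma> y v w"]
    linear_dd_family[OF open_U assms, of "\<lambda>y. \<Gamma> y v"] \<Gamma>_linear \<Gamma>_linear2 \<Gamma>_diffable assms by auto

lemmas d\<Gamma>_add = d\<Gamma>_linear[THEN linear_add]
lemmas d\<Gamma>_scale = d\<Gamma>_linear[THEN linear_scale]

lemma d\<Gamma>_sym: "x \<in> U \<Longrightarrow> d\<Gamma> x u v w = d\<Gamma> x u w v"
  unfolding d\<Gamma>_def by (rule dd_cong_at[OF open_U]) (auto intro: \<Gamma>_sym)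

lemma R_alt: "R x u v w = d\<Gamma> x u v w - d\<Gamma> x v u w + \<Gamma> x u (\<Gamma> x v w) - \<Gamma> x v (\<Gamma> x u w)"
  by (simp add: riem_def d\<Gamma>_def)

lemma R_linear:
  assumes "x \<in> U"
  shows "linear (\<lambda>u. R x u v w)" "linear (\<lambda>v. R x u v w)" "linear (\<lambda>w. R x u v w)"
  unfolding R_alt
  by (auto intro!: linearI simp: d\<Gamma>_add[OF assms] \<Gamma>_add[OF assms] d\<Gamma>_scale[OF assms] \<Gamma>_scale[OF assms] algebra_simps)

lemma R_antisym: "R x u v w = - R x v u w"
  by (simp add: R_alt)

lemma bianchi: "x \<in> U \<Longrightarrow> R x u v w + R x v w u + R x w u v = 0"
  unfolding R_alt using d\<Gamma>_sym[of x] \<Gamma>_sym[of x v w] \<Gamma>_sym[of x u w] \<Gamma>_sym[of x u v]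
    d\<Gamma>_sym[of x u v w] d\<Gamma>_sym[of x v u w] d\<Gamma>_sym[of x w u v] by simp

text \<open>Metric compatibility, differentiated once more. Exchanging \<open>u\<close> and
  \<open>v\<close> leaves the left-hand side unchanged, and what the exchange changes on the right
  are exactly the curvature terms of \<open>R_skew\<close>.\<close>

lemma d2G:
  assumes x: "x \<in> U"
  shows "dd (\<lambda>y. dd (\<lambda>y. G y w z) y v) x u =
    G x (\<Gamma> x u (\<Gamma> x v w)) z + G x (\<Gamma> x v w) (\<Gamma> x u z) + G x (d\<Gamma> x u v w) z
    + G x (\<Gamma> x u w) (\<Gamma> x v z) + G x w (\<Gamma> x u (\<Gamma> x v z)) + G x w (d\<Gamma> x u v z)"
proof -
  have 1: "dd (\<lambda>y. dd (\<lambda>y. G y w z) y v) x u = dd (\<lambda>y. G y (\<Gamma> y v w) z + G y w (\<Gamma> y v z)) x u"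
    by (rule dd_cong_at[OF open_U x]) (simp add: compat dG_def[symmetric])
  have \<Gamma>': "((\<lambda>y. \<Gamma> y a b) has_derivative (\<lambda>u. d\<Gamma> x u a b)) (at x)" for a b
    unfolding d\<Gamma>_def by (rule has_derivative_dd[OF \<Gamma>_diffable[OF x]])
  have 2: "((\<lambda>y. G y (\<Gamma> y v w) z) has_derivative (\<lambda>u. dG x u (\<Gamma> x v w) z + G x (d\<Gamma> x u v w) z)) (at x)"
    using has_derivative_family[where F="\<lambda>y a. G y a z" and f="\<lambda>s. s" and S=UNIV, OF open_U x G_linear G_diffable[OF x] has_derivative_ident \<Gamma>']
    by (simp add: dG_def)
  have 3: "((\<lambda>y. G y w (\<Gamma> y v z)) has_derivative (\<lambda>u. dG x u w (\<Gamma> x v z) + G x w (d\<Gamma> x u v z))) (at x)"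
    using has_derivative_family[where F="\<lambda>y a. G y w a" and f="\<lambda>s. s" and S=UNIV, OF open_U x G_linear2 G_diffable[OF x] has_derivative_ident \<Gamma>']
    by (simp add: dG_def)
  show ?thesis unfolding 1 dd_eq[OF has_derivative_add[OF 2 3]] by (simp add: compat[OF x])
qed

lemma R_skew:
  assumes x: "x \<in> U" shows "G x (R x u v w) z = - G x w (R x u v z)"
proof -
  have "dd (\<lambda>y. dd (\<lambda>y. G y w z) y v) x u = dd (\<lambda>y. dd (\<lambda>y. G y w z) y u) x v"
    by (rule dd_symmetric[OF smooth_onD[OF smooth_G] open_U x])
  then show ?thesis unfolding d2G[OF x] R_alt by (simp add: G_add[OF x] G_diff[OF x])
qed

text \<open>An instance of the pair symmetry of the curvature tensor, a linear consequence of the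
  two antisymmetries and the Bianchi identity. It is the source of the symmetric coefficient matrix
  in the Jacobi equation.\<close>

lemma R_self_adjoint:
  assumes x: "x \<in> U" shows "G x (R x u v v) w = G x u (R x w v v)"
proof -
  define Q where "Q = (\<lambda>a b c d. G x (R x a b c) d)"
  have a1: "Q a b c d = - Q b a c d" for a b c d
    unfolding Q_def R_antisym[of x a b] G_neg[OF x] by simp
  have a2: "Q a b c d = - Q a b d c" for a b c d
    unfolding Q_def using R_skew[OF x, of a b c d] G_sym[OF x] by simp
  have b: "Q a b c d + Q b c a d + Q c a b d = 0" for a b c d
    unfolding Q_def using bianchi[OF x, of a b c] by (simp add: G_add(1)[OF x, symmetric] G_zero[OF x])
  have "Q u v v w = Q w v v u"
    using b[of u v v w] b[of v w u v] b[of u v w v] b[of w v u v] b[of w v v u] a1 a2 by smt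
  then show ?thesis unfolding Q_def using G_sym[OF x] by simp
qed

lemma R_self: "x \<in> U \<Longrightarrow> G x (R x u v v) v = 0"
  using R_skew[of x u v v v] G_sym[of x] by simp

lemma Ck_R: "Ck_on k U (\<lambda>x. R x u v w)"
proof -
  have "Ck_on k U (\<lambda>x. \<Gamma> x a (\<Gamma> x b c))" for a b c
    by (rule Ck_on_family[where F="\<lambda>x. \<Gamma> x a", OF open_U \<Gamma>_linear2 Ck_\<Gamma> Ck_\<Gamma>])
  then show ?thesis unfolding riem_def
    by (intro Ck_on_add Ck_on_diff open_U smooth_onD[OF smooth_on_dd[OF smooth_\<Gamma>]])
qed

end

section \<open>Transformation laws under isometries between coordinate metrics\<close>

locale coord_isometry = G: coord_metric U G + H: coord_metric V H
  for U and G :: "'e::euclidean_space \<Rightarrow> 'e \<Rightarrow> 'e \<Rightarrow> real" and V and H :: "'e::euclidean_space \<Rightarrow> 'e \<Rightarrow> 'e \<Rightarrow> real" +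
  fixes W \<phi>
  assumes open_W: "open W" and WU: "W \<subseteq> U" and WV: "\<phi> ` W \<subseteq> V"
    and smooth_\<phi>: "smooth_on W \<phi>"
    and inj_d\<phi>: "x \<in> W \<Longrightarrow> inj (\<lambda>v. dd \<phi> x v)"
    and isom: "x \<in> W \<Longrightarrow> G x u v = H (\<phi> x) (dd \<phi> x u) (dd \<phi> x v)"
begin

definition D2 where "D2 x u v = dd (\<lambda>y. dd \<phi> y v) x u"

lemma \<phi>_diffable: "x \<in> W \<Longrightarrow> \<phi> differentiable at x"
  using smooth_on_differentiable[OF smooth_\<phi>] .

lemma d\<phi>_diffable: "x \<in> W \<Longrightarrow> (\<lambda>y. dd \<phi> y v) differentiable at x"
  using smooth_on_differentiable[OF smooth_on_dd[OF smooth_\<phi>]] .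

lemma d\<phi>_linear: "x \<in> W \<Longrightarrow> linear (\<lambda>v. dd \<phi> x v)"
  using linear_dd \<phi>_diffable by blast

lemma D2_sym: "x \<in> W \<Longrightarrow> D2 x u v = D2 x v u"
  unfolding D2_def by (rule dd_symmetric[OF smooth_onD[OF smooth_\<phi>] open_W])

text \<open>Differentiating the isometry condition produces two extra \<open>D2\<close> terms in
  each \<open>dG\<close>. In the Koszul combination four of the six cancel by symmetry of
  \<open>D2\<close>, and the other two give the inhomogeneous term. Testing against vectors
  \<open>dd \<phi> x w\<close> suffices, these being all vectors.\<close>

lemma chris_law:
  assumes x: "x \<in> W"
  shows "chris H (\<phi> x) (dd \<phi> x u) (dd \<phi> x v) = dd \<phi> x (chris G x u v) - D2 x u v"
proof -
  let ?d = "\<lambda>v. dd \<phi> x v"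
  have xU: "x \<in> U" and xV: "\<phi> x \<in> V" using x WU WV by auto
  have dG: "G.dG x u v w = H.dG (\<phi> x) (?d u) (?d v) (?d w) + H (\<phi> x) (D2 x u v) (?d w) + H (\<phi> x) (?d v) (D2 x u w)" for u v w
  proof -
    have "((\<lambda>s. H (\<phi> s) (dd \<phi> s v) (dd \<phi> s w)) has_derivative
     (\<lambda>h. dd (\<lambda>y. H y (?d v) (?d w)) (\<phi> x) (?d h) + H (\<phi> x) (dd (\<lambda>y. dd \<phi> y v) x h) (?d w) + H (\<phi> x) (?d v) (dd (\<lambda>y. dd \<phi> y w) x h))) (at x)"
      by (rule has_derivative_family2[where f=\<phi> and t=x and F=H, OF H.open_U xV])
        (auto intro!: H.G_linear H.G_linear2 H.G_diffable xV has_derivative_dd \<phi>_diffable d\<phi>_diffable x)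
    from dd_eq[OF this] have "dd (\<lambda>s. H (\<phi> s) (dd \<phi> s v) (dd \<phi> s w)) x u =
      H.dG (\<phi> x) (?d u) (?d v) (?d w) + H (\<phi> x) (D2 x u v) (?d w) + H (\<phi> x) (?d v) (D2 x u w)"
      by (simp add: H.dG_def D2_def)
    moreover have "G.dG x u v w = dd (\<lambda>s. H (\<phi> s) (dd \<phi> s v) (dd \<phi> s w)) x u"
      unfolding G.dG_def by (rule dd_cong_at[OF open_W x isom])
    ultimately show ?thesis by simp
  qed
  have "H (\<phi> x) (chris H (\<phi> x) (?d u) (?d v)) z = H (\<phi> x) (?d (chris G x u v) - D2 x u v) z" for z
  proof -
    have "surj ?d" using linear_inj_imp_surj[OF d\<phi>_linear inj_d\<phi>] x by blast
    then obtain w where w: "z = ?d w" by (metis surjD)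
    have "2 * H (\<phi> x) (?d (chris G x u v)) (?d w) = 2 * G x (chris G x u v) w" using isom[OF x] by simp
    also have "\<dots> = 2 * H (\<phi> x) (chris H (\<phi> x) (?d u) (?d v)) (?d w) + 2 * H (\<phi> x) (D2 x u v) (?d w)"
      unfolding G.koszul[OF xU] H.koszul[OF xV] dG
      using D2_sym[OF x] H.G_sym[OF xV] by (simp add: algebra_simps)
    finally show ?thesis unfolding w by (simp add: H.G_diff[OF xV])
  qed
  then show ?thesis by (rule H.G_eqI[OF xV])
qed

text \<open>The derivative of \<open>chris_law\<close> in direction \<open>u\<close>, with both
  sides expanded by the product rules for linear families.\<close>

lemma d_chris_law:
  assumes x: "x \<in> W"
  shows "H.d\<Gamma> (\<phi> x) (dd \<phi> x u) (dd \<phi> x v) (dd \<phi> x w) + chris H (\<phi> x) (D2 x u v) (dd \<phi> x w)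
      + chris H (\<phi> x) (dd \<phi> x v) (D2 x u w)
    = D2 x u (chris G x v w) + dd \<phi> x (G.d\<Gamma> x u v w) - dd (\<lambda>y. D2 y v w) x u"
proof -
  let ?d = "\<lambda>v. dd \<phi> x v"
  have xU: "x \<in> U" and xV: "\<phi> x \<in> V" using x WU WV by auto
  have 1: "((\<lambda>s. chris H (\<phi> s) (dd \<phi> s v) (dd \<phi> s w)) has_derivative
     (\<lambda>h. dd (\<lambda>y. chris H y (?d v) (?d w)) (\<phi> x) (?d h) + chris H (\<phi> x) (dd (\<lambda>y. dd \<phi> y v) x h) (?d w) + chris H (\<phi> x) (?d v) (dd (\<lambda>y. dd \<phi> y w) x h))) (at x)"
    by (rule has_derivative_family2[where f=\<phi> and t=x and F="chris H", OF H.open_U xV])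
      (auto intro!: H.\<Gamma>_linear H.\<Gamma>_linear2 H.\<Gamma>_diffable xV has_derivative_dd \<phi>_diffable d\<phi>_diffable x)
  have 2: "((\<lambda>s. dd \<phi> s (chris G s v w)) has_derivative
     (\<lambda>h. dd (\<lambda>y. dd \<phi> y (chris G x v w)) x h + ?d (dd (\<lambda>y. chris G y v w) x h))) (at x)"
    using has_derivative_family[where F="\<lambda>y. dd \<phi> y" and f="\<lambda>s. s" and S=UNIV, OF open_W x d\<phi>_linear d\<phi>_diffable[OF x] has_derivative_ident has_derivative_dd[OF G.\<Gamma>_diffable[OF xU]]]
    by simp
  have 3: "(\<lambda>y. D2 y v w) differentiable at x" unfolding D2_def
    using smooth_on_differentiable[OF smooth_on_dd[OF smooth_on_dd[OF smooth_\<phi>]] x] .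
  have "dd (\<lambda>s. chris H (\<phi> s) (dd \<phi> s v) (dd \<phi> s w)) x u = dd (\<lambda>s. dd \<phi> s (chris G s v w) - D2 s v w) x u"
    by (rule dd_cong_at[OF open_W x chris_law])
  then show ?thesis unfolding dd_eq[OF 1] dd_eq[OF has_derivative_diff[OF 2 has_derivative_dd[OF 3]]]
    by (simp add: H.d\<Gamma>_def G.d\<Gamma>_def D2_def)
qed

text \<open>Tensoriality of the curvature: after antisymmetrization in \<open>u\<close> and
  \<open>v\<close> the third derivatives of \<phi> cancel, and \<open>chris_law\<close> eliminates
  the second derivatives.\<close>

lemma riem_law:
  assumes x: "x \<in> W"
  shows "riem (chris H) (\<phi> x) (dd \<phi> x u) (dd \<phi> x v) (dd \<phi> x w) = dd \<phi> x (riem (chris G) x u v w)"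
proof -
  let ?d = "\<lambda>v. dd \<phi> x v" and ?K = "chris H (\<phi> x)" and ?\<Gamma> = "chris G x"
  have xU: "x \<in> U" and xV: "\<phi> x \<in> V" using x WU WV by auto
  have D3: "dd (\<lambda>y. D2 y v w) x u = dd (\<lambda>y. D2 y u w) x v" unfolding D2_def
    by (rule dd_symmetric[OF smooth_onD[OF smooth_on_dd[OF smooth_\<phi>]] open_W x])
  have K: "?K (?d a) (D2 x b w) = ?d (?\<Gamma> a (?\<Gamma> b w)) - D2 x a (?\<Gamma> b w) - ?K (?d a) (?K (?d b) (?d w))" for a b
  proof -
    have "D2 x b w = ?d (?\<Gamma> b w) - ?K (?d b) (?d w)" using chris_law[OF x, of b w] by simp
    then show ?thesis by (simp add: H.\<Gamma>_diff[OF xV] chris_law[OF x, of a "?\<Gamma> b w"])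
  qed
  have e: "H.d\<Gamma> (\<phi> x) (?d a) (?d b) (?d w) = D2 x a (?\<Gamma> b w) + ?d (G.d\<Gamma> x a b w) - dd (\<lambda>y. D2 y b w) x a
     - ?K (D2 x a b) (?d w) - ?K (?d b) (D2 x a w)" for a b
    using d_chris_law[OF x, of a b w] by (simp add: algebra_simps)
  show ?thesis unfolding H.R_alt G.R_alt e K D3 D2_sym[OF x, of v u]
    by (simp add: linear_add[OF d\<phi>_linear[OF x]] linear_diff[OF d\<phi>_linear[OF x]])
qed

text \<open>The second derivative of \<phi> that arises from differentiating
  \<open>dd \<phi> (x s)\<close> is the one in \<open>chris_law\<close>. Hence
  \<open>Y' + chris G (x t) u (Y t)\<close>, the covariant derivative, is carried over by
  \<open>dd \<phi>\<close> like a tangent vector.\<close>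

lemma covariant_law:
  assumes x: "x t \<in> W" and t: "t \<in> I" and dx: "(x has_vector_derivative u) (at t within I)"
    and dY: "(Y has_vector_derivative Y') (at t within I)"
  shows "((\<lambda>s. \<phi> (x s)) has_vector_derivative dd \<phi> (x t) u) (at t within I)"
    and "((\<lambda>s. dd \<phi> (x s) (Y s)) has_vector_derivative
      dd \<phi> (x t) (Y' + chris G (x t) u (Y t)) - chris H (\<phi> (x t)) (dd \<phi> (x t) u) (dd \<phi> (x t) (Y t))) (at t within I)"
proof -
  have "((\<lambda>s. \<phi> (x s)) has_derivative (\<lambda>h. dd \<phi> (x t) (h *\<^sub>R u))) (at t within I)"
    using has_derivative_compose[OF dx[unfolded has_vector_derivative_def] has_derivative_dd[OF \<phi>_diffable[OF x]]] .
  then show "((\<lambda>s. \<phi> (x s)) has_vector_derivative dd \<phi> (x t) u) (at t within I)"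
    by (simp add: has_vector_derivative_def linear_scale[OF d\<phi>_linear[OF x]])
  have "((\<lambda>s. dd \<phi> (x s) (Y s)) has_derivative
     (\<lambda>h. dd (\<lambda>y. dd \<phi> y (Y t)) (x t) (h *\<^sub>R u) + dd \<phi> (x t) (h *\<^sub>R Y'))) (at t within I)"
    by (rule has_derivative_family[OF open_W x d\<phi>_linear d\<phi>_diffable[OF x]
        dx[unfolded has_vector_derivative_def] dY[unfolded has_vector_derivative_def] t])
  then have "((\<lambda>s. dd \<phi> (x s) (Y s)) has_vector_derivative D2 (x t) u (Y t) + dd \<phi> (x t) Y') (at t within I)"
    by (simp add: has_vector_derivative_def linear_scale[OF d\<phi>_linear[OF x]] D2_def
       linear_scale[OF linear_dd[OF d\<phi>_diffable[OF x]]] scaleR_right_distrib)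
  then show "((\<lambda>s. dd \<phi> (x s) (Y s)) has_vector_derivative
      dd \<phi> (x t) (Y' + chris G (x t) u (Y t)) - chris H (\<phi> (x t)) (dd \<phi> (x t) u) (dd \<phi> (x t) (Y t))) (at t within I)"
    by (simp add: chris_law[OF x] linear_add[OF d\<phi>_linear[OF x]] add.commute)
qed

end

section \<open>Ordinary differential equations\<close>

lemma has_vector_derivative_within_Un:
  assumes "(f has_vector_derivative f') (at x within S)" "(f has_vector_derivative f') (at x within T)"
  shows "(f has_vector_derivative f') (at x within S \<union> T)"
  using assms unfolding has_vector_derivative_def has_derivative_iff_norm by (blast intro: Lim_Un)

lemma has_vector_derivative_glue:
  assumes "a \<le> b" "b \<le> c" "t \<in> {a..c}"
    and "t \<in> {a..b} \<Longrightarrow> (f has_vector_derivative f') (at t within {a..b})"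
    and "t \<in> {b..c} \<Longrightarrow> (f has_vector_derivative f') (at t within {b..c})"
  shows "(f has_vector_derivative f') (at t within {a..c})"
proof -
  have e: "{a..c} = {a..b} \<union> {b..c}" using assms by auto
  have w: "(f has_vector_derivative f') (at t within S)" if "S = {a..b} \<or> S = {b..c}" for S
  proof (cases "t \<in> S")
    case True then show ?thesis using assms(4,5) that by blast
  next
    case False
    \<comment> \<open>At a point outside a closed interval the filter is trivial and every
      derivative statement holds, which is why the hypotheses may be conditional on
      membership.\<close>
    then have "at t within S = bot" using that by (auto simp: at_within_eq_bot_iff)
    then show ?thesis by (simp add: has_vector_derivative_def has_derivative_bot bounded_linear_scaleR_left)
  qed
  show ?thesis unfolding e by (rule has_vector_derivative_within_Un) (use w in auto)
qed

text \<open>Global solutions arise as solutions on all intervals [t0 - n, t0 + n]; each time is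
  interior to a large enough one, where the derivative becomes two-sided.\<close>

lemma has_vector_derivative_exhaustion:
  fixes f :: "real \<Rightarrow> 'v::real_normed_vector"
  assumes "\<And>n::nat. t \<in> {t0 - n..t0 + n} \<Longrightarrow> (f has_vector_derivative D) (at t within {t0 - n..t0 + n})"
  shows "(f has_vector_derivative D) (at t)"
proof -
  obtain n :: nat where n: "\<bar>t - t0\<bar> < n" using reals_Archimedean2 by blast
  then have "(f has_vector_derivative D) (at t within {t0 - n..t0 + n})"
    by (intro assms) (simp add: abs_less_iff)
  then have "(f has_vector_derivative D) (at t within {t0 - n<..<t0 + n})"
    by (rule has_vector_derivative_within_subset) auto
  then show ?thesis using n by (subst (asm) at_within_open) auto
qed

lemma integral_increment_bound:
  fixes h :: "real \<Rightarrow> 'v::banach"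
  assumes c: "continuous_on {a..b} h" and B: "\<And>t. t \<in> {a..b} \<Longrightarrow> norm (h t) \<le> B"
    and st: "s \<in> {a..b}" "t \<in> {a..b}"
  shows "norm (integral {a..t} h - integral {a..s} h) \<le> B * \<bar>t - s\<bar>"
proof -
  have *: "norm (integral {a..t} h - integral {a..s} h) \<le> B * \<bar>t - s\<bar>"
    if "s \<le> t" "s \<in> {a..b}" "t \<in> {a..b}" for s t
  proof -
    have "h integrable_on {a..t}"
      by (rule integrable_continuous_real[OF continuous_on_subset[OF c]]) (use that in auto)
    from Henstock_Kurzweil_Integration.integral_combine[OF _ _ this, of s]
    have "integral {a..t} h - integral {a..s} h = integral {s..t} h" using that by (simp add: algebra_simps)
    moreover have "norm (integral {s..t} h) \<le> B * (t - s)"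
      by (rule integral_bound[OF that(1) continuous_on_subset[OF c]]) (use that B in auto)
    ultimately show ?thesis using that by simp
  qed
  show ?thesis
  proof (cases "s \<le> t")
    case True then show ?thesis using * st by blast
  next
    case False then show ?thesis using *[of t s] st by (simp add: norm_minus_commute abs_minus_commute)
  qed
qed

text \<open>The integral operator is a contraction on the bounded
  continuous functions with values in the ball, extended constantly outside the interval.\<close>

lemma picard:
  fixes F :: "real \<Rightarrow> 'v::euclidean_space \<Rightarrow> 'v"
  assumes e: "e > 0" and r: "r \<ge> 0" and L: "L \<ge> 0"
    and cont: "continuous_on ({t0 - e..t0 + e} \<times> cball y0 r) (\<lambda>p. F (fst p) (snd p))"
    and bound: "\<And>t y. t \<in> {t0 - e..t0 + e} \<Longrightarrow> y \<in> cball y0 r \<Longrightarrow> norm (F t y) \<le> N"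
    and lip: "\<And>t y z. t \<in> {t0 - e..t0 + e} \<Longrightarrow> y \<in> cball y0 r \<Longrightarrow> z \<in> cball y0 r \<Longrightarrow>
       norm (F t y - F t z) \<le> L * norm (y - z)"
    and eN: "e * N \<le> r" and eL: "e * L < 1"
  obtains y where "y t0 = y0" "\<And>t. t \<in> {t0 - e..t0 + e} \<Longrightarrow> y t \<in> cball y0 r"
    "\<And>t. t \<in> {t0 - e..t0 + e} \<Longrightarrow> (y has_vector_derivative F t (y t)) (at t within {t0 - e..t0 + e})"
proof -
  define a b where "a = t0 - e" and "b = t0 + e"
  define c where "c = (\<lambda>t. max a (min b t))"
  have ab: "a \<le> t0" "t0 \<le> b" using e by (auto simp: a_def b_def)
  have c: "c t \<in> {a..b}" for t using ab by (auto simp: c_def)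
  have c_id: "c t = t" if "t \<in> {a..b}" for t using that by (auto simp: c_def)
  have cdist: "\<bar>c t - t0\<bar> \<le> e" for t using c[of t] by (auto simp: a_def b_def)
  \<comment> \<open>Taking both integrals from the left end \<open>a\<close> expresses the signed
    integral from \<open>t0\<close> to \<open>c t\<close> as a difference, valid on either side of
    \<open>t0\<close>.\<close>
  define T where "T = (\<lambda>(f :: real \<Rightarrow>\<^sub>C 'v) t. y0 + (integral {a..c t} (\<lambda>s. F s (f s)) - integral {a..t0} (\<lambda>s. F s (f s))))"
  define S where "S = {f :: real \<Rightarrow>\<^sub>C 'v. \<forall>t. f t \<in> cball y0 r}"
  have Fc: "continuous_on {a..b} (\<lambda>s. F s (f s))" if "f \<in> S" for f
  proof -
    have "continuous_on {a..b} (\<lambda>s. (s, apply_bcontfun f s))" by (intro continuous_intros) auto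
    moreover have "(\<lambda>s. (s, apply_bcontfun f s)) ` {a..b} \<subseteq> {t0 - e..t0 + e} \<times> cball y0 r"
      using that by (auto simp: S_def a_def b_def)
    ultimately show ?thesis using continuous_on_compose2[OF cont] by fastforce
  qed
  have Tball: "T f t \<in> cball y0 r" if f: "f \<in> S" for f t
  proof -
    have "norm (T f t - y0) \<le> N * \<bar>c t - t0\<bar>" unfolding T_def
      using integral_increment_bound[OF Fc[OF f], of N t0 "c t"] bound f c ab
      by (auto simp: S_def a_def b_def)
    also have "\<dots> \<le> N * e"
    proof (rule mult_left_mono[OF cdist])
      have "norm (F t0 y0) \<le> N" using bound[of t0 y0] e r by auto
      then show "0 \<le> N" using norm_ge_zero order_trans by blast
    qed
    finally show ?thesis using eN by (simp add: dist_norm norm_minus_commute mult.commute)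
  qed
  have Tcont: "continuous_on UNIV (T f)" if f: "f \<in> S" for f
  proof -
    have "continuous_on {a..b} (\<lambda>u. integral {a..u} (\<lambda>s. F s (f s)))"
      using indefinite_integral_continuous_1[OF integrable_continuous_real[OF Fc[OF f]]] .
    moreover have "continuous_on UNIV c" unfolding c_def by (intro continuous_intros)
    ultimately have "continuous_on UNIV (\<lambda>t. integral {a..c t} (\<lambda>s. F s (f s)))"
      by (rule continuous_on_compose2) (use c in auto)
    then show ?thesis unfolding T_def by (intro continuous_intros)
  qed
  have Tb: "T f \<in> bcontfun" if "f \<in> S" for f
  proof -
    have "range (T f) \<subseteq> cball y0 r" using Tball[OF that] by blast
    then show ?thesis using Tcont[OF that] bounded_subset[OF bounded_cball] by (auto simp: bcontfun_def)
  qed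
  define \<T> where "\<T> f = Bcontfun (T f)" for f
  have \<T>: "apply_bcontfun (\<T> f) = T f" if "f \<in> S" for f
    using Tb[OF that] by (simp add: \<T>_def Bcontfun_inverse)
  have "S = PiC UNIV (\<lambda>_. cball y0 r)" by (auto simp: S_def mem_PiC_iff Pi_def)
  then have "complete S" using closed_PiC[of UNIV "\<lambda>_. cball y0 r"] complete_eq_closed by auto
  moreover have "S \<noteq> {}"
  proof -
    have "const_bcontfun y0 \<in> S" using r by (simp add: S_def const_bcontfun.rep_eq)
    then show ?thesis by blast
  qed
  moreover have "0 \<le> e * L" "e * L < 1" using e L eL by auto
  moreover have "\<T> ` S \<subseteq> S"
  proof
    fix g assume "g \<in> \<T> ` S"
    then obtain f where "f \<in> S" "g = \<T> f" by blast
    then show "g \<in> S" using \<T>[of f] Tball[of f] by (simp add: S_def)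
  qed
  moreover have "dist (\<T> f) (\<T> g) \<le> e * L * dist f g" if f: "f \<in> S" and g: "g \<in> S" for f g
  proof (rule dist_bound)
    fix t
    let ?h = "\<lambda>s. F s (f s) - F s (g s)"
    have int: "(\<lambda>s. F s (f s)) integrable_on {a..u}" "(\<lambda>s. F s (g s)) integrable_on {a..u}" if "u \<in> {a..b}" for u
      by (rule integrable_continuous_real[OF continuous_on_subset[OF Fc]], use f g that in auto)+
    have "T f t - T g t = integral {a..c t} ?h - integral {a..t0} ?h"
      unfolding T_def using int[OF c] int[of t0] ab by (simp add: integral_diff)
    also have "norm \<dots> \<le> (L * dist f g) * \<bar>c t - t0\<bar>"
    proof (rule integral_increment_bound[of a b])
      show "continuous_on {a..b} ?h" by (intro continuous_intros Fc f g)
      fix s assume s: "s \<in> {a..b}"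
      have "norm (?h s) \<le> L * norm (f s - g s)" using lip s f g by (simp add: S_def a_def b_def)
      also have "\<dots> \<le> L * dist f g" using dist_bounded[of f s g] L by (simp add: dist_norm mult_left_mono)
      finally show "norm (?h s) \<le> L * dist f g" .
    qed (use ab c in auto)
    also have "\<dots> \<le> (L * dist f g) * e" by (rule mult_left_mono[OF cdist]) (use L in auto)
    finally show "dist (\<T> f t) (\<T> g t) \<le> e * L * dist f g" using \<T>[OF f] \<T>[OF g] by (simp add: dist_norm mult_ac)
  qed
  ultimately have "\<exists>!f\<in>S. \<T> f = f" by (rule Banach_fix)
  then obtain f where f: "f \<in> S" "\<T> f = f" by blast
  have feq: "f t = T f t" for t using \<T>[OF f(1)] f(2) by metis
  show thesis
  proof (rule that[of "apply_bcontfun f"])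
    show "f t0 = y0" unfolding feq[of t0] T_def using c_id[of t0] ab by simp
    show "f t \<in> cball y0 r" for t using f by (simp add: S_def)
    fix t assume t: "t \<in> {t0 - e..t0 + e}"
    then have t': "t \<in> {a..b}" by (simp add: a_def b_def)
    have "((\<lambda>u. y0 + (integral {a..u} (\<lambda>s. F s (f s)) - integral {a..t0} (\<lambda>s. F s (f s)))) has_vector_derivative 0 + (F t (f t) - 0))
       (at t within {a..b})"
      by (intro has_vector_derivative_add has_vector_derivative_diff has_vector_derivative_const
          integral_has_vector_derivative[OF Fc[OF f(1)] t'])
    then have d: "((\<lambda>u. y0 + (integral {a..u} (\<lambda>s. F s (f s)) - integral {a..t0} (\<lambda>s. F s (f s))))
       has_vector_derivative F t (f t)) (at t within {a..b})" by simp
    have eq: "apply_bcontfun f u = y0 + (integral {a..u} (\<lambda>s. F s (f s)) - integral {a..t0} (\<lambda>s. F s (f s)))"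
      if "u \<in> {a..b}" for u
      by (subst feq) (simp add: T_def c_id[OF that])
    have "(apply_bcontfun f has_vector_derivative F t (f t)) (at t within {a..b})"
      by (rule has_vector_derivative_transform[OF t' eq d])
    then show "(apply_bcontfun f has_vector_derivative F t (f t)) (at t within {t0 - e..t0 + e})"
      by (simp add: a_def b_def)
  qed
qed

text \<open>The common continuation argument for linear equations, parallel fields and geodesics:
  \<open>Sol a b s\<close> means that \<open>s\<close> solves on [a,b], and \<open>V t\<close> is
  the set of admissible states at time t. The length \<open>d\<close> in \<open>loc\<close> depends
  on the time but not on the state; this excludes blow-up, and a Bolzano argument reaches every
  compact interval from either end.\<close>

lemma global_from_local:
  fixes Sol :: "real \<Rightarrow> real \<Rightarrow> (real \<Rightarrow> 's) \<Rightarrow> bool" and V :: "real \<Rightarrow> 's set"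
  assumes cong: "\<And>a b s s'. Sol a b s \<Longrightarrow> (\<And>t. a \<le> t \<Longrightarrow> t \<le> b \<Longrightarrow> s t = s' t) \<Longrightarrow> Sol a b s'"
    and glue: "\<And>a b c s. Sol a b s \<Longrightarrow> Sol b c s \<Longrightarrow> a \<le> b \<Longrightarrow> b \<le> c \<Longrightarrow> Sol a c s"
    and valid: "\<And>a b s t. Sol a b s \<Longrightarrow> a \<le> t \<Longrightarrow> t \<le> b \<Longrightarrow> s t \<in> V t"
    and loc: "\<And>t. \<exists>d>0. \<forall>a b. a \<le> t \<and> t \<le> b \<and> b - a < d \<longrightarrow>
      (\<forall>x\<in>V a. \<exists>s. Sol a b s \<and> s a = x) \<and> (\<forall>x\<in>V b. \<exists>s. Sol a b s \<and> s b = x)"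
    and x0: "x0 \<in> V t0"
  shows "\<exists>s. s t0 = x0 \<and> (\<forall>n::nat. Sol (t0 - n) (t0 + n) s)"
proof -
  have glue2: "\<exists>s. Sol a c s \<and> (\<forall>t\<in>{a..b}. s t = s1 t) \<and> (\<forall>t\<in>{b..c}. s t = s2 t)"
    if "Sol a b s1" "Sol b c s2" "s1 b = s2 b" "a \<le> b" "b \<le> c" for a b c s1 s2
  proof -
    let ?s = "\<lambda>t. if t \<le> b then s1 t else s2 t"
    have "Sol a b ?s" by (rule cong[OF that(1)]) simp
    moreover have "Sol b c ?s" by (rule cong[OF that(2)]) (use that(3) in auto)
    ultimately have "Sol a c ?s" using glue that by blast
    then show ?thesis using that(3) by (intro exI[of _ ?s]) auto
  qed
  have ext: "(\<forall>x\<in>V a. \<exists>s. Sol a b s \<and> s a = x) \<and> (\<forall>x\<in>V b. \<exists>s. Sol a b s \<and> s b = x)" if "a \<le> b" for a b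
    using that
  proof (induction a b rule: Bolzano)
    case (trans a b c)
    show ?case
    proof (intro conjI ballI)
      fix x assume "x \<in> V a"
      then obtain s1 where s1: "Sol a b s1" "s1 a = x" using trans by blast
      then obtain s2 where s2: "Sol b c s2" "s2 b = s1 b" using trans valid[OF s1(1)] by blast
      from glue2[OF s1(1) s2(1)] s2 trans s1(2) show "\<exists>s. Sol a c s \<and> s a = x" by fastforce
    next
      fix x assume "x \<in> V c"
      then obtain s2 where s2: "Sol b c s2" "s2 c = x" using trans by blast
      then obtain s1 where s1: "Sol a b s1" "s1 b = s2 b" using trans valid[OF s2(1)] by blast
      from glue2[OF s1(1) s2(1)] s1 trans s2(2) show "\<exists>s. Sol a c s \<and> s c = x" by fastforce
    qed
  next
    case (local t) show ?case by (rule loc)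
  qed
  \<comment> \<open>Solutions on growing intervals are chosen so that each extends its predecessor;
    coherence is built into the choice and does not rest on uniqueness.\<close>
  have "\<exists>f. \<forall>n. (Sol (t0 - real n) (t0 + real n) (f n) \<and> f n t0 = x0) \<and>
     (\<forall>t\<in>{t0 - real n..t0 + real n}. f (Suc n) t = f n t)"
  proof (rule dependent_nat_choice)
    show "\<exists>s. Sol (t0 - real 0) (t0 + real 0) s \<and> s t0 = x0" using ext[of t0 t0] x0 by auto
    fix s n assume s: "Sol (t0 - real n) (t0 + real n) s \<and> s t0 = x0"
    have "s (t0 + real n) \<in> V (t0 + real n)" "s (t0 - real n) \<in> V (t0 - real n)" using s valid by auto
    moreover have le: "t0 + real n \<le> t0 + real (Suc n)" "t0 - real (Suc n) \<le> t0 - real n" by auto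
    ultimately obtain u v where u: "Sol (t0 + real n) (t0 + real (Suc n)) u" "u (t0 + real n) = s (t0 + real n)"
      and v: "Sol (t0 - real (Suc n)) (t0 - real n) v" "v (t0 - real n) = s (t0 - real n)"
      using ext[OF le(1)] ext[OF le(2)] by blast
    from glue2[OF _ u(1), of "t0 - real n" s] s u(2) obtain w where
      w: "Sol (t0 - real n) (t0 + real (Suc n)) w" "\<forall>t\<in>{t0 - real n..t0 + real n}. w t = s t" by auto
    from glue2[OF v(1) w(1)] v(2) w(2) obtain z where
      z: "Sol (t0 - real (Suc n)) (t0 + real (Suc n)) z" "\<forall>t\<in>{t0 - real n..t0 + real (Suc n)}. z t = w t" by auto
    have "\<forall>t\<in>{t0 - real n..t0 + real n}. z t = s t" using z(2) w(2) by auto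
    moreover from this have "z t0 = x0" using s by auto
    ultimately show "\<exists>y. (Sol (t0 - real (Suc n)) (t0 + real (Suc n)) y \<and> y t0 = x0) \<and>
        (\<forall>t\<in>{t0 - real n..t0 + real n}. y t = s t)" using z(1) by blast
  qed
  then obtain f where f: "\<And>n. Sol (t0 - real n) (t0 + real n) (f n)" "\<And>n. f n t0 = x0"
    "\<And>n t. t \<in> {t0 - real n..t0 + real n} \<Longrightarrow> f (Suc n) t = f n t" by blast
  have mono: "f (n + k) t = f n t" if "t \<in> {t0 - real n..t0 + real n}" for n k t
    using that by (induction k) (auto simp: f(3))
  \<comment> \<open>The index is the least n whose interval contains t; later stages agree with it
    there.\<close>
  define s where "s = (\<lambda>t. f (nat \<lceil>\<bar>t - t0\<bar>\<rceil>) t)"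
  have "s t = f n t" if "t0 - real n \<le> t" "t \<le> t0 + real n" for n t
  proof -
    let ?m = "nat \<lceil>\<bar>t - t0\<bar>\<rceil>"
    have "?m \<le> n" using that by (simp add: nat_le_iff ceiling_le_iff)
    moreover have "t \<in> {t0 - real ?m..t0 + real ?m}" using of_nat_ceiling[of "\<bar>t - t0\<bar>"]
      by (simp only: atLeastAtMost_iff abs_le_iff) linarith
    ultimately show ?thesis unfolding s_def using mono[of t ?m "n - ?m"] by simp
  qed
  then have "Sol (t0 - real n) (t0 + real n) s" for n using cong[OF f(1)[of n]] by metis
  moreover have "s t0 = x0" by (simp add: s_def f(2))
  ultimately show ?thesis by blast
qed

section \<open>Linear ordinary differential equations\<close>

lemma linear_family_continuous_on:
  fixes B :: "'a::topological_space \<Rightarrow> 'v::euclidean_space \<Rightarrow> 'w::real_normed_vector"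
  assumes "\<And>t. t \<in> S \<Longrightarrow> linear (B t)" "\<And>v. continuous_on S (\<lambda>t. B t v)"
  shows "continuous_on (S \<times> UNIV) (\<lambda>p. B (fst p) (snd p))"
proof -
  have "continuous_on (S \<times> UNIV) (\<lambda>p. \<Sum>i\<in>Basis. (snd p \<bullet> i) *\<^sub>R B (fst p) i)"
    by (intro continuous_intros continuous_on_compose2[OF assms(2) continuous_on_fst]) auto
  moreover have "B (fst p) (snd p) = (\<Sum>i\<in>Basis. (snd p \<bullet> i) *\<^sub>R B (fst p) i)" if "p \<in> S \<times> UNIV" for p
    using linear_basis_expand[OF assms(1)] that by auto
  ultimately show ?thesis by (simp cong: continuous_on_cong)
qed

lemma linear_family_bound:
  fixes B :: "'a::t2_space \<Rightarrow> 'v::euclidean_space \<Rightarrow> 'w::real_normed_vector"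
  assumes "\<And>t. t \<in> S \<Longrightarrow> linear (B t)" "\<And>v. continuous_on S (\<lambda>t. B t v)" "compact S"
  obtains L where "L > 0" "\<And>t v. t \<in> S \<Longrightarrow> norm (B t v) \<le> L * norm v"
proof -
  have "continuous_on S (\<lambda>t. \<Sum>i\<in>Basis. norm (B t i))" by (intro continuous_intros assms)
  then have "bounded ((\<lambda>t. \<Sum>i\<in>Basis. norm (B t i)) ` S)"
    using assms(3) compact_continuous_image compact_imp_bounded by blast
  then obtain L where L: "L > 0" "\<And>t. t \<in> S \<Longrightarrow> norm (\<Sum>i\<in>Basis. norm (B t i)) \<le> L"
    unfolding bounded_pos by blast
  have "norm (B t v) \<le> L * norm v" if t: "t \<in> S" for t v
  proof -
    have "norm (B t v) \<le> (\<Sum>i\<in>Basis. norm (B t i) * norm v)"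
      unfolding linear_basis_expand[OF assms(1)[OF t], of v]
      by (rule sum_norm_le) (simp add: mult.commute[of _ "norm v"] mult_right_mono Basis_le_norm)
    also have "\<dots> = (\<Sum>i\<in>Basis. norm (B t i)) * norm v" by (simp add: sum_distrib_right)
    also have "\<dots> \<le> L * norm v" using L(2)[OF t] by (intro mult_right_mono) auto
    finally show ?thesis .
  qed
  with L(1) that show thesis by blast
qed

lemma linear_ode_global:
  fixes B :: "real \<Rightarrow> 'v::euclidean_space \<Rightarrow> 'v"
  assumes lin: "\<And>t. linear (B t)" and cont: "\<And>v. continuous_on UNIV (\<lambda>t. B t v)"
  shows "\<exists>y. y t0 = y0 \<and> (\<forall>t. (y has_vector_derivative B t (y t)) (at t))"
proof -
  define Sol where "Sol = (\<lambda>a b y. \<forall>t\<in>{a..b}. (y has_vector_derivative B t (y t)) (at t within {a..b}))"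
  have "\<exists>y. y t0 = y0 \<and> (\<forall>n::nat. Sol (t0 - n) (t0 + n) y)"
  proof (rule global_from_local[where V="\<lambda>_. UNIV"])
    fix a b :: real and s s' assume "Sol a b s" "\<And>t. a \<le> t \<Longrightarrow> t \<le> b \<Longrightarrow> s t = s' t"
    then show "Sol a b s'" unfolding Sol_def
      by (metis atLeastAtMost_iff has_vector_derivative_transform)
  next
    fix a b c :: real and s assume s: "Sol a b s" "Sol b c s" and ab: "a \<le> b" "b \<le> c"
    show "Sol a c s" using s unfolding Sol_def by (blast intro: has_vector_derivative_glue[OF ab])
  next
    fix t :: real
    obtain L where L: "L > 0" "\<And>s v. s \<in> {t - 2..t + 2} \<Longrightarrow> norm (B s v) \<le> L * norm v"
      by (rule linear_family_bound[of "{t - 2..t + 2}" B])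
        (use lin cont in \<open>auto intro: continuous_on_subset\<close>)
    \<comment> \<open>In the ball of radius \<open>norm x\<close> about \<open>x\<close> vectors
      have norm at most \<open>2 * norm x\<close>, so bound and radius both scale with
      \<open>norm x\<close> and the step length can be chosen independently of the initial value.
      The bound 1 keeps the solution interval inside [t - 2, t + 2], where \<open>L\<close> is
      valid.\<close>
    define d where "d = min 1 (1 / (4 * L))"
    have d: "d > 0" "d \<le> 1" "d * L \<le> 1 / 4" using L(1) by (auto simp: d_def min_def field_simps)
    have sol: "\<exists>y. y s = x \<and> (\<forall>u\<in>{s - d..s + d}. (y has_vector_derivative B u (y u)) (at u within {s - d..s + d}))"
      if s: "\<bar>s - t\<bar> \<le> 1" for s x
    proof -
      have sub: "{s - d..s + d} \<subseteq> {t - 2..t + 2}" using s d by auto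
      show ?thesis
      proof (rule picard[of d "norm x" L s x B "L * (2 * norm x)"])
        show "continuous_on ({s - d..s + d} \<times> cball x (norm x)) (\<lambda>p. B (fst p) (snd p))"
          by (rule continuous_on_subset[OF linear_family_continuous_on[of UNIV]]) (use lin cont in auto)
        show "norm (B u y) \<le> L * (2 * norm x)" if "u \<in> {s - d..s + d}" "y \<in> cball x (norm x)" for u y
        proof -
          have "norm (B u y) \<le> L * norm y" using L that sub by blast
          also have "norm y \<le> 2 * norm x" using that norm_triangle_sub[of y x] by (simp add: dist_norm norm_minus_commute)
          finally show ?thesis using L(1) by simp
        qed
        show "norm (B u y - B u z) \<le> L * norm (y - z)" if "u \<in> {s - d..s + d}" for u y z
          using L(2)[of u "y - z"] that sub linear_diff[OF lin] by auto
        have "d * L * (2 * norm x) \<le> 1 / 4 * (2 * norm x)" using d by (intro mult_right_mono) auto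
        then show "d * (L * (2 * norm x)) \<le> norm x" using norm_ge_zero[of x] by (simp only: mult.assoc)
      qed (use d L in auto)
    qed
    show "\<exists>d>0. \<forall>a b. a \<le> t \<and> t \<le> b \<and> b - a < d \<longrightarrow>
      (\<forall>x\<in>UNIV. \<exists>s. Sol a b s \<and> s a = x) \<and> (\<forall>x\<in>UNIV. \<exists>s. Sol a b s \<and> s b = x)"
    proof (intro exI[of _ d] conjI allI impI ballI)
      fix a b x assume ab: "a \<le> t \<and> t \<le> b \<and> b - a < d"
      have *: "\<exists>y. Sol a b y \<and> y s = x" if "s = a \<or> s = b" for s
      proof -
        have "\<bar>s - t\<bar> \<le> 1" "{a..b} \<subseteq> {s - d..s + d}" using that ab d by auto
        then show ?thesis using sol[of s x] unfolding Sol_def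
          by (meson has_vector_derivative_within_subset subsetD)
      qed
      show "\<exists>s. Sol a b s \<and> s a = x" "\<exists>s. Sol a b s \<and> s b = x" using * by auto
    qed (rule d)
  qed auto
  then obtain y where y: "y t0 = y0" "\<And>n::nat. Sol (t0 - n) (t0 + n) y" by blast
  have "(y has_vector_derivative B t (y t)) (at t)" for t
    by (rule has_vector_derivative_exhaustion[of t t0]) (use y(2) in \<open>auto simp: Sol_def\<close>)
  with y(1) show ?thesis by blast
qed

lemma linear_ode_interval:
  fixes B :: "real \<Rightarrow> 'v::euclidean_space \<Rightarrow> 'v"
  assumes lin: "\<And>t. t \<in> {a..b} \<Longrightarrow> linear (B t)" and cont: "\<And>v. continuous_on {a..b} (\<lambda>t. B t v)"
    and t0: "t0 \<in> {a..b}"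
  shows "\<exists>y. y t0 = y0 \<and> (\<forall>t\<in>{a..b}. (y has_vector_derivative B t (y t)) (at t within {a..b}))"
proof -
  \<comment> \<open>Freezing the coefficients at their end values outside [a,b] reduces the claim to
    the equation on the whole line.\<close>
  define c where "c = (\<lambda>t. max a (min b t))"
  have c: "c t \<in> {a..b}" for t using t0 by (auto simp: c_def)
  have "continuous_on UNIV c" unfolding c_def by (intro continuous_intros)
  then have "continuous_on UNIV (\<lambda>t. B (c t) v)" for v
    by (rule continuous_on_compose2[OF cont]) (use c in auto)
  then obtain y where y: "y t0 = y0" "\<And>t. (y has_vector_derivative B (c t) (y t)) (at t)"
    using linear_ode_global[of "\<lambda>t. B (c t)"] lin c by blast
  have "c t = t" if "t \<in> {a..b}" for t using that by (auto simp: c_def)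
  then show ?thesis using y by (metis has_vector_derivative_at_within)
qed

text \<open>A Gronwall argument: \<open>exp (- 2 * L * s) * u s\<close> is nonincreasing and
  \<open>exp (2 * L * s) * u s\<close> nondecreasing on a window around \<open>t0\<close> containing
  \<open>t\<close>, where \<open>u\<close> is the squared norm. The first settles times after
  \<open>t0\<close>, the second times before it.\<close>

lemma linear_ode_unique:
  fixes B :: "real \<Rightarrow> 'v::euclidean_space \<Rightarrow> 'v"
  assumes lin: "\<And>t. linear (B t)" and cont: "\<And>v. continuous_on UNIV (\<lambda>t. B t v)"
    and y: "\<And>t. (y has_vector_derivative B t (y t)) (at t)" and y0: "y t0 = 0"
  shows "y t = 0"
proof -
  define R where "R = \<bar>t - t0\<bar> + 1"
  obtain L where L: "L > 0" "\<And>s v. s \<in> {t0 - R..t0 + R} \<Longrightarrow> norm (B s v) \<le> L * norm v"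
    by (rule linear_family_bound[of "{t0 - R..t0 + R}" B])
      (use lin cont in \<open>auto intro: continuous_on_subset\<close>)
  define u where "u = (\<lambda>s. y s \<bullet> y s)"
  have du: "(u has_real_derivative 2 * (y s \<bullet> B s (y s))) (at s)" for s
  proof -
    have "(u has_vector_derivative y s \<bullet> B s (y s) + B s (y s) \<bullet> y s) (at s)"
      unfolding u_def by (rule bounded_bilinear.has_vector_derivative[OF bounded_bilinear_inner y y])
    then show ?thesis by (simp add: has_real_derivative_iff_has_vector_derivative inner_commute)
  qed
  have bd: "\<bar>2 * (y s \<bullet> B s (y s))\<bar> \<le> 2 * L * u s" if "s \<in> {t0 - R..t0 + R}" for s
  proof -
    have "\<bar>y s \<bullet> B s (y s)\<bar> \<le> norm (y s) * norm (B s (y s))" by (rule Cauchy_Schwarz_ineq2)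
    also have "\<dots> \<le> norm (y s) * (L * norm (y s))" using L(2)[OF that] by (intro mult_left_mono) auto
    finally show ?thesis unfolding u_def dot_square_norm by (simp add: power2_eq_square mult_ac)
  qed
  have dexp: "((\<lambda>s. exp (k * s) * u s) has_real_derivative exp (k * s) * (k * u s + 2 * (y s \<bullet> B s (y s)))) (at s)" for k s
    by (rule derivative_eq_intros du refl | simp add: algebra_simps)+
  have "u t \<le> 0"
  proof (cases "t0 \<le> t")
    case True
    have "exp (- 2 * L * t) * u t \<le> exp (- 2 * L * t0) * u t0"
    proof (rule DERIV_nonpos_imp_nonincreasing[OF True])
      fix s assume s: "t0 \<le> s" "s \<le> t"
      have "exp (- 2 * L * s) * (- 2 * L * u s + 2 * (y s \<bullet> B s (y s))) \<le> 0"
        using bd[of s] s by (intro mult_nonneg_nonpos) (auto simp: R_def)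
      then show "\<exists>z. ((\<lambda>s. exp (- 2 * L * s) * u s) has_real_derivative z) (at s) \<and> z \<le> 0"
        using dexp[of "- 2 * L" s] by blast
    qed
    then show ?thesis using y0 by (simp add: u_def mult_le_0_iff)
  next
    case False
    then have le: "t \<le> t0" by simp
    have "exp (2 * L * t) * u t \<le> exp (2 * L * t0) * u t0"
    proof (rule DERIV_nonneg_imp_nondecreasing[OF le])
      fix s assume s: "t \<le> s" "s \<le> t0"
      have "exp (2 * L * s) * (2 * L * u s + 2 * (y s \<bullet> B s (y s))) \<ge> 0"
        using bd[of s] s by (intro mult_nonneg_nonneg) (auto simp: R_def)
      then show "\<exists>z. ((\<lambda>s. exp (2 * L * s) * u s) has_real_derivative z) (at s) \<and> 0 \<le> z"
        using dexp[of "2 * L" s] by blast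
    qed
    then show ?thesis using y0 by (simp add: u_def mult_le_0_iff)
  qed
  then show ?thesis unfolding u_def by (metis inner_eq_zero_iff inner_ge_zero order_antisym)
qed

section \<open>Regularity of curves and of solutions\<close>

lemma Ck_on_Suc_real:
  fixes y :: "real \<Rightarrow> 'v::real_normed_vector"
  assumes "open S" "\<And>t. t \<in> S \<Longrightarrow> (y has_vector_derivative y' t) (at t)" "Ck_on k S y'"
  shows "Ck_on (Suc k) S y"
proof -
  have "dd y t v = v *\<^sub>R y' t" if "t \<in> S" for t v
    using dd_eq[OF assms(2)[OF that, unfolded has_vector_derivative_def]] .
  then have "Ck_on k S (\<lambda>t. dd y t v) \<longleftrightarrow> Ck_on k S (\<lambda>t. v *\<^sub>R y' t)" for v
    by (intro Ck_on_cong assms(1))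
  moreover have "Ck_on k S (\<lambda>t. v *\<^sub>R y' t)" for v by (intro Ck_on_scaleR assms Ck_on_const)
  ultimately show ?thesis using differentiableI_vector[OF assms(2)] by auto
qed

lemma Ck_on_vector_derivative:
  fixes y :: "real \<Rightarrow> 'v::real_normed_vector"
  assumes "open S" "Ck_on (Suc k) S y"
  shows "Ck_on k S (\<lambda>t. vector_derivative y (at t))"
proof -
  have "dd y t 1 = vector_derivative y (at t)" if "t \<in> S" for t
    using frechet_derivative_eq_vector_derivative[of y t] assms(2) that by simp
  then have "Ck_on k S (\<lambda>t. vector_derivative y (at t)) \<longleftrightarrow> Ck_on k S (\<lambda>t. dd y t 1)"
    by (intro Ck_on_cong assms(1)) simp
  then show ?thesis using assms(2) by simp
qed

lemma smooth_linear_ode: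
  fixes B :: "real \<Rightarrow> 'v::euclidean_space \<Rightarrow> 'v"
  assumes S: "open S" and lin: "\<And>t. t \<in> S \<Longrightarrow> linear (B t)" and B: "\<And>k v. Ck_on k S (\<lambda>t. B t v)"
    and y: "\<And>t. t \<in> S \<Longrightarrow> (y has_vector_derivative B t (y t)) (at t)"
  shows "Ck_on k S y"
proof (induction k)
  case 0
  have "continuous (at t) y" if "t \<in> S" for t
    using y[OF that] by (rule has_vector_derivative_continuous)
  then show ?case by (simp add: continuous_at_imp_continuous_on)
next
  case (Suc k)
  show ?case by (rule Ck_on_Suc_real[OF S y]) (auto intro: Ck_on_family[OF S lin B Suc])
qed

section \<open>The index form\<close>

locale second_order =
  fixes P :: "real \<Rightarrow> 'e::euclidean_space \<Rightarrow> 'e"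
  assumes P_linear: "linear (P t)"
    and P_sym: "P t u \<bullet> v = u \<bullet> P t v"
    and P_cont: "continuous_on UNIV (\<lambda>t. P t v)"
begin

definition sol :: "(real \<Rightarrow> 'e) \<Rightarrow> (real \<Rightarrow> 'e) \<Rightarrow> bool" where
  "sol y y' \<longleftrightarrow> (\<forall>t. (y has_vector_derivative y' t) (at t) \<and> (y' has_vector_derivative - P t (y t)) (at t))"

lemma solD: "sol y y' \<Longrightarrow> (y has_vector_derivative y' t) (at t)"
  "sol y y' \<Longrightarrow> (y' has_vector_derivative - P t (y t)) (at t)"
  by (auto simp: sol_def)

lemma sol_continuous: "sol y y' \<Longrightarrow> continuous_on A y" "sol y y' \<Longrightarrow> continuous_on A y'"
  by (meson continuous_at_imp_continuous_on has_vector_derivative_continuous solD)+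

lemma first_order_linear: "linear (\<lambda>z. (snd z, - P t (fst z)))"
  using P_linear[of t] by (intro linearI) (auto simp: linear_add linear_scale)

lemma first_order_continuous: "continuous_on UNIV (\<lambda>t. (snd z, - P t (fst z)))"
  by (intro continuous_intros P_cont)

lemma sol_exists: "\<exists>y y'. sol y y' \<and> y t0 = a \<and> y' t0 = b"
proof -
  obtain z :: "real \<Rightarrow> 'e \<times> 'e" where z: "z t0 = (a, b)"
    "\<And>t. (z has_vector_derivative (snd (z t), - P t (fst (z t)))) (at t)"
    using linear_ode_global[OF first_order_linear first_order_continuous] by blast
  have "sol (\<lambda>t. fst (z t)) (\<lambda>t. snd (z t))" unfolding sol_def
    using bounded_linear.has_vector_derivative[OF bounded_linear_fst z(2)]
      bounded_linear.has_vector_derivative[OF bounded_linear_snd z(2)] by simp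
  then show ?thesis using z(1) by force
qed

lemma sol_unique:
  assumes "sol y y'" "y t0 = 0" "y' t0 = 0" shows "y t = 0"
proof -
  have "((\<lambda>t. (y t, y' t)) has_vector_derivative (y' t, - P t (y t))) (at t)" for t
    using solD[OF assms(1)] by (intro has_vector_derivative_Pair)
  then have "(y t, y' t) = 0"
    by (intro linear_ode_unique[where B="\<lambda>t z. (snd z, - P t (fst z))" and y="\<lambda>t. (y t, y' t)" and ?t0.0=t0 and t=t])
      (use first_order_linear first_order_continuous assms in \<open>simp_all add: zero_prod_def\<close>)
  then show ?thesis by (simp add: zero_prod_def)
qed

lemma sol_eq_0_iff: "sol y y' \<Longrightarrow> y t0 = 0 \<Longrightarrow> (\<exists>t. y t \<noteq> 0) \<longleftrightarrow> y' t0 \<noteq> 0"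
proof
  assume s: "sol y y'" "y t0 = 0"
  show "\<exists>t. y t \<noteq> 0 \<Longrightarrow> y' t0 \<noteq> 0" using sol_unique[OF s] by blast
  show "\<exists>t. y t \<noteq> 0" if "y' t0 \<noteq> 0"
  proof (rule ccontr)
    assume "\<not> (\<exists>t. y t \<noteq> 0)"
    then have "y = (\<lambda>t. 0)" by auto
    then show False using solD(1)[OF s(1), of t0] that
      vector_derivative_unique_at[OF has_vector_derivative_const] by metis
  qed
qed

definition disconjugate :: bool where
  "disconjugate \<longleftrightarrow> (\<forall>y y' a b. sol y y' \<and> y a = 0 \<and> y b = 0 \<and> a \<noteq> b \<longrightarrow> (\<forall>t. y t = 0))"

text \<open>With the solution operator \<open>A\<close> vanishing at \<open>p - 1\<close>, write \<open>W = A c\<close>; then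
  \<open>\<bar>W'\<bar>\<^sup>2 - P W \<bullet> W = \<bar>A c'\<bar>\<^sup>2 + (A' c \<bullet> W)'\<close>, where the last term integrates to zero.\<close>

lemma index_form_nonneg:
  assumes disc: disconjugate and X: "finite X" and pq: "p \<le> q"
    and W: "continuous_on UNIV W" "W p = 0" "W q = 0"
      "\<And>t. t \<in> {p<..<q} - X \<Longrightarrow> (W has_vector_derivative W' t) (at t)"
    and I: "((\<lambda>t. W' t \<bullet> W' t - P t (W t) \<bullet> W t) has_integral I) {p..q}"
  shows "I \<ge> 0"
proof -
  \<comment> \<open>With the start strictly before \<open>p\<close>, disconjugacy makes
    \<open>A t\<close> invertible on all of [p,q]; an operator vanishing at \<open>p\<close> would
    be singular at that end.\<close>
  define a where "a = p - 1"
  have "\<exists>y y'. sol y y' \<and> y a = 0 \<and> y' a = i" for i by (rule sol_exists)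
  then obtain Y Y' where Y: "\<And>i. sol (Y i) (Y' i)" "\<And>i. Y i a = 0" "\<And>i. Y' i a = i" by metis
  define A A' where "A = (\<lambda>t v. \<Sum>i\<in>Basis. (v \<bullet> i) *\<^sub>R Y i t)" and "A' = (\<lambda>t v. \<Sum>i\<in>Basis. (v \<bullet> i) *\<^sub>R Y' i t)"
  have lA: "linear (A t)" "linear (A' t)" for t
    unfolding A_def A'_def
    by (auto intro!: linearI simp: inner_add_left scaleR_add_left sum.distrib scaleR_sum_right)
  have sA: "sol (\<lambda>t. A t v) (\<lambda>t. A' t v)" for v
  proof -
    have "((\<lambda>t. A t v) has_vector_derivative A' t v) (at t)" for t unfolding A_def A'_def
      by (intro has_vector_derivative_sum bounded_linear.has_vector_derivative[OF bounded_linear_scaleR_right] solD[OF Y(1)])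
    moreover have "((\<lambda>t. A' t v) has_vector_derivative (\<Sum>i\<in>Basis. (v \<bullet> i) *\<^sub>R - P t (Y i t))) (at t)" for t
      unfolding A'_def
      by (intro has_vector_derivative_sum bounded_linear.has_vector_derivative[OF bounded_linear_scaleR_right] solD[OF Y(1)])
    moreover have "(\<Sum>i\<in>Basis. (v \<bullet> i) *\<^sub>R - P t (Y i t)) = - P t (A t v)" for t
      unfolding A_def using P_linear[of t] by (simp add: linear_sum linear_scale sum_negf)
    ultimately show ?thesis by (simp add: sol_def)
  qed
  have Aa: "A a v = 0" "A' a v = v" for v
    unfolding A_def A'_def using Y by (simp_all add: euclidean_representation)
  have injA: "inj (A t)" if "t > a" for t
  proof (rule linear_injective_on_subspace_0[THEN iffD2, OF lA(1) subspace_UNIV, rule_format])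
    fix v assume "A t v = 0"
    then have "\<forall>t. A t v = 0" using disc sA[of v] Aa(1)[of v] that unfolding disconjugate_def by blast
    then show "v = 0" using sol_eq_0_iff[OF sA Aa(1), of v] Aa(2)[of v] by simp
  qed
  \<comment> \<open>Symmetry of \<open>P\<close> makes the Wronskian constant, and it vanishes at
    \<open>a\<close>. This is what completes the square: it lets the mixed terms in \<open>c\<close>
    and \<open>c'\<close> cancel.\<close>
  have wron: "A' t u \<bullet> A t v = A t u \<bullet> A' t v" for t u v
  proof -
    have "((\<lambda>t. A' t u \<bullet> A t v - A t u \<bullet> A' t v) has_vector_derivative
       (A' t u \<bullet> A' t v + (- P t (A t u)) \<bullet> A t v) - (A t u \<bullet> (- P t (A t v)) + A' t u \<bullet> A' t v)) (at t)" for t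
      by (intro has_vector_derivative_diff bounded_bilinear.has_vector_derivative[OF bounded_bilinear_inner] solD[OF sA])
    then have "((\<lambda>t. A' t u \<bullet> A t v - A t u \<bullet> A' t v) has_vector_derivative 0) (at t)" for t
      by (simp add: P_sym)
    then obtain k where k: "\<And>t. A' t u \<bullet> A t v - A t u \<bullet> A' t v = k"
      using has_vector_derivative_zero_constant[of UNIV "\<lambda>t. A' t u \<bullet> A t v - A t u \<bullet> A' t v"] by auto
    show ?thesis using k[of t] k[of a] Aa by simp
  qed
  define c where "c = (\<lambda>t. SOME z. A t z = W t)"
  have Ac: "A t (c t) = W t" if "t \<in> {a<..}" for t
  proof -
    have "surj (A t)" using linear_inj_imp_surj[OF lA(1) injA] that by simp
    then have "\<exists>z. A t z = W t" by (metis surjD)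
    then show ?thesis unfolding c_def by (rule someI_ex)
  qed
  have ca: "open {a<..}" "\<And>t. t \<in> {p..q} \<Longrightarrow> t \<in> {a<..}" by (auto simp: a_def)
  have c_cont: "continuous (at t) c" if "t \<in> {p..q}" for t
  proof (rule solve_continuous[where A=A and b=W and z=c and S="{a<..}", OF ca(1) ca(2)[OF that] lA(1) injA _ _ Ac])
    show "t > a" using that by (simp add: a_def)
    show "continuous (at t) (\<lambda>x. A x v)" for v
      using solD(1)[OF sA] by (rule has_vector_derivative_continuous)
    show "continuous (at t) W" using W(1) by (simp add: continuous_on_eq_continuous_at)
  qed
  define c' where "c' = (\<lambda>t. vector_derivative c (at t))"
  have dA: "(\<lambda>x. A x v) differentiable at t" "(\<lambda>x. A' x v) differentiable at t"
    "dd (\<lambda>x. A x v) t h = h *\<^sub>R A' t v" "dd (\<lambda>x. A' x v) t h = h *\<^sub>R (- P t (A t v))" for t v h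
    using solD[OF sA[of v], of t] dd_eq[of "\<lambda>x. A x v" _ t] dd_eq[of "\<lambda>x. A' x v" _ t]
    unfolding has_vector_derivative_def differentiable_def by blast+
  have c_deriv: "(c has_vector_derivative c' t) (at t)" if t: "t \<in> {p<..<q} - X" for t
  proof -
    have "c differentiable at t"
    proof (rule solve_differentiable[where A=A and b=W and z=c and S="{a<..}", OF ca(1) ca(2) lA(1) injA dA(1) _ Ac])
      show "t \<in> {p..q}" "t > a" using t by (auto simp: a_def)
      show "W differentiable at t" using W(4)[OF t] by (rule differentiableI_vector)
    qed
    then show ?thesis unfolding c'_def using vector_derivative_works by blast
  qed
  have dAc: "((\<lambda>t. A t (c t)) has_vector_derivative A' t (c t) + A t (c' t)) (at t)"
       "((\<lambda>t. A' t (c t)) has_vector_derivative - P t (A t (c t)) + A' t (c' t)) (at t)"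
    if t: "t \<in> {p<..<q} - X" for t
  proof -
    note c = c_deriv[OF t, unfolded has_vector_derivative_def]
    show "((\<lambda>t. A t (c t)) has_vector_derivative A' t (c t) + A t (c' t)) (at t)"
      using has_derivative_family[where F=A and f="\<lambda>s. s" and U=UNIV and S=UNIV, OF open_UNIV UNIV_I lA(1) dA(1) has_derivative_ident c UNIV_I]
      by (simp add: dA has_vector_derivative_def linear_scale[OF lA(1)] scaleR_add_right)
    show "((\<lambda>t. A' t (c t)) has_vector_derivative - P t (A t (c t)) + A' t (c' t)) (at t)"
      using has_derivative_family[where F=A' and f="\<lambda>s. s" and U=UNIV and S=UNIV, OF open_UNIV UNIV_I lA(2) dA(2) has_derivative_ident c UNIV_I]
      by (simp add: dA has_vector_derivative_def linear_scale[OF lA(2)] scaleR_diff_right)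
  qed
  have W': "W' t = A' t (c t) + A t (c' t)" if t: "t \<in> {p<..<q} - X" for t
  proof (rule vector_derivative_unique_at[OF W(4)[OF t]])
    show "(W has_vector_derivative A' t (c t) + A t (c' t)) (at t)"
      by (rule has_vector_derivative_transform_within_open[OF dAc(1)[OF t] ca(1)])
        (use t Ac in \<open>auto simp: a_def\<close>)
  qed
  define Q where "Q = (\<lambda>t. A' t (c t) \<bullet> W t)"
  define Q' where "Q' = (\<lambda>t. A' t (c t) \<bullet> W' t + (- P t (W t) + A' t (c' t)) \<bullet> W t)"
  \<comment> \<open>\<open>Q\<close> vanishes at both ends because \<open>W\<close> does; the
    fundamental theorem tolerates the finite set \<open>X\<close> since \<open>Q\<close> is
    continuous.\<close>
  have "(Q' has_integral (Q q - Q p)) {p..q}"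
  proof (rule fundamental_theorem_of_calculus_interior_strong[OF X pq])
    fix t assume t: "t \<in> {p<..<q} - X"
    have "A t (c t) = W t" using Ac t by (auto simp: a_def)
    then show "(Q has_vector_derivative Q' t) (at t)" unfolding Q_def Q'_def
      using bounded_bilinear.has_vector_derivative[OF bounded_bilinear_inner dAc(2)[OF t] W(4)[OF t]] by simp
  next
    have "continuous_on {p..q} c" using c_cont by (simp add: continuous_at_imp_continuous_on)
    then have "continuous_on {p..q} (\<lambda>t. (t, c t))" by (intro continuous_intros)
    from continuous_on_compose2[OF linear_family_continuous_on[of UNIV A', OF lA(2) sol_continuous(2)[OF sA]] this]
    have "continuous_on {p..q} (\<lambda>t. A' t (c t))" by auto
    then show "continuous_on {p..q} Q" unfolding Q_def
      by (intro continuous_intros continuous_on_subset[OF W(1)]) auto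
  qed
  then have "(Q' has_integral 0) {p..q}" by (simp add: Q_def W)
  from has_integral_diff[OF I this]
  have "((\<lambda>t. W' t \<bullet> W' t - P t (W t) \<bullet> W t - Q' t) has_integral I) {p..q}" by simp
  \<comment> \<open>\<open>W'\<close> is tied to \<open>W\<close> only in the open interval and off
    \<open>X\<close>, so the integrand is set to 0 at the finitely many other points before its sign
    is examined.\<close>
  then have "((\<lambda>t. if t \<in> {p, q} \<union> X then 0 else W' t \<bullet> W' t - P t (W t) \<bullet> W t - Q' t) has_integral I) {p..q}"
    by (rule has_integral_spike_finite[where S="{p, q} \<union> X", rotated 2]) (use X in auto)
  then show "I \<ge> 0"
  proof (rule has_integral_nonneg)
    fix t assume t: "t \<in> {p..q}"
    show "0 \<le> (if t \<in> {p, q} \<union> X then 0 else W' t \<bullet> W' t - P t (W t) \<bullet> W t - Q' t)"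
    proof (cases "t \<in> {p, q} \<union> X")
      case False
      then have t': "t \<in> {p<..<q} - X" using t by auto
      have w: "W t = A t (c t)" using Ac ca t by auto
      have "W' t \<bullet> W' t - P t (W t) \<bullet> W t - Q' t = A t (c' t) \<bullet> A t (c' t)"
        unfolding Q'_def W'[OF t'] w using wron[of t "c' t" "c t"]
        by (simp add: inner_add_left inner_add_right inner_commute algebra_simps)
      then show ?thesis by simp
    qed auto
  qed
qed

end

lemma second_order_scale:
  assumes "second_order K" shows "second_order (\<lambda>t v. \<beta> *\<^sub>R K t v)"
proof -
  interpret second_order K by fact
  show ?thesis
    by unfold_locales (auto intro!: linearI continuous_intros P_cont
        simp: P_sym linear_add[OF P_linear] linear_scale[OF P_linear] scaleR_add_right)
qed

abbreviation "jsol K \<beta> \<equiv> second_order.sol (\<lambda>t v. \<beta> *\<^sub>R K t v)"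
abbreviation "jdisc K \<beta> \<equiv> second_order.disconjugate (\<lambda>t v. \<beta> *\<^sub>R K t v)"

text \<open>The two parts of the index form are kept apart because it is affine in the parameter \<open>\<beta>\<close>.\<close>

definition index_pair :: "(real \<Rightarrow> 'e::euclidean_space \<Rightarrow> 'e) \<Rightarrow> real \<Rightarrow> real \<Rightarrow> bool" where
  "index_pair K I1 I2 \<longleftrightarrow> (\<exists>W W' p q X. finite X \<and> p \<le> q \<and> continuous_on UNIV W \<and> W p = 0 \<and> W q = 0 \<and>
     (\<forall>t\<in>{p<..<q} - X. (W has_vector_derivative W' t) (at t)) \<and>
     ((\<lambda>t. W' t \<bullet> W' t) has_integral I1) {p..q} \<and> ((\<lambda>t. K t (W t) \<bullet> W t) has_integral I2) {p..q})"

lemma index_pair_nonneg: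
  assumes K: "second_order K" and "index_pair K I1 I2" "jdisc K \<beta>"
  shows "I1 - \<beta> * I2 \<ge> 0"
proof -
  obtain W W' p q X where *: "finite X" "p \<le> q" "continuous_on UNIV W" "W p = 0" "W q = 0"
    "\<And>t. t\<in>{p<..<q} - X \<Longrightarrow> (W has_vector_derivative W' t) (at t)"
    "((\<lambda>t. W' t \<bullet> W' t) has_integral I1) {p..q}" "((\<lambda>t. K t (W t) \<bullet> W t) has_integral I2) {p..q}"
    using assms(2) unfolding index_pair_def by blast
  have "((\<lambda>t. W' t \<bullet> W' t - (\<beta> *\<^sub>R K t (W t)) \<bullet> W t) has_integral I1 - \<beta> * I2) {p..q}"
    using has_integral_diff[OF *(7) has_integral_mult_right[OF *(8), of \<beta>]] by simp
  from second_order.index_form_nonneg[OF second_order_scale[OF K] assms(3) *(1-6) this] show ?thesis .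
qed

text \<open>The test field is the Jacobi field extended by zero beyond \<open>b\<close>, minus \<open>\<epsilon> \<phi> J'(b)\<close>. The extension
  has index \<open>0\<close>, and its corner at \<open>b\<close> makes the term linear in \<open>\<epsilon>\<close> negative.\<close>

lemma conjugate_imp_negative_index:
  assumes K: "second_order K" and J: "jsol K \<beta> J J'" "J a = 0" "J b = 0" "a < b" "J' b \<noteq> 0"
  shows "\<exists>I1 I2. index_pair K I1 I2 \<and> I1 - \<beta> * I2 < 0"
proof -
  interpret K: second_order K by fact
  interpret S: second_order "\<lambda>t v. \<beta> *\<^sub>R K t v" by (rule second_order_scale[OF K])
  note dJ = S.solD[OF J(1)]
  have cJ: "continuous_on A J" "continuous_on A J'" for A using S.sol_continuous[OF J(1)] by auto
  define u where "u = J' b"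
  \<comment> \<open>The perturbation has to vanish at \<open>a\<close> and at the end
    \<open>b + 1\<close> of the longer interval and be positive at the corner; here its value at
    \<open>b\<close> is \<open>b - a\<close>.\<close>
  define \<phi> \<phi>' where "\<phi> = (\<lambda>t::real. (t - a) * (b + 1 - t))" and "\<phi>' = (\<lambda>t::real. b + 1 - t - (t - a))"
  have d\<phi>: "(\<phi> has_vector_derivative \<phi>' t) (at t)" for t
    unfolding \<phi>_def \<phi>'_def has_real_derivative_iff_has_vector_derivative[symmetric]
    by (auto intro!: derivative_eq_intros)
  have c\<phi>: "continuous_on A \<phi>" "continuous_on A \<phi>'" for A
    unfolding \<phi>_def \<phi>'_def by (intro continuous_intros)+
  have cKJ: "continuous_on A (\<lambda>t. K t (J t))" for A
  proof -
    have "continuous_on A (\<lambda>t. (t, J t))" by (intro continuous_intros cJ)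
    from continuous_on_compose2[OF linear_family_continuous_on[of UNIV K, OF K.P_linear K.P_cont] this]
    show ?thesis by auto
  qed
  have cKu: "continuous_on A (\<lambda>t. K t u)" for A using K.P_cont continuous_on_subset by blast
  note ints = integrable_integral[OF integrable_continuous_real]
  define a1 where "a1 = integral {a..b} (\<lambda>t. J' t \<bullet> J' t)"
  define a2 where "a2 = integral {a..b} (\<lambda>t. \<phi>' t * (J' t \<bullet> u))"
  define a3 where "a3 = integral {a..b + 1} (\<lambda>t. \<phi>' t * \<phi>' t * (u \<bullet> u))"
  define b1 where "b1 = integral {a..b} (\<lambda>t. K t (J t) \<bullet> J t)"
  define b2 where "b2 = integral {a..b} (\<lambda>t. \<phi> t * (K t (J t) \<bullet> u))"
  define b3 where "b3 = integral {a..b + 1} (\<lambda>t. \<phi> t * \<phi> t * (K t u \<bullet> u))"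
  have i: "((\<lambda>t. J' t \<bullet> J' t) has_integral a1) {a..b}" "((\<lambda>t. \<phi>' t * (J' t \<bullet> u)) has_integral a2) {a..b}"
    "((\<lambda>t. \<phi>' t * \<phi>' t * (u \<bullet> u)) has_integral a3) {a..b + 1}"
    "((\<lambda>t. K t (J t) \<bullet> J t) has_integral b1) {a..b}" "((\<lambda>t. \<phi> t * (K t (J t) \<bullet> u)) has_integral b2) {a..b}"
    "((\<lambda>t. \<phi> t * \<phi> t * (K t u \<bullet> u)) has_integral b3) {a..b + 1}"
    unfolding a1_def a2_def a3_def b1_def b2_def b3_def
    by (intro ints continuous_intros cJ c\<phi> cKJ cKu)+
  \<comment> \<open>Integration by parts: a solution with zeros at both ends has index 0.\<close>
  have e1: "a1 - \<beta> * b1 = 0"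
  proof -
    have "((\<lambda>t. J' t \<bullet> J t) has_vector_derivative J' t \<bullet> J' t + (- (\<beta> *\<^sub>R K t (J t))) \<bullet> J t) (at t)" for t
      by (rule bounded_bilinear.has_vector_derivative[OF bounded_bilinear_inner dJ(2) dJ(1)])
    from fundamental_theorem_of_calculus[OF less_imp_le[OF J(4)] has_vector_derivative_at_within[OF this]]
    have "((\<lambda>t. J' t \<bullet> J' t + (- (\<beta> *\<^sub>R K t (J t))) \<bullet> J t) has_integral (J' b \<bullet> J b - J' a \<bullet> J a)) {a..b}" .
    moreover have "((\<lambda>t. J' t \<bullet> J' t - \<beta> * (K t (J t) \<bullet> J t)) has_integral (a1 - \<beta> * b1)) {a..b}"
      by (intro has_integral_diff has_integral_mult_right i)
    ultimately have "J' b \<bullet> J b - J' a \<bullet> J a = a1 - \<beta> * b1" by (simp add: has_integral_unique)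
    then show ?thesis using J by simp
  qed
  \<comment> \<open>The contribution of the corner: integrating the cross term by parts leaves the
    boundary value of \<open>\<phi> t * (J' t \<bullet> u)\<close> at \<open>b\<close>, where
    \<open>J' b = u\<close>.\<close>
  have e2: "a2 - \<beta> * b2 = (b - a) * (u \<bullet> u)"
  proof -
    have 1: "((\<lambda>t. J' t \<bullet> u) has_vector_derivative (- (\<beta> *\<^sub>R K t (J t))) \<bullet> u) (at t)" for t
      by (rule bounded_linear.has_vector_derivative[OF bounded_linear_inner_left dJ(2)])
    have "((\<lambda>t. \<phi> t * (J' t \<bullet> u)) has_vector_derivative \<phi> t * (- (\<beta> *\<^sub>R K t (J t)) \<bullet> u) + \<phi>' t * (J' t \<bullet> u)) (at t)" for t
      by (rule bounded_bilinear.has_vector_derivative[OF bounded_bilinear_mult d\<phi> 1])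
    from fundamental_theorem_of_calculus[OF less_imp_le[OF J(4)] has_vector_derivative_at_within[OF this]]
    have "((\<lambda>t. \<phi> t * (- (\<beta> *\<^sub>R K t (J t)) \<bullet> u) + \<phi>' t * (J' t \<bullet> u)) has_integral (\<phi> b * (J' b \<bullet> u) - \<phi> a * (J' a \<bullet> u))) {a..b}" .
    moreover have "((\<lambda>t. \<phi>' t * (J' t \<bullet> u) - \<beta> * (\<phi> t * (K t (J t) \<bullet> u))) has_integral (a2 - \<beta> * b2)) {a..b}"
      by (intro has_integral_diff has_integral_mult_right i)
    moreover have "(\<lambda>t. \<phi> t * (- (\<beta> *\<^sub>R K t (J t)) \<bullet> u) + \<phi>' t * (J' t \<bullet> u)) = (\<lambda>t. \<phi>' t * (J' t \<bullet> u) - \<beta> * (\<phi> t * (K t (J t) \<bullet> u)))"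
      by (auto simp: algebra_simps)
    ultimately show ?thesis by (simp add: has_integral_unique \<phi>_def u_def)
  qed
  define C where "C = a3 - \<beta> * b3"
  \<comment> \<open>The index equals \<open>\<epsilon> * (\<epsilon> * C - 2 * ((b - a) * (u
    \<bullet> u)))\<close>. This choice makes the quadratic part at most half of what is to be
    beaten, and the 1 avoids division by zero.\<close>
  define \<epsilon> where "\<epsilon> = (b - a) * (u \<bullet> u) / (\<bar>C\<bar> + 1)"
  have uu: "(b - a) * (u \<bullet> u) > 0" using J by (simp add: u_def)
  have \<epsilon>: "\<epsilon> > 0" using uu by (simp add: \<epsilon>_def)
  have "\<epsilon> * C < 2 * ((b - a) * (u \<bullet> u))"
  proof -
    have "\<epsilon> * C \<le> \<epsilon> * (\<bar>C\<bar> + 1)" using \<epsilon> by (intro mult_left_mono) auto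
    also have "\<dots> = (b - a) * (u \<bullet> u)" by (simp add: \<epsilon>_def)
    also have "\<dots> < 2 * ((b - a) * (u \<bullet> u))" using uu by linarith
    finally show ?thesis .
  qed
  define I1 I2 where "I1 = a1 - 2 * \<epsilon> * a2 + \<epsilon>\<^sup>2 * a3" and "I2 = b1 - 2 * \<epsilon> * b2 + \<epsilon>\<^sup>2 * b3"
  have "I1 - \<beta> * I2 = (a1 - \<beta> * b1) - 2 * \<epsilon> * (a2 - \<beta> * b2) + \<epsilon>\<^sup>2 * C"
    by (simp add: I1_def I2_def C_def algebra_simps)
  also have "\<dots> = \<epsilon> * (\<epsilon> * C - 2 * ((b - a) * (u \<bullet> u)))"
    unfolding e1 e2 by (simp add: power2_eq_square algebra_simps)
  also have "\<dots> < 0" using \<epsilon> \<open>\<epsilon> * C < _\<close> by (simp add: mult_pos_neg)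
  finally have neg: "I1 - \<beta> * I2 < 0" .
  \<comment> \<open>Since \<open>J b = 0\<close>, the cut-off \<open>J (min t b)\<close> is the
    extension by zero, continuous but with a corner at \<open>b\<close>.\<close>
  define W where "W = (\<lambda>t. J (min t b) - (\<epsilon> * \<phi> t) *\<^sub>R u)"
  define W' where "W' = (\<lambda>t. (if t \<in> {a..b} then J' t else 0) - (\<epsilon> * \<phi>' t) *\<^sub>R u)"
  have "index_pair K I1 I2" unfolding index_pair_def
  proof (intro exI conjI ballI)
    show "finite {b}" "a \<le> b + 1" using J by auto
    show "continuous_on UNIV W" unfolding W_def
      by (intro continuous_intros c\<phi> continuous_on_compose2[OF cJ(1)[of UNIV]]) auto
    show "W a = 0" "W (b + 1) = 0" using J by (auto simp: W_def \<phi>_def min_def)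
  next
    fix t assume t: "t \<in> {a<..<b + 1} - {b}"
    have 2: "((\<lambda>t. (\<epsilon> * \<phi> t) *\<^sub>R u) has_vector_derivative (\<epsilon> * \<phi>' t) *\<^sub>R u) (at t)"
      by (intro bounded_linear.has_vector_derivative[OF bounded_linear_scaleR_left]
          bounded_linear.has_vector_derivative[OF bounded_linear_mult_right] d\<phi>)
    have 1: "((\<lambda>t. J (min t b)) has_vector_derivative (if t \<in> {a..b} then J' t else 0)) (at t)"
    proof (cases "t < b")
      case True
      then have "((\<lambda>t. J (min t b)) has_vector_derivative J' t) (at t)"
        by (intro has_vector_derivative_transform_within_open[OF dJ(1) open_lessThan[of b]]) (auto simp: min_def)
      then show ?thesis using True t by auto
    next
      case False
      then have "((\<lambda>t. J (min t b)) has_vector_derivative 0) (at t)"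
        using t J(3) by (intro has_vector_derivative_transform_within_open[OF has_vector_derivative_const open_greaterThan[of b]]) (auto simp: min_def)
      then show ?thesis using False t by auto
    qed
    show "(W has_vector_derivative W' t) (at t)" unfolding W_def W'_def
      by (rule has_vector_derivative_diff[OF 1 2])
  next
    have sub: "{a..b} \<subseteq> {a..b + 1}" by auto
    note R = has_integral_restrict[OF sub, THEN iffD2]
    have "((\<lambda>t. (if t \<in> {a..b} then J' t \<bullet> J' t else 0) - 2 * \<epsilon> * (if t \<in> {a..b} then \<phi>' t * (J' t \<bullet> u) else 0)
       + \<epsilon>\<^sup>2 * (\<phi>' t * \<phi>' t * (u \<bullet> u))) has_integral I1) {a..b + 1}" unfolding I1_def
      by (intro has_integral_add has_integral_diff has_integral_mult_right R i)
    then show "((\<lambda>t. W' t \<bullet> W' t) has_integral I1) {a..b + 1}"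
      by (rule has_integral_eq[rotated])
        (auto simp: W'_def inner_diff_left inner_diff_right inner_commute power2_eq_square algebra_simps)
    have W1: "W t = (if t \<in> {a..b} then J t else 0) - (\<epsilon> * \<phi> t) *\<^sub>R u" if "t \<in> {a..b + 1}" for t
      using that J(3) by (auto simp: W_def min_def)
    have "((\<lambda>t. (if t \<in> {a..b} then K t (J t) \<bullet> J t else 0) - 2 * \<epsilon> * (if t \<in> {a..b} then \<phi> t * (K t (J t) \<bullet> u) else 0)
       + \<epsilon>\<^sup>2 * (\<phi> t * \<phi> t * (K t u \<bullet> u))) has_integral I2) {a..b + 1}" unfolding I2_def
      by (intro has_integral_add has_integral_diff has_integral_mult_right R i)
    then show "((\<lambda>t. K t (W t) \<bullet> W t) has_integral I2) {a..b + 1}"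
    proof (rule has_integral_eq[rotated])
      fix t assume t: "t \<in> {a..b + 1}"
      show "(if t \<in> {a..b} then K t (J t) \<bullet> J t else 0) - 2 * \<epsilon> * (if t \<in> {a..b} then \<phi> t * (K t (J t) \<bullet> u) else 0)
       + \<epsilon>\<^sup>2 * (\<phi> t * \<phi> t * (K t u \<bullet> u)) = K t (W t) \<bullet> W t"
        unfolding W1[OF t] using K.P_sym[of t u "J t"]
        by (auto simp: linear_diff[OF K.P_linear] linear_scale[OF K.P_linear] linear_0[OF K.P_linear]
           inner_diff_left inner_diff_right inner_commute power2_eq_square algebra_simps)
    qed
  qed
  with neg show ?thesis by blast
qed

text \<open>The test field is the constant vector \<open>x\<close> times the bump \<delta>^2 - t^2,
  supported where \<open>K t x \<bullet> x\<close> exceeds half its value at 0. Only the sign of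
  \<open>I2\<close> matters, because it multiplies \<beta> and dominates for large
  parameters.\<close>

lemma positive_curvature_index:
  assumes K: "second_order K" and pos: "K 0 x \<bullet> x > 0"
  shows "\<exists>I1 I2. index_pair K I1 I2 \<and> I2 > 0"
proof -
  interpret K: second_order K by fact
  define k where "k = (\<lambda>t. K t x \<bullet> x)"
  have ck: "continuous_on A k" for A unfolding k_def
    by (intro continuous_intros continuous_on_subset[OF K.P_cont]) auto
  have "continuous (at 0) k" using ck[of UNIV] by (simp add: continuous_on_eq_continuous_at)
  then obtain d where d: "d > 0" "\<And>t. dist t 0 < d \<Longrightarrow> dist (k t) (k 0) < k 0 / 2"
    using pos unfolding continuous_at_eps_delta k_def by (metis half_gt_zero)
  define \<delta> where "\<delta> = d / 2"
  have \<delta>: "\<delta> > 0" using d by (simp add: \<delta>_def)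
  have kpos: "k t > k 0 / 2" if "t \<in> {-\<delta>..\<delta>}" for t
  proof -
    have "dist t 0 < d" using that d(1) by (auto simp: \<delta>_def)
    then have "\<bar>k t - k 0\<bar> < k 0 / 2" using d(2)[of t] by (simp only: dist_real_def)
    then show ?thesis by linarith
  qed
  define \<phi> \<phi>' where "\<phi> = (\<lambda>t::real. \<delta>\<^sup>2 - t\<^sup>2)" and "\<phi>' = (\<lambda>t::real. - 2 * t)"
  have d\<phi>: "(\<phi> has_vector_derivative \<phi>' t) (at t)" for t
    unfolding \<phi>_def \<phi>'_def has_real_derivative_iff_has_vector_derivative[symmetric]
    by (auto intro!: derivative_eq_intros)
  have c\<phi>: "continuous_on A \<phi>" "continuous_on A \<phi>'" for A
    unfolding \<phi>_def \<phi>'_def by (intro continuous_intros)+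
  note ints = integrable_integral[OF integrable_continuous_real]
  define I1 where "I1 = integral {-\<delta>..\<delta>} (\<lambda>t. \<phi>' t * \<phi>' t * (x \<bullet> x))"
  define I2 where "I2 = integral {-\<delta>..\<delta>} (\<lambda>t. \<phi> t * \<phi> t * k t)"
  have i: "((\<lambda>t. \<phi>' t * \<phi>' t * (x \<bullet> x)) has_integral I1) {-\<delta>..\<delta>}"
    "((\<lambda>t. \<phi> t * \<phi> t * k t) has_integral I2) {-\<delta>..\<delta>}"
    unfolding I1_def I2_def by (intro ints continuous_intros c\<phi> ck)+
  have "index_pair K I1 I2" unfolding index_pair_def
  proof (intro exI conjI ballI)
    show "finite ({} :: real set)" "- \<delta> \<le> \<delta>" using \<delta> by auto
    show "continuous_on UNIV (\<lambda>t. \<phi> t *\<^sub>R x)" by (intro continuous_intros c\<phi>)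
    show "\<phi> (- \<delta>) *\<^sub>R x = 0" "\<phi> \<delta> *\<^sub>R x = 0" by (auto simp: \<phi>_def)
    show "((\<lambda>t. \<phi> t *\<^sub>R x) has_vector_derivative \<phi>' t *\<^sub>R x) (at t)" for t
      by (intro bounded_linear.has_vector_derivative[OF bounded_linear_scaleR_left] d\<phi>)
    show "((\<lambda>t. \<phi>' t *\<^sub>R x \<bullet> \<phi>' t *\<^sub>R x) has_integral I1) {- \<delta>..\<delta>}" using i(1) by (simp add: mult_ac)
    show "((\<lambda>t. K t (\<phi> t *\<^sub>R x) \<bullet> \<phi> t *\<^sub>R x) has_integral I2) {- \<delta>..\<delta>}"
      using i(2) by (simp add: linear_scale[OF K.P_linear] mult_ac k_def)
  qed
  moreover have "I2 > 0"
  proof -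
    have nn: "0 \<le> \<phi> t * \<phi> t * k t" if "t \<in> {-\<delta>..\<delta>}" for t
      using kpos[OF that] pos by (intro mult_nonneg_nonneg[OF zero_le_square]) (simp add: k_def)
    then have "I2 \<ge> 0" using i(2) by (rule has_integral_nonneg[rotated])
    moreover have "I2 \<noteq> 0"
    proof
      assume "I2 = 0"
      then have "\<phi> 0 * \<phi> 0 * k 0 = 0"
        using has_integral_0_cbox_imp_0[of "-\<delta>" \<delta> "\<lambda>t. \<phi> t * \<phi> t * k t" 0] i(2) nn \<delta>
        by (force intro: continuous_intros c\<phi> ck)
      then show False using pos \<delta> by (simp add: \<phi>_def k_def)
    qed
    ultimately show ?thesis by linarith
  qed
  ultimately show ?thesis by blast
qed

text \<open>Between the zeros the nondecreasing function \<open>y' \<bullet> y\<close> is squeezed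
  to 0, hence so is its derivative, a sum of two nonnegative terms. Thus \<open>y' = 0\<close>
  there, \<open>y\<close> is constant and zero, and uniqueness spreads this to all times. The sign
  condition is imposed along \<open>y\<close> alone, since it will come from sectional curvatures of
  planes containing the velocity.\<close>

lemma nonpositive_imp_no_conjugate:
  assumes K: "second_order K" and \<beta>: "\<beta> \<ge> 0" and y: "jsol K \<beta> y y'" "y a = 0" "y b = 0" "a < b"
    and np: "\<And>t. \<beta> * (K t (y t) \<bullet> y t) \<le> 0"
  shows "y t = 0"
proof -
  interpret S: second_order "\<lambda>t v. \<beta> *\<^sub>R K t v" by (rule second_order_scale[OF K])
  note dy = S.solD[OF y(1)]
  define h where "h = (\<lambda>t. y' t \<bullet> y t)"
  have dh: "(h has_real_derivative y' t \<bullet> y' t - \<beta> * (K t (y t) \<bullet> y t)) (at t)" for t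
    using bounded_bilinear.has_vector_derivative[OF bounded_bilinear_inner dy(2) dy(1), of t]
    by (simp add: h_def has_real_derivative_iff_has_vector_derivative)
  have mono: "h s \<le> h t" if "s \<le> t" for s t
  proof (rule DERIV_nonneg_imp_nondecreasing[OF that])
    fix x show "\<exists>z. (h has_real_derivative z) (at x) \<and> 0 \<le> z"
      using dh[of x] np[of x] inner_ge_zero[of "y' x"] by (intro exI conjI) (assumption, linarith)
  qed
  have h0: "h t = 0" if "t \<in> {a..b}" for t
    using mono[of a t] mono[of t b] that y by (auto simp: h_def)
  have y'0: "y' t = 0" if t: "t \<in> {a<..<b}" for t
  proof -
    have "(h has_real_derivative 0) (at t)"
      by (rule has_field_derivative_transform_within_open[OF DERIV_const open_greaterThanLessThan t, of 0])
        (use h0 in auto)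
    then have "y' t \<bullet> y' t - \<beta> * (K t (y t) \<bullet> y t) = 0" using dh DERIV_unique by blast
    then show ?thesis using np[of t] inner_ge_zero[of "y' t"] by (metis diff_ge_0_iff_ge inner_eq_zero_iff le_iff_diff_le_0 order_antisym order_trans eq_iff_diff_eq_0)
  qed
  define m where "m = (a + b) / 2"
  have m: "m \<in> {a<..<b}" using y by (auto simp: m_def)
  have "y m = y a"
  proof (rule has_derivative_zero_unique_strong_interval[where k="{a, b}" and a=a and b=b])
    show "continuous_on {a..b} y" by (rule S.sol_continuous[OF y(1)])
    show "(y has_derivative (\<lambda>h. 0)) (at t within {a..b})" if "t \<in> {a..b} - {a, b}" for t
      using dy(1)[of t] y'0[of t] that
      by (auto simp: has_vector_derivative_def intro: has_derivative_at_withinI)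
  qed (use m in auto)
  then have "y m = 0" using y by simp
  then show ?thesis using S.sol_unique[OF y(1), of m] y'0[OF m] by blast
qed

section \<open>Charts and tangent spaces\<close>

lemma christoffel_eq: "christoffel A g c = chris (metric_coord A g c)"
  by (intro ext) (simp add: christoffel_def chris_def)

lemma curvature_coord_eq: "curvature_coord A g c = riem (chris (metric_coord A g c))"
  by (intro ext) (simp add: curvature_coord_def riem_def christoffel_eq)

locale rmfd =
  fixes M :: "'a::{t2_space, second_countable_topology} set"
    and A :: "('a, 'e::euclidean_space) chart set" and g :: "('a, 'e) metric"
  assumes closed_mfd: "closed_riemannian_manifold M A g"
begin

abbreviation Gc where "Gc \<equiv> metric_coord A g"
abbreviation T where "T \<equiv> tangent_space A"
abbreviation cimg where "cimg c \<equiv> cmap c ` cdom c"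
abbreviation ch where "ch \<equiv> charts_at A"

definition D where "D c d p v = dd (transition c d) (cmap c p) v"

lemma compact_M: "compact M"
  and mfd: "smooth_manifold M A"
  and metric: "riemannian_metric M A g"
  using closed_mfd by (auto simp: closed_riemannian_manifold_def)

lemma cover: "p \<in> M \<Longrightarrow> \<exists>c. c \<in> ch p"
  using mfd unfolding smooth_manifold_def charts_at_def by blast

lemma ch_iff: "c \<in> ch p \<longleftrightarrow> c \<in> A \<and> p \<in> cdom c"
  by (simp add: charts_at_def)

lemma ch_M: "c \<in> ch p \<Longrightarrow> p \<in> M"
  using mfd unfolding smooth_manifold_def charts_at_def by blast

lemma
  assumes "c \<in> A"
  shows cdom_open: "openin (top_of_set M) (cdom c)"
    and cimg_open: "open (cimg c)"
    and chart_homeo: "homeomorphism (cdom c) (cimg c) (cmap c) (cinv c)"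
  using mfd assms unfolding smooth_manifold_def by blast+

lemma cinv_cmap: "c \<in> ch p \<Longrightarrow> cinv c (cmap c p) = p"
  using chart_homeo unfolding homeomorphism_def ch_iff by blast

lemma cmap_cinv: "c \<in> A \<Longrightarrow> x \<in> cimg c \<Longrightarrow> cmap c (cinv c x) = x"
  using chart_homeo unfolding homeomorphism_def by blast

lemma cinv_in: "c \<in> A \<Longrightarrow> x \<in> cimg c \<Longrightarrow> c \<in> ch (cinv c x)"
  by (simp add: ch_iff inv_into_into)

lemma cmap_in: "c \<in> ch p \<Longrightarrow> cmap c p \<in> cimg c"
  by (auto simp: ch_iff)

lemma cmap_cont: "c \<in> A \<Longrightarrow> continuous_on (cdom c) (cmap c)"
  using chart_homeo homeomorphism_cont1 by blast

lemma cinv_cont: "c \<in> A \<Longrightarrow> continuous_on (cimg c) (cinv c)"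
  using chart_homeo homeomorphism_cont2 by blast

definition overlap where "overlap c d = cmap c ` (cdom c \<inter> cdom d)"

lemma overlap_open:
  assumes "c \<in> A" "d \<in> A" shows "open (overlap c d)"
proof -
  have "openin (top_of_set M) (cdom c \<inter> cdom d)" using assms cdom_open by blast
  then have "openin (top_of_set (cdom c)) (cdom c \<inter> cdom d)"
    using openin_subset_trans[of M "cdom c \<inter> cdom d" "cdom c"] cdom_open[OF assms(1)]
    by (auto dest: openin_imp_subset)
  then have "openin (top_of_set (cimg c)) (overlap c d)" unfolding overlap_def
    using homeomorphism_imp_open_map[OF chart_homeo[OF assms(1)]] by blast
  then show ?thesis using cimg_open[OF assms(1)] openin_open_trans by blast
qed

lemma overlap_in: "c \<in> ch p \<Longrightarrow> d \<in> ch p \<Longrightarrow> cmap c p \<in> overlap c d"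
  by (auto simp: overlap_def ch_iff)

lemma overlapE:
  assumes "c \<in> A" "d \<in> A" "x \<in> overlap c d"
  obtains p where "c \<in> ch p" "d \<in> ch p" "x = cmap c p"
  using assms unfolding overlap_def ch_iff by blast

lemma transition_smooth: "c \<in> A \<Longrightarrow> d \<in> A \<Longrightarrow> smooth_on (overlap c d) (transition c d)"
  using mfd unfolding smooth_manifold_def overlap_def by blast

lemma transition_eq: "c \<in> ch p \<Longrightarrow> transition c d (cmap c p) = cmap d p"
  by (simp add: cinv_cmap)

lemma transition_diffable: "c \<in> ch p \<Longrightarrow> d \<in> ch p \<Longrightarrow> transition c d differentiable at (cmap c p)"
  using smooth_on_differentiable[OF transition_smooth overlap_in] by (simp add: ch_iff)

lemma D_linear: "c \<in> ch p \<Longrightarrow> d \<in> ch p \<Longrightarrow> linear (D c d p)"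
  unfolding D_def by (rule linear_dd[OF transition_diffable])

lemma D_cocycle:
  assumes "c \<in> ch p" "d \<in> ch p" "e \<in> ch p" shows "D d e p (D c d p v) = D c e p v"
proof -
  let ?x = "cmap c p"
  have c: "c \<in> A" "d \<in> A" "e \<in> A" using assms by (auto simp: ch_iff)
  have "transition d e differentiable at (transition c d ?x)"
    using transition_diffable assms transition_eq by metis
  then have "((\<lambda>x. transition d e (transition c d x)) has_derivative
      (\<lambda>v. dd (transition d e) (transition c d ?x) (dd (transition c d) ?x v))) (at ?x)"
    by (intro has_derivative_compose[OF has_derivative_dd[OF transition_diffable] has_derivative_dd] assms)
  from dd_eq[OF this] have "D d e p (D c d p v) = dd (\<lambda>x. transition d e (transition c d x)) ?x v"
    using transition_eq[OF assms(1)] by (simp add: D_def)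
  also have "\<dots> = dd (transition c e) ?x v"
  proof (rule dd_cong_at)
    show "open (overlap c d \<inter> overlap c e)" using overlap_open c by blast
    show "?x \<in> overlap c d \<inter> overlap c e" using overlap_in assms by blast
    fix y assume "y \<in> overlap c d \<inter> overlap c e"
    then obtain q where q: "c \<in> ch q" "d \<in> ch q" "y = cmap c q" using overlapE c by blast
    then show "transition d e (transition c d y) = transition c e y"
      using transition_eq by metis
  qed
  finally show ?thesis by (simp add: D_def)
qed

lemma D_id: assumes "c \<in> ch p" shows "D c c p v = v"
proof -
  have c: "c \<in> A" using assms by (simp add: ch_iff)
  have "D c c p v = dd (\<lambda>x. x) (cmap c p) v" unfolding D_def
  proof (rule dd_cong_at[OF overlap_open[OF c c] overlap_in[OF assms assms]])
    fix y assume "y \<in> overlap c c"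
    then obtain q where "c \<in> ch q" "y = cmap c q" using overlapE c by blast
    then show "transition c c y = y" using transition_eq by metis
  qed
  then show ?thesis by simp
qed

lemma D_inverse: "c \<in> ch p \<Longrightarrow> d \<in> ch p \<Longrightarrow> D d c p (D c d p v) = v"
  using D_cocycle D_id by metis

section \<open>Tangent vectors and their coordinates\<close>

lemma T_iff: "v \<in> T p \<longleftrightarrow> (\<forall>c\<in>ch p. \<forall>d\<in>ch p. v d = D c d p (v c)) \<and> (\<forall>c. c \<notin> ch p \<longrightarrow> v c = 0)"
  by (simp add: tangent_space_def D_def)

lemma T_D: "v \<in> T p \<Longrightarrow> c \<in> ch p \<Longrightarrow> d \<in> ch p \<Longrightarrow> v d = D c d p (v c)"
  unfolding T_iff by blast

lemma T_out: "v \<in> T p \<Longrightarrow> c \<notin> ch p \<Longrightarrow> v c = 0"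
  unfolding T_iff by blast

lemma T_eqI: assumes "u \<in> T p" "v \<in> T p" "c \<in> ch p" "u c = v c" shows "u = v"
proof
  fix d show "u d = v d"
    using T_D[OF assms(1,3), of d] T_D[OF assms(2,3), of d] T_out[OF assms(1), of d] T_out[OF assms(2), of d] assms(4)
    by (cases "d \<in> ch p") auto
qed

lemma T_0: "(\<lambda>c. 0) \<in> T p"
  using linear_0[OF D_linear] by (simp add: T_iff)

lemma T_comb: "u \<in> T p \<Longrightarrow> v \<in> T p \<Longrightarrow> (\<lambda>c. r *\<^sub>R u c + s *\<^sub>R v c) \<in> T p"
proof -
  assume u: "u \<in> T p" and v: "v \<in> T p"
  show ?thesis unfolding T_iff
  proof (intro conjI ballI allI impI)
    fix c d assume "c \<in> ch p" "d \<in> ch p"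
    then show "r *\<^sub>R u d + s *\<^sub>R v d = D c d p (r *\<^sub>R u c + s *\<^sub>R v c)"
      using T_D[OF u, of c d] T_D[OF v, of c d] linear_add[OF D_linear] linear_scale[OF D_linear] by metis
  qed (simp add: T_out[OF u] T_out[OF v])
qed

lemma T_add: "u \<in> T p \<Longrightarrow> v \<in> T p \<Longrightarrow> (\<lambda>c. u c + v c) \<in> T p"
  using T_comb[of u p v 1 1] by simp

lemma T_scale: "u \<in> T p \<Longrightarrow> (\<lambda>c. r *\<^sub>R u c) \<in> T p"
  using T_comb[of u p u r 0] by simp

lemma T_sum: "(\<And>i. i \<in> I \<Longrightarrow> u i \<in> T p) \<Longrightarrow> (\<lambda>c. \<Sum>i\<in>I. u i c) \<in> T p"
  by (induction I rule: infinite_finite_induct) (auto simp: T_0 intro: T_add)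

lemma tvec_of_at: "c \<in> ch p \<Longrightarrow> d \<in> ch p \<Longrightarrow> tvec_of A c p x d = D c d p x"
  by (simp add: tvec_of_def D_def)

lemma tvec_of_self: "c \<in> ch p \<Longrightarrow> tvec_of A c p x c = x"
  by (simp add: tvec_of_at D_id)

lemma tvec_of_T: "c \<in> ch p \<Longrightarrow> tvec_of A c p x \<in> T p"
  unfolding T_iff by (auto simp: tvec_of_at D_cocycle) (simp add: tvec_of_def)

lemma tvec_of_eq: "c \<in> ch p \<Longrightarrow> v \<in> T p \<Longrightarrow> tvec_of A c p (v c) = v"
  by (rule T_eqI[OF tvec_of_T]) (auto simp: tvec_of_self)

lemma tvec_of_D: "c \<in> ch p \<Longrightarrow> d \<in> ch p \<Longrightarrow> tvec_of A d p (D c d p x) = tvec_of A c p x"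
  by (rule T_eqI[OF tvec_of_T tvec_of_T, of d _ c d]) (auto simp: tvec_of_at D_id)

section \<open>Metric and curvature in charts\<close>

lemma inner_T: "p \<in> M \<Longrightarrow> inner_product_on_tangent_space A p (g p)"
  using metric by (simp add: riemannian_metric_def)

lemma g_coord:
  assumes "c \<in> ch p" "u \<in> T p" "v \<in> T p" shows "g p u v = Gc c (cmap c p) (u c) (v c)"
  using assms by (simp add: metric_coord_def cinv_cmap tvec_of_eq)

lemma coord_metric:
  assumes "c \<in> A" shows "coord_metric (cimg c) (Gc c)"
proof (rule coord_metric.intro)
  show "open (cimg c)" by (rule cimg_open[OF assms])
  show "smooth_on (cimg c) (\<lambda>x. Gc c x u v)" for u v
    using metric assms by (simp add: riemannian_metric_def)
  fix x :: 'e and u v assume x: "x \<in> cimg c"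
  define p where "p = cinv c x"
  have c: "c \<in> ch p" unfolding p_def by (rule cinv_in[OF assms x])
  have ip: "inner_product_on_tangent_space A p (g p)" using inner_T ch_M c by blast
  have G: "Gc c x u v = g p (tvec_of A c p u) (tvec_of A c p v)" for u v by (simp add: metric_coord_def p_def)
  show "Gc c x u v = Gc c x v u"
    unfolding G using ip tvec_of_T[OF c] unfolding inner_product_on_tangent_space_def by blast
  have comb: "tvec_of A c p (r *\<^sub>R a + s *\<^sub>R b) = (\<lambda>d. r *\<^sub>R tvec_of A c p a d + s *\<^sub>R tvec_of A c p b d)" for r s a b
    by (rule T_eqI[OF tvec_of_T[OF c] T_comb[OF tvec_of_T[OF c] tvec_of_T[OF c]] c]) (simp add: tvec_of_self[OF c])
  have lin: "Gc c x (r *\<^sub>R a + s *\<^sub>R b) v = r * Gc c x a v + s * Gc c x b v" for r s a b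
    unfolding G comb using ip tvec_of_T[OF c] unfolding inner_product_on_tangent_space_def by blast
  show "linear (\<lambda>u. Gc c x u v)"
    using lin[of 1 _ 1] lin[of _ _ 0 0] by (intro linearI) auto
  show "Gc c x u u > 0" if "u \<noteq> 0"
  proof -
    have "tvec_of A c p u \<noteq> (\<lambda>c. 0)" using tvec_of_self[OF c, of u] that by metis
    then show ?thesis
      unfolding G using ip tvec_of_T[OF c] unfolding inner_product_on_tangent_space_def by blast
  qed
qed

text \<open>Both coordinate expressions evaluate the same inner product on the same tangent vectors,
  so a transition map is an isometry and the transformation laws apply to it.\<close>

lemma coord_isometry:
  assumes c: "c \<in> A" and d: "d \<in> A"
  shows "coord_isometry (cimg c) (Gc c) (cimg d) (Gc d) (overlap c d) (transition c d)"
proof (intro coord_isometry.intro coord_metric c d, unfold_locales)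
  show "open (overlap c d)" by (rule overlap_open[OF c d])
  show "overlap c d \<subseteq> cimg c" by (auto simp: overlap_def)
  show "transition c d ` overlap c d \<subseteq> cimg d"
    using overlapE[OF c d] transition_eq cmap_in by (metis image_subsetI)
  show "smooth_on (overlap c d) (transition c d)" by (rule transition_smooth[OF c d])
next
  fix x :: 'e and u v assume "x \<in> overlap c d"
  then obtain p where p: "c \<in> ch p" "d \<in> ch p" "x = cmap c p" using overlapE[OF c d] by metis
  have "inj (D c d p)" using D_inverse[OF p(1,2)] by (metis injI)
  then show "inj (\<lambda>v. dd (transition c d) x v)" by (simp add: D_def[abs_def] p(3))
  have "Gc d (transition c d x) (D c d p u) (D c d p v) = Gc c x u v"
    using p by (simp add: metric_coord_def cinv_cmap tvec_of_D)
  then show "Gc c x u v = Gc d (transition c d x) (dd (transition c d) x u) (dd (transition c d) x v)"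
    by (simp add: D_def p(3))
qed

lemma curvature_at:
  "c \<in> ch p \<Longrightarrow> curvature A g p u v w c = riem (chris (Gc c)) (cmap c p) (u c) (v c) (w c)"
  by (simp add: curvature_def curvature_coord_eq)

text \<open>The curvature is defined chart by chart; by \<open>riem_law\<close> the components are
  related by the differentials of the transition maps.\<close>

lemma curvature_T:
  assumes "u \<in> T p" "v \<in> T p" "w \<in> T p" shows "curvature A g p u v w \<in> T p"
  unfolding T_iff
proof (intro conjI ballI allI impI)
  fix c d assume c: "c \<in> ch p" and d: "d \<in> ch p"
  then have A: "c \<in> A" "d \<in> A" by (auto simp: ch_iff)
  interpret coord_isometry "cimg c" "Gc c" "cimg d" "Gc d" "overlap c d" "transition c d"
    by (rule coord_isometry[OF A])
  show "curvature A g p u v w d = D c d p (curvature A g p u v w c)"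
    using riem_law[OF overlap_in[OF c d], of "u c" "v c" "w c"]
    unfolding curvature_at[OF c] curvature_at[OF d] transition_eq[OF c] D_def[symmetric]
      T_D[OF assms(1) c d, symmetric] T_D[OF assms(2) c d, symmetric] T_D[OF assms(3) c d, symmetric] by simp
qed (simp add: curvature_def)

lemma g_sym: "p \<in> M \<Longrightarrow> u \<in> T p \<Longrightarrow> v \<in> T p \<Longrightarrow> g p u v = g p v u"
  using inner_T unfolding inner_product_on_tangent_space_def by blast

lemma g_comb: "p \<in> M \<Longrightarrow> u \<in> T p \<Longrightarrow> v \<in> T p \<Longrightarrow> w \<in> T p \<Longrightarrow>
   g p (\<lambda>c. r *\<^sub>R u c + s *\<^sub>R v c) w = r * g p u w + s * g p v w"
  using inner_T unfolding inner_product_on_tangent_space_def by blast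

lemma g_scale: "p \<in> M \<Longrightarrow> u \<in> T p \<Longrightarrow> w \<in> T p \<Longrightarrow> g p (\<lambda>c. r *\<^sub>R u c) w = r * g p u w"
  using g_comb[of p u u w r 0] by simp

lemma g_add: "p \<in> M \<Longrightarrow> u \<in> T p \<Longrightarrow> v \<in> T p \<Longrightarrow> w \<in> T p \<Longrightarrow>
   g p (\<lambda>c. u c + v c) w = g p u w + g p v w"
  using g_comb[of p u v w 1 1] by simp

lemma g_pos: "p \<in> M \<Longrightarrow> u \<in> T p \<Longrightarrow> u \<noteq> (\<lambda>c. 0) \<Longrightarrow> g p u u > 0"
  using inner_T unfolding inner_product_on_tangent_space_def by blast

lemma g_zero: "p \<in> M \<Longrightarrow> w \<in> T p \<Longrightarrow> g p (\<lambda>c. 0) w = 0"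
  using g_scale[of p w w 0] by simp

lemma g_sum: "p \<in> M \<Longrightarrow> (\<And>i. i \<in> I \<Longrightarrow> u i \<in> T p) \<Longrightarrow> w \<in> T p \<Longrightarrow>
   g p (\<lambda>c. \<Sum>i\<in>I. u i c) w = (\<Sum>i\<in>I. g p (u i) w)"
  by (induction I rule: infinite_finite_induct) (auto simp: g_zero g_add T_sum)

lemma curvature_self_adjoint:
  assumes "u \<in> T p" "v \<in> T p" "w \<in> T p" "p \<in> M"
  shows "g p (curvature A g p u v v) w = g p u (curvature A g p w v v)"
proof -
  obtain c where c: "c \<in> ch p" using cover assms by blast
  then interpret coord_metric "cimg c" "Gc c" using coord_metric by (simp add: ch_iff)
  show ?thesis
    using assms by (simp add: g_coord[OF c] curvature_T curvature_at[OF c] R_self_adjoint[OF cmap_in[OF c]])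
qed

lemma curvature_self:
  assumes "u \<in> T p" "v \<in> T p" "p \<in> M"
  shows "g p (curvature A g p u v v) v = 0"
proof -
  obtain c where c: "c \<in> ch p" using cover assms by blast
  then interpret coord_metric "cimg c" "Gc c" using coord_metric by (simp add: ch_iff)
  show ?thesis
    using assms by (simp add: g_coord[OF c] curvature_T curvature_at[OF c] R_self[OF cmap_in[OF c]])
qed

lemma curvature_linear:
  assumes "p \<in> M"
  shows "curvature A g p (\<lambda>c. u c + u' c) v w = (\<lambda>c. curvature A g p u v w c + curvature A g p u' v w c)"
    and "curvature A g p (\<lambda>c. r *\<^sub>R u c) v w = (\<lambda>c. r *\<^sub>R curvature A g p u v w c)"
proof -
  have "curvature A g p (\<lambda>c. u c + u' c) v w c = curvature A g p u v w c + curvature A g p u' v w c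
    \<and> curvature A g p (\<lambda>c. r *\<^sub>R u c) v w c = r *\<^sub>R curvature A g p u v w c" for c
  proof (cases "c \<in> ch p")
    case c: True
    then interpret coord_metric "cimg c" "Gc c" using coord_metric by (simp add: ch_iff)
    show ?thesis using linear_add[OF R_linear(1)[OF cmap_in[OF c]]] linear_scale[OF R_linear(1)[OF cmap_in[OF c]]]
      by (simp add: curvature_at[OF c])
  qed (simp add: curvature_def)
  then show "curvature A g p (\<lambda>c. u c + u' c) v w = (\<lambda>c. curvature A g p u v w c + curvature A g p u' v w c)"
    "curvature A g p (\<lambda>c. r *\<^sub>R u c) v w = (\<lambda>c. r *\<^sub>R curvature A g p u v w c)" by auto
qed

lemma curvature_sum:
  assumes "p \<in> M" "finite I"
  shows "curvature A g p (\<lambda>c. \<Sum>i\<in>I. u i c) v w = (\<lambda>c. \<Sum>i\<in>I. curvature A g p (u i) v w c)"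
  using assms(2)
proof induction
  case empty
  show ?case using curvature_linear(2)[OF assms(1), of 0 "\<lambda>c. 0"] by simp
next
  case (insert i I) then show ?case using curvature_linear(1)[OF assms(1)] by simp
qed

end

section \<open>Fields along curves\<close>

lemma has_vector_derivative_cong_eventually:
  assumes "(f has_vector_derivative f') (at t within I)" "\<forall>\<^sub>F s in at t within I. f s = h s" "f t = h t" "t \<in> I"
  shows "(h has_vector_derivative f') (at t within I)"
  using has_derivative_transform_eventually[of f "\<lambda>x. x *\<^sub>R f'" t I h] assms
  by (simp add: has_vector_derivative_def)

context coord_metric
begin

text \<open>Gram-Schmidt, indexed by subsets of \<open>Basis\<close> so that the resulting frame is
  labelled by the standard basis. A dimension count provides a vector outside the span reached so
  far.\<close>

lemma orthonormal_extend:
  fixes B :: "'e set"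
  assumes x: "x \<in> U" and "finite B" "B \<subseteq> Basis"
  shows "\<exists>f. \<forall>i\<in>B. \<forall>j\<in>B. G x (f i) (f j) = (if i = j then 1 else 0)"
  using assms(2,3)
proof (induction B)
  case empty then show ?case by simp
next
  case (insert b B)
  then obtain f where f: "\<And>i j. i \<in> B \<Longrightarrow> j \<in> B \<Longrightarrow> G x (f i) (f j) = (if i = j then 1 else 0)" by auto
  have "card B < DIM('e)"
    using insert(2,4) by (intro psubset_card_mono[OF finite_Basis]) auto
  then have "dim (f ` B) < DIM('e)"
    using dim_le_card'[of "f ` B"] card_image_le[of B f] insert(1) by simp
  then have "span (f ` B) \<noteq> UNIV" using dim_eq_full by (metis less_irrefl)
  then obtain v where v: "v \<notin> span (f ` B)" by blast
  define w where "w = v - (\<Sum>i\<in>B. G x v (f i) *\<^sub>R f i)"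
  have "w \<noteq> 0"
  proof
    assume "w = 0"
    then have "v = (\<Sum>i\<in>B. G x v (f i) *\<^sub>R f i)" by (simp add: w_def)
    moreover have "\<dots> \<in> span (f ` B)" by (intro span_sum span_scale span_base) auto
    ultimately show False using v by simp
  qed
  then have ww: "G x w w > 0" using G_pos[OF x] by blast
  have wf: "G x w (f j) = 0" if "j \<in> B" for j
  proof -
    have "G x (\<Sum>i\<in>B. G x v (f i) *\<^sub>R f i) (f j) = (\<Sum>i\<in>B. G x v (f i) * G x (f i) (f j))"
      by (simp add: linear_sum[OF G_linear[OF x]] G_scale[OF x])
    also have "\<dots> = (\<Sum>i\<in>B. if i = j then G x v (f j) else 0)"
      by (rule sum.cong) (auto simp: f that)
    also have "\<dots> = G x v (f j)" using insert(1) that by simp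
    finally show ?thesis by (simp add: w_def G_diff[OF x])
  qed
  define u where "u = (1 / sqrt (G x w w)) *\<^sub>R w"
  have uu: "G x u u = 1" using ww by (simp add: u_def G_scale[OF x] field_simps)
  have uf: "G x u (f j) = 0" "G x (f j) u = 0" if "j \<in> B" for j
    using wf[OF that] G_sym[OF x] by (auto simp: u_def G_scale[OF x])
  show ?case
    by (rule exI[of _ "f(b := u)"]) (use insert(2) uu uf f in auto)
qed

lemma orthonormal_exists:
  assumes "x \<in> U"
  obtains f :: "'e \<Rightarrow> 'e" where "\<And>i j. i \<in> Basis \<Longrightarrow> j \<in> Basis \<Longrightarrow> G x (f i) (f j) = (if i = j then 1 else 0)"
  using orthonormal_extend[OF assms finite_Basis order_refl] by metis

lemma orthonormal_expand:
  fixes f :: "'e \<Rightarrow> 'e"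
  assumes x: "x \<in> U" and f: "\<And>i j. i \<in> Basis \<Longrightarrow> j \<in> Basis \<Longrightarrow> G x (f i) (f j) = (if i = j then 1 else 0)"
  shows "v = (\<Sum>i\<in>Basis. G x v (f i) *\<^sub>R f i)"
proof -
  define L where "L = (\<lambda>w::'e. \<Sum>i\<in>Basis. (w \<bullet> i) *\<^sub>R f i)"
  have L: "linear L" unfolding L_def
    by (intro linearI) (auto simp: inner_add_left scaleR_add_left sum.distrib scaleR_sum_right)
  have GL: "G x (L w) (f j) = w \<bullet> j" if "j \<in> Basis" for w j
  proof -
    have "G x (L w) (f j) = (\<Sum>i\<in>Basis. (w \<bullet> i) * G x (f i) (f j))"
      by (simp add: L_def linear_sum[OF G_linear[OF x]] G_scale[OF x])
    also have "\<dots> = (\<Sum>i\<in>Basis. if i = j then w \<bullet> j else 0)"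
      by (rule sum.cong) (auto simp: f that)
    finally show ?thesis using that by simp
  qed
  have "inj L"
  proof (rule linear_injective_on_subspace_0[THEN iffD2, OF L subspace_UNIV, rule_format])
    fix w assume "L w = 0"
    then have "w \<bullet> j = 0" if "j \<in> Basis" for j using GL[OF that, of w] G_zero[OF x] by simp
    then show "w = 0" by (simp add: euclidean_eq_iff[of w 0])
  qed
  then obtain w where w: "v = L w" using linear_inj_imp_surj[OF L] by (metis surjD)
  have "L w = (\<Sum>i\<in>Basis. G x (L w) (f i) *\<^sub>R f i)"
    unfolding GL[symmetric] using GL by (simp add: L_def)
  then show ?thesis using w by simp
qed

end

context rmfd
begin

lemma ev_chart:
  assumes cont: "continuous (at t within I) \<gamma>" and M: "\<gamma> ` I \<subseteq> M" and c: "c \<in> ch (\<gamma> t)"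
  shows "\<forall>\<^sub>F s in at t within I. c \<in> ch (\<gamma> s)"
proof -
  obtain B where B: "open B" "cdom c = M \<inter> B"
    using cdom_open c unfolding ch_iff openin_open by blast
  have "\<forall>\<^sub>F s in at t within I. \<gamma> s \<in> B"
    using cont B c unfolding continuous_within by (intro topological_tendstoD) (auto simp: ch_iff)
  moreover have "\<forall>\<^sub>F s in at t within I. s \<in> I" by (simp add: eventually_at_filter)
  ultimately show ?thesis by eventually_elim (use B M c in \<open>auto simp: ch_iff\<close>)
qed

text \<open>If in one chart \<open>u\<close> is the coordinate velocity and \<open>k\<close> the
  covariant derivative of the field, their images under \<open>D c d\<close> are the same objects in
  every other chart at that point. An equation solved in a single chart therefore holds in all of
  them.\<close>

lemma covariant_transfer:
  assumes t: "t \<in> I" and cont: "continuous (at t within I) \<gamma>" and M: "\<gamma> ` I \<subseteq> M"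
    and c: "c \<in> ch (\<gamma> t)" and d: "d \<in> ch (\<gamma> t)"
    and dx: "((\<lambda>s. cmap c (\<gamma> s)) has_vector_derivative u) (at t within I)"
  shows covariant_transfer_velocity:
      "((\<lambda>s. cmap d (\<gamma> s)) has_vector_derivative D c d (\<gamma> t) u) (at t within I)"
    and covariant_transfer_field:
    "\<lbrakk>\<And>s. s \<in> I \<Longrightarrow> J s \<in> T (\<gamma> s);
      ((\<lambda>s. J s c) has_vector_derivative k - chris (Gc c) (cmap c (\<gamma> t)) u (J t c)) (at t within I)\<rbrakk> \<Longrightarrow>
      ((\<lambda>s. J s d) has_vector_derivative D c d (\<gamma> t) k
        - chris (Gc d) (cmap d (\<gamma> t)) (D c d (\<gamma> t) u) (J t d)) (at t within I)"
proof -
  have A: "c \<in> A" "d \<in> A" using c d by (auto simp: ch_iff)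
  interpret coord_isometry "cimg c" "Gc c" "cimg d" "Gc d" "overlap c d" "transition c d"
    by (rule coord_isometry[OF A])
  have ev: "\<forall>\<^sub>F s in at t within I. c \<in> ch (\<gamma> s) \<and> d \<in> ch (\<gamma> s) \<and> s \<in> I"
    using ev_chart[OF cont M c] ev_chart[OF cont M d] by (auto simp: eventually_conj_iff eventually_at_filter)
  note ov = overlap_in[OF c d]
  show "((\<lambda>s. cmap d (\<gamma> s)) has_vector_derivative D c d (\<gamma> t) u) (at t within I)"
  proof (rule has_vector_derivative_cong_eventually[where f="\<lambda>s. transition c d (cmap c (\<gamma> s))" and h="\<lambda>s. cmap d (\<gamma> s)", OF _ _ transition_eq[OF c] t])
    show "((\<lambda>s. transition c d (cmap c (\<gamma> s))) has_vector_derivative D c d (\<gamma> t) u) (at t within I)"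
      using covariant_law(1)[where x="\<lambda>s. cmap c (\<gamma> s)", OF ov t dx dx] unfolding D_def .
    show "\<forall>\<^sub>F s in at t within I. transition c d (cmap c (\<gamma> s)) = cmap d (\<gamma> s)"
      using ev by eventually_elim (use transition_eq in blast)
  qed
  assume J: "\<And>s. s \<in> I \<Longrightarrow> J s \<in> T (\<gamma> s)"
    and dJ: "((\<lambda>s. J s c) has_vector_derivative k - chris (Gc c) (cmap c (\<gamma> t)) u (J t c)) (at t within I)"
  have JD: "J s d = D c d (\<gamma> s) (J s c)" if "c \<in> ch (\<gamma> s)" "d \<in> ch (\<gamma> s)" "s \<in> I" for s
    using T_D J that by blast
  show "((\<lambda>s. J s d) has_vector_derivative D c d (\<gamma> t) k
        - chris (Gc d) (cmap d (\<gamma> t)) (D c d (\<gamma> t) u) (J t d)) (at t within I)"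
  proof (rule has_vector_derivative_cong_eventually[where f="\<lambda>s. D c d (\<gamma> s) (J s c)" and h="\<lambda>s. J s d", OF _ _ JD[OF c d t, symmetric] t])
    show "((\<lambda>s. D c d (\<gamma> s) (J s c)) has_vector_derivative D c d (\<gamma> t) k
        - chris (Gc d) (cmap d (\<gamma> t)) (D c d (\<gamma> t) u) (J t d)) (at t within I)"
      using covariant_law(2)[where x="\<lambda>s. cmap c (\<gamma> s)" and Y="\<lambda>s. J s c", OF ov t dx dJ]
      unfolding D_def[symmetric] JD[OF c d t, symmetric] transition_eq[OF c] by simp
    show "\<forall>\<^sub>F s in at t within I. D c d (\<gamma> s) (J s c) = J s d"
      using ev by eventually_elim (use JD in metis)
  qed
qed

end

section \<open>Covariant differentiation along a smooth curve\<close>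

locale mcurve = rmfd +
  fixes \<gamma> :: "real \<Rightarrow> 'a"
  assumes smooth: "smooth_curve M A \<gamma>"
begin

abbreviation vel where "vel \<equiv> velocity A \<gamma>"
abbreviation DD where "DD \<equiv> covariant_derivative A g \<gamma>"
abbreviation field where "field \<equiv> smooth_field_along A \<gamma>"
abbreviation dom where "dom c \<equiv> \<gamma> -` cdom c"

lemma \<gamma>_M: "\<gamma> t \<in> M" using smooth by (auto simp: smooth_curve_def)

lemma \<gamma>_cont: "continuous_on I \<gamma>"
  using smooth continuous_on_subset by (auto simp: smooth_curve_def)

lemma \<gamma>_cont_at: "continuous (at t within I) \<gamma>"
  using \<gamma>_cont[of UNIV] by (metis UNIV_I continuous_at_imp_continuous_within continuous_on_eq_continuous_at open_UNIV)

lemma dom_open: assumes "c \<in> A" shows "open (dom c)"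
proof -
  obtain B where B: "open B" "cdom c = M \<inter> B"
    using cdom_open assms unfolding openin_open by blast
  then have "dom c = \<gamma> -` B" using \<gamma>_M by auto
  then show ?thesis using open_vimage[OF B(1) \<gamma>_cont] by simp
qed

lemma Ck_x: "c \<in> A \<Longrightarrow> Ck_on k (dom c) (\<lambda>t. cmap c (\<gamma> t))"
  using smooth by (simp add: smooth_curve_def smooth_on_def o_def)

lemma vel_deriv: assumes "c \<in> ch (\<gamma> t)"
  shows "((\<lambda>s. cmap c (\<gamma> s)) has_vector_derivative vel t c) (at t)"
proof -
  have "(\<lambda>s. cmap c (\<gamma> s)) differentiable at t" using Ck_x[of c 1] assms by (auto simp: ch_iff)
  then have "((\<lambda>s. cmap c (\<gamma> s)) has_vector_derivative vector_derivative (\<lambda>s. cmap c (\<gamma> s)) (at t)) (at t)"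
    by (simp add: vector_derivative_works)
  then show ?thesis using assms by (simp add: velocity_def o_def)
qed

lemma vel_T: "vel t \<in> T (\<gamma> t)"
  unfolding T_iff
proof (intro conjI ballI allI impI)
  fix c d assume c: "c \<in> ch (\<gamma> t)" and d: "d \<in> ch (\<gamma> t)"
  have "((\<lambda>s. cmap d (\<gamma> s)) has_vector_derivative D c d (\<gamma> t) (vel t c)) (at t)"
    by (rule covariant_transfer_velocity[OF UNIV_I \<gamma>_cont_at _ c d vel_deriv[OF c]]) (use \<gamma>_M in auto)
  then show "vel t d = D c d (\<gamma> t) (vel t c)" using vel_deriv[OF d] vector_derivative_unique_at by blast
qed (simp add: velocity_def)

lemma Ck_vel: assumes c: "c \<in> A" shows "Ck_on k (dom c) (\<lambda>t. vel t c)"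
  by (rule Ck_on_eqI[OF dom_open[OF c] Ck_on_vector_derivative[OF dom_open[OF c] Ck_x[OF c]]])
    (use c in \<open>auto simp: velocity_def o_def ch_iff\<close>)

lemma vel_field: "field vel"
  using vel_T Ck_vel by (simp add: smooth_field_along_def smooth_on_def)

lemma field_T: "field J \<Longrightarrow> J t \<in> T (\<gamma> t)" by (simp add: smooth_field_along_def)

lemma field_Ck: "field J \<Longrightarrow> c \<in> A \<Longrightarrow> Ck_on k (dom c) (\<lambda>t. J t c)"
  by (simp add: smooth_field_along_def smooth_on_def)

lemma fieldI: "(\<And>t. J t \<in> T (\<gamma> t)) \<Longrightarrow> (\<And>c k. c \<in> A \<Longrightarrow> Ck_on k (dom c) (\<lambda>t. J t c)) \<Longrightarrow> field J"
  by (simp add: smooth_field_along_def smooth_on_def)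

lemma DD_at: "c \<in> ch (\<gamma> t) \<Longrightarrow> DD J t c = vector_derivative (\<lambda>s. J s c) (at t)
     + chris (Gc c) (cmap c (\<gamma> t)) (vel t c) (J t c)"
  by (simp add: covariant_derivative_def christoffel_eq)

lemma field_deriv:
  assumes J: "field J" and c: "c \<in> ch (\<gamma> t)"
  shows "((\<lambda>s. J s c) has_vector_derivative DD J t c - chris (Gc c) (cmap c (\<gamma> t)) (vel t c) (J t c)) (at t)"
proof -
  have "(\<lambda>s. J s c) differentiable at t" using field_Ck[OF J, of c 1] c by (auto simp: ch_iff)
  then show ?thesis by (simp add: DD_at[OF c] vector_derivative_works[symmetric])
qed

lemma DD_eqI:
  assumes "\<And>c. c \<in> ch (\<gamma> t) \<Longrightarrow>
      ((\<lambda>s. J s c) has_vector_derivative X c - chris (Gc c) (cmap c (\<gamma> t)) (vel t c) (J t c)) (at t)"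
    and "X \<in> T (\<gamma> t)"
  shows "DD J t = X"
proof
  fix c show "DD J t c = X c"
  proof (cases "c \<in> ch (\<gamma> t)")
    case True then show ?thesis using vector_derivative_at[OF assms(1)] by (simp add: DD_at)
  next
    case False then show ?thesis using T_out[OF assms(2)] by (simp add: covariant_derivative_def)
  qed
qed

lemma DD_T: assumes J: "field J" shows "DD J t \<in> T (\<gamma> t)"
  unfolding T_iff
proof (intro conjI ballI allI impI)
  fix c d assume c: "c \<in> ch (\<gamma> t)" and d: "d \<in> ch (\<gamma> t)"
  have "((\<lambda>s. J s d) has_vector_derivative D c d (\<gamma> t) (DD J t c)
        - chris (Gc d) (cmap d (\<gamma> t)) (D c d (\<gamma> t) (vel t c)) (J t d)) (at t)"
    by (rule covariant_transfer_field[OF UNIV_I \<gamma>_cont_at _ c d vel_deriv[OF c] field_T[OF J] field_deriv[OF J c]]) (use \<gamma>_M in auto)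
  moreover have "D c d (\<gamma> t) (vel t c) = vel t d" using T_D[OF vel_T c d] by simp
  ultimately have "D c d (\<gamma> t) (DD J t c) - chris (Gc d) (cmap d (\<gamma> t)) (vel t d) (J t d)
     = DD J t d - chris (Gc d) (cmap d (\<gamma> t)) (vel t d) (J t d)"
    using vector_derivative_unique_at[OF field_deriv[OF J d]] by simp
  then show "DD J t d = D c d (\<gamma> t) (DD J t c)" by simp
qed (simp add: covariant_derivative_def)

lemma Ck_chris_along:
  assumes c: "c \<in> A" and J: "Ck_on k (dom c) J"
  shows "Ck_on k (dom c) (\<lambda>t. chris (Gc c) (cmap c (\<gamma> t)) (vel t c) (J t))"
proof -
  interpret coord_metric "cimg c" "Gc c" by (rule coord_metric[OF c])
  have in_U: "cmap c (\<gamma> t) \<in> cimg c" if "t \<in> dom c" for t using that by auto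
  show ?thesis
  proof (rule Ck_on_family2[where F="\<lambda>t. chris (Gc c) (cmap c (\<gamma> t))", OF dom_open[OF c] _ _ _ Ck_vel[OF c] J])
    show "Ck_on k (dom c) (\<lambda>t. chris (Gc c) (cmap c (\<gamma> t)) v w)" for v w
      by (rule Ck_on_compose[OF dom_open[OF c] Ck_x[OF c] Ck_\<Gamma> open_U]) auto
  qed (use \<Gamma>_linear \<Gamma>_linear2 in_U in auto)
qed

lemma DD_field: assumes J: "field J" shows "field (DD J)"
proof (rule fieldI[OF DD_T[OF J]])
  fix c k assume c: "c \<in> A"
  show "Ck_on k (dom c) (\<lambda>t. DD J t c)"
    by (rule Ck_on_eqI[OF dom_open[OF c] Ck_on_add[OF Ck_on_vector_derivative[OF dom_open[OF c] field_Ck[OF J c]]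
          Ck_chris_along[OF c field_Ck[OF J c]] dom_open[OF c]]])
      (use c in \<open>auto simp: DD_at ch_iff\<close>)
qed

lemma Ck_g:
  assumes X: "field X" and Y: "field Y" shows "Ck_on k UNIV (\<lambda>t. g (\<gamma> t) (X t) (Y t))"
proof (rule Ck_on_local)
  fix t :: real
  obtain c where c: "c \<in> ch (\<gamma> t)" using cover[OF \<gamma>_M] by blast
  then have cA: "c \<in> A" by (simp add: ch_iff)
  interpret coord_metric "cimg c" "Gc c" by (rule coord_metric[OF cA])
  have in_U: "cmap c (\<gamma> t) \<in> cimg c" if "t \<in> dom c" for t using that by auto
  have "Ck_on k (dom c) (\<lambda>t. g (\<gamma> t) (X t) (Y t)) \<longleftrightarrow> Ck_on k (dom c) (\<lambda>t. Gc c (cmap c (\<gamma> t)) (X t c) (Y t c))"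
    by (rule Ck_on_cong[OF dom_open[OF cA]]) (use cA field_T X Y in \<open>auto simp: ch_iff intro!: g_coord\<close>)
  moreover have "Ck_on k (dom c) (\<lambda>t. Gc c (cmap c (\<gamma> t)) (X t c) (Y t c))"
  proof (rule Ck_on_family2[where F="\<lambda>t. Gc c (cmap c (\<gamma> t))", OF dom_open[OF cA] _ _ _ field_Ck[OF X cA] field_Ck[OF Y cA]])
    show "Ck_on k (dom c) (\<lambda>t. Gc c (cmap c (\<gamma> t)) v w)" for v w
      by (rule Ck_on_compose[OF dom_open[OF cA] Ck_x[OF cA] smooth_onD[OF smooth_G] open_U]) auto
  qed (use G_linear G_linear2 in_U in auto)
  ultimately show "\<exists>U. open U \<and> t \<in> U \<and> Ck_on k U (\<lambda>t. g (\<gamma> t) (X t) (Y t))"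
    using dom_open[OF cA] c by (intro exI[of _ "dom c"]) (auto simp: ch_iff)
qed

lemma curvature_field:
  assumes X: "field X" and Y: "field Y" and Z: "field Z"
  shows "field (\<lambda>t. curvature A g (\<gamma> t) (X t) (Y t) (Z t))"
proof (rule fieldI)
  show "curvature A g (\<gamma> t) (X t) (Y t) (Z t) \<in> T (\<gamma> t)" for t using curvature_T field_T X Y Z by blast
  fix c k assume c: "c \<in> A"
  interpret coord_metric "cimg c" "Gc c" by (rule coord_metric[OF c])
  have in_U: "cmap c (\<gamma> t) \<in> cimg c" if "t \<in> dom c" for t using that by auto
  have "Ck_on k (dom c) (\<lambda>t. curvature A g (\<gamma> t) (X t) (Y t) (Z t) c) \<longleftrightarrow>
     Ck_on k (dom c) (\<lambda>t. R (cmap c (\<gamma> t)) (X t c) (Y t c) (Z t c))"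
    by (rule Ck_on_cong[OF dom_open[OF c]]) (use c in \<open>auto simp: curvature_at ch_iff\<close>)
  moreover have "Ck_on k (dom c) (\<lambda>t. R (cmap c (\<gamma> t)) (X t c) (Y t c) (Z t c))"
  proof (rule Ck_on_family[where F="\<lambda>t. R (cmap c (\<gamma> t)) (X t c) (Y t c)", OF dom_open[OF c] _ _ field_Ck[OF Z c]])
    show "Ck_on k (dom c) (\<lambda>t. R (cmap c (\<gamma> t)) (X t c) (Y t c) w)" for w
    proof (rule Ck_on_family2[where F="\<lambda>t u v. R (cmap c (\<gamma> t)) u v w", OF dom_open[OF c] _ _ _ field_Ck[OF X c] field_Ck[OF Y c]])
      show "Ck_on k (dom c) (\<lambda>t. R (cmap c (\<gamma> t)) u v w)" for u v
        by (rule Ck_on_compose[OF dom_open[OF c] Ck_x[OF c] Ck_R open_U]) auto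
    qed (use R_linear in_U in auto)
  qed (use R_linear in_U in auto)
  ultimately show "Ck_on k (dom c) (\<lambda>t. curvature A g (\<gamma> t) (X t) (Y t) (Z t) c)" by simp
qed

text \<open>In a chart the derivative of the metric coefficients cancels the Christoffel terms of
  the two fields, by \<open>compat\<close>.\<close>

lemma g_deriv:
  assumes X: "field X" and Y: "field Y"
  shows "((\<lambda>t. g (\<gamma> t) (X t) (Y t)) has_vector_derivative
     g (\<gamma> t) (DD X t) (Y t) + g (\<gamma> t) (X t) (DD Y t)) (at t)"
proof -
  obtain c where c: "c \<in> ch (\<gamma> t)" using cover[OF \<gamma>_M] by blast
  then have cA: "c \<in> A" and xU: "cmap c (\<gamma> t) \<in> cimg c" by (auto simp: ch_iff)
  interpret coord_metric "cimg c" "Gc c" by (rule coord_metric[OF cA])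
  let ?x = "cmap c (\<gamma> t)" and ?u = "vel t c"
  let ?X = "DD X t c - chris (Gc c) ?x ?u (X t c)" and ?Y = "DD Y t c - chris (Gc c) ?x ?u (Y t c)"
  have "((\<lambda>s. Gc c (cmap c (\<gamma> s)) (X s c) (Y s c)) has_derivative
     (\<lambda>h. dd (\<lambda>y. Gc c y (X t c) (Y t c)) ?x (h *\<^sub>R ?u) + Gc c ?x (h *\<^sub>R ?X) (Y t c) + Gc c ?x (X t c) (h *\<^sub>R ?Y))) (at t)"
    by (rule has_derivative_family2[where F="Gc c" and f="\<lambda>s. cmap c (\<gamma> s)" and t=t and u="\<lambda>s. X s c" and w="\<lambda>s. Y s c", OF open_U xU])
      (use G_linear G_linear2 G_diffable[OF xU] vel_deriv[OF c] field_deriv[OF X c] field_deriv[OF Y c] in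
        \<open>auto simp: has_vector_derivative_def\<close>)
  then have "((\<lambda>s. Gc c (cmap c (\<gamma> s)) (X s c) (Y s c)) has_vector_derivative
     dG ?x ?u (X t c) (Y t c) + Gc c ?x ?X (Y t c) + Gc c ?x (X t c) ?Y) (at t)"
    unfolding dG_def by (simp add: has_vector_derivative_def G_scale[OF xU] linear_scale[OF linear_dd[OF G_diffable[OF xU]]] distrib_left)
  then have "((\<lambda>s. Gc c (cmap c (\<gamma> s)) (X s c) (Y s c)) has_vector_derivative
     g (\<gamma> t) (DD X t) (Y t) + g (\<gamma> t) (X t) (DD Y t)) (at t)"
    by (simp add: compat[OF xU] G_diff[OF xU] g_coord[OF c] field_T[OF X] field_T[OF Y] DD_T[OF X] DD_T[OF Y])
  moreover have "\<forall>\<^sub>F s in at t. Gc c (cmap c (\<gamma> s)) (X s c) (Y s c) = g (\<gamma> s) (X s) (Y s)"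
  proof -
    have "\<forall>\<^sub>F s in at t. c \<in> ch (\<gamma> s)" by (rule ev_chart[OF \<gamma>_cont_at _ c]) (use \<gamma>_M in auto)
    then show ?thesis by eventually_elim (use g_coord field_T X Y in metis)
  qed
  ultimately show ?thesis
    by (rule has_vector_derivative_cong_eventually) (use g_coord[OF c] field_T X Y in auto)
qed

text \<open>Within a chart the equation is linear, hence solvable on any closed interval mapped into
  the chart, whatever the initial vector. \<open>Sol\<close> demands the equation in all charts
  around each point, so that pieces computed in different charts can be glued.\<close>

lemma parallel_exists:
  assumes v: "v \<in> T (\<gamma> t0)"
  shows "\<exists>J. field J \<and> (\<forall>t. DD J t = (\<lambda>c. 0)) \<and> J t0 = v"
proof -
  let ?B = "\<lambda>c t v. - chris (Gc c) (cmap c (\<gamma> t)) (vel t c) v"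
  have lin: "linear (?B c t)" if "c \<in> ch (\<gamma> t)" for c t
  proof -
    interpret coord_metric "cimg c" "Gc c" using coord_metric that by (simp add: ch_iff)
    show ?thesis using \<Gamma>_linear2[OF cmap_in[OF that]] by (intro linear_compose_neg)
  qed
  have Ck: "Ck_on k (dom c) (\<lambda>t. ?B c t v)" if "c \<in> A" for c k v
    by (intro Ck_on_uminus dom_open Ck_chris_along that Ck_on_const)
  define Sol where "Sol = (\<lambda>a b J. \<forall>t\<in>{a..b}. J t \<in> T (\<gamma> t) \<and> (\<forall>c\<in>ch (\<gamma> t).
     ((\<lambda>s. J s c) has_vector_derivative ?B c t (J t c)) (at t within {a..b})))"
  have "\<exists>J. J t0 = v \<and> (\<forall>n::nat. Sol (t0 - n) (t0 + n) J)"
  proof (rule global_from_local[where V="\<lambda>t. T (\<gamma> t)"])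
    fix a b :: real and J J' assume S: "Sol a b J" and e: "\<And>t. a \<le> t \<Longrightarrow> t \<le> b \<Longrightarrow> J t = J' t"
    show "Sol a b J'" unfolding Sol_def
    proof (intro ballI conjI)
      fix t assume t: "t \<in> {a..b}"
      then have Jt: "J t = J' t" using e by simp
      show "J' t \<in> T (\<gamma> t)" using S t Jt unfolding Sol_def by metis
      fix c assume "c \<in> ch (\<gamma> t)"
      then have "((\<lambda>s. J s c) has_vector_derivative ?B c t (J' t c)) (at t within {a..b})"
        using S t Jt unfolding Sol_def by metis
      then show "((\<lambda>s. J' s c) has_vector_derivative ?B c t (J' t c)) (at t within {a..b})"
        by (rule has_vector_derivative_transform[OF t, rotated]) (use e in auto)
    qed
  next
    fix a b c :: real and J assume S: "Sol a b J" "Sol b c J" "a \<le> b" "b \<le> c"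
    show "Sol a c J" unfolding Sol_def
    proof (intro ballI conjI)
      fix t assume t: "t \<in> {a..c}"
      then show "J t \<in> T (\<gamma> t)" using S unfolding Sol_def by (cases "t \<le> b") auto
      fix d assume "d \<in> ch (\<gamma> t)"
      then show "((\<lambda>s. J s d) has_vector_derivative ?B d t (J t d)) (at t within {a..c})"
        using S unfolding Sol_def by (intro has_vector_derivative_glue[OF S(3,4) t]) blast+
    qed
  next
    fix a b t :: real and J assume "Sol a b J" "a \<le> t" "t \<le> b"
    then show "J t \<in> T (\<gamma> t)" by (auto simp: Sol_def)
  next
    fix t :: real
    obtain c where c: "c \<in> ch (\<gamma> t)" using cover[OF \<gamma>_M] by blast
    then have cA: "c \<in> A" by (simp add: ch_iff)
    obtain \<delta> where \<delta>: "\<delta> > 0" "ball t \<delta> \<subseteq> dom c"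
      using dom_open[OF cA] c openE[of "dom c" t] by (auto simp: ch_iff)
    show "\<exists>d>0. \<forall>a b. a \<le> t \<and> t \<le> b \<and> b - a < d \<longrightarrow>
      (\<forall>x\<in>T (\<gamma> a). \<exists>s. Sol a b s \<and> s a = x) \<and> (\<forall>x\<in>T (\<gamma> b). \<exists>s. Sol a b s \<and> s b = x)"
    proof (intro exI[of _ \<delta>] conjI allI impI)
      fix a b assume ab: "a \<le> t \<and> t \<le> b \<and> b - a < \<delta>"
      have "s \<in> ball t \<delta>" if "s \<in> {a..b}" for s using ab that by (auto simp: dist_real_def)
      then have sub: "{a..b} \<subseteq> dom c" using \<delta>(2) by blast
      then have chs: "c \<in> ch (\<gamma> s)" if "s \<in> {a..b}" for s using that cA by (auto simp: ch_iff)
      have *: "\<exists>J. Sol a b J \<and> J r = x" if r: "r \<in> {a..b}" and x: "x \<in> T (\<gamma> r)" for r x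
      proof -
        obtain y where y: "y r = x c" "\<And>s. s \<in> {a..b} \<Longrightarrow> (y has_vector_derivative ?B c s (y s)) (at s within {a..b})"
          using linear_ode_interval[of a b "?B c" r "x c"] lin[OF chs] r
            continuous_on_subset[OF Ck_on_imp_continuous_on[OF Ck[OF cA]] sub] by blast
        define J where "J = (\<lambda>s. tvec_of A c (\<gamma> s) (y s))"
        have JT: "J s \<in> T (\<gamma> s)" if "s \<in> {a..b}" for s unfolding J_def by (rule tvec_of_T[OF chs[OF that]])
        have Jc: "J s c = y s" if "s \<in> {a..b}" for s unfolding J_def by (rule tvec_of_self[OF chs[OF that]])
        have "Sol a b J" unfolding Sol_def
        proof (intro ballI conjI)
          fix s d assume s: "s \<in> {a..b}"
          show "J s \<in> T (\<gamma> s)" by (rule JT[OF s])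
          assume d: "d \<in> ch (\<gamma> s)"
          have "((\<lambda>s. J s c) has_vector_derivative ?B c s (y s)) (at s within {a..b})"
            by (rule has_vector_derivative_transform[OF s Jc y(2)[OF s]])
          then have 1: "((\<lambda>s. J s c) has_vector_derivative 0 - chris (Gc c) (cmap c (\<gamma> s)) (vel s c) (J s c)) (at s within {a..b})"
            using Jc[OF s] by simp
          have "((\<lambda>s. J s d) has_vector_derivative D c d (\<gamma> s) 0
             - chris (Gc d) (cmap d (\<gamma> s)) (D c d (\<gamma> s) (vel s c)) (J s d)) (at s within {a..b})"
            by (rule covariant_transfer_field[OF s \<gamma>_cont_at _ chs[OF s] d has_vector_derivative_at_within[OF vel_deriv[OF chs[OF s]]] JT 1])
              (use \<gamma>_M in auto)
          then show "((\<lambda>s. J s d) has_vector_derivative ?B d s (J s d)) (at s within {a..b})"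
            using T_D[OF vel_T chs[OF s] d] linear_0[OF D_linear[OF chs[OF s] d]] by simp
        qed
        moreover have "J r = x" unfolding J_def y(1) by (rule tvec_of_eq[OF chs[OF r] x])
        ultimately show ?thesis by blast
      qed
      show "\<forall>x\<in>T (\<gamma> a). \<exists>s. Sol a b s \<and> s a = x" "\<forall>x\<in>T (\<gamma> b). \<exists>s. Sol a b s \<and> s b = x"
        using * ab by auto
    qed (rule \<delta>)
  qed (rule v)
  then obtain J where J: "J t0 = v" "\<And>n::nat. Sol (t0 - n) (t0 + n) J" by blast
  have JT: "J t \<in> T (\<gamma> t)" and dJ: "c \<in> ch (\<gamma> t) \<Longrightarrow> ((\<lambda>s. J s c) has_vector_derivative ?B c t (J t c)) (at t)" for t c
  proof -
    obtain n :: nat where "\<bar>t - t0\<bar> < n" using reals_Archimedean2 by blast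
    then have "t \<in> {t0 - n..t0 + n}" by (simp add: abs_less_iff)
    then show "J t \<in> T (\<gamma> t)" using J(2)[of n] unfolding Sol_def by blast
    assume "c \<in> ch (\<gamma> t)"
    then show "((\<lambda>s. J s c) has_vector_derivative ?B c t (J t c)) (at t)"
      using J(2) unfolding Sol_def by (intro has_vector_derivative_exhaustion[of t t0]) blast
  qed
  have "field J"
  proof (rule fieldI[OF JT])
    fix c k assume c: "c \<in> A"
    show "Ck_on k (dom c) (\<lambda>t. J t c)"
      by (rule smooth_linear_ode[where B="?B c", OF dom_open[OF c] lin Ck[OF c] dJ]) (use c in \<open>auto simp: ch_iff\<close>)
  qed
  moreover have "DD J t = (\<lambda>c. 0)" for t
    by (rule DD_eqI) (use dJ T_0 in auto)
  ultimately show ?thesis using J(1) by blast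
qed

end

section \<open>Parallel frames along geodesics\<close>

locale geodesic_curve = mcurve +
  assumes geo: "DD vel t = (\<lambda>c. 0)" and unit: "g (\<gamma> t) (vel t) (vel t) = 1"
begin

lemma g_zero_right: "w \<in> T (\<gamma> t) \<Longrightarrow> g (\<gamma> t) w (\<lambda>c. 0) = 0"
  using g_sym[OF \<gamma>_M _ T_0] g_zero[OF \<gamma>_M] by metis

text \<open>Inner products of parallel fields are constant, so orthonormality at time 0 persists.
  The frame spans the whole tangent space, including the direction of the velocity; tangential parts
  are handled by \<open>jacobi_orthogonal\<close>.\<close>

lemma parallel_frame:
  "\<exists>e :: 'b \<Rightarrow> real \<Rightarrow> ('a, 'b) tvec. (\<forall>i\<in>Basis. field (e i) \<and> (\<forall>t. DD (e i) t = (\<lambda>c. 0))) \<and>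
     (\<forall>i\<in>Basis. \<forall>j\<in>Basis. \<forall>t. g (\<gamma> t) (e i t) (e j t) = (if i = j then 1 else 0))"
proof -
  obtain c where c: "c \<in> ch (\<gamma> 0)" using cover[OF \<gamma>_M] by blast
  then interpret coord_metric "cimg c" "Gc c" using coord_metric by (simp add: ch_iff)
  obtain f :: "'b \<Rightarrow> 'b" where f: "\<And>i j. i \<in> Basis \<Longrightarrow> j \<in> Basis \<Longrightarrow> Gc c (cmap c (\<gamma> 0)) (f i) (f j) = (if i = j then 1 else 0)"
    using orthonormal_exists[OF cmap_in[OF c]] by blast
  have "\<forall>i. \<exists>J. field J \<and> (\<forall>t. DD J t = (\<lambda>c. 0)) \<and> J 0 = tvec_of A c (\<gamma> 0) (f i)"
    using parallel_exists[OF tvec_of_T[OF c]] by blast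
  then obtain e where e: "\<And>i. field (e i)" "\<And>i t. DD (e i) t = (\<lambda>c. 0)" "\<And>i. e i 0 = tvec_of A c (\<gamma> 0) (f i)"
    by metis
  have "g (\<gamma> t) (e i t) (e j t) = (if i = j then 1 else 0)" if "i \<in> Basis" "j \<in> Basis" for i j t
  proof -
    have "((\<lambda>t. g (\<gamma> t) (e i t) (e j t)) has_vector_derivative 0) (at t)" for t
      using g_deriv[OF e(1) e(1), of i j t] g_zero[OF \<gamma>_M field_T[OF e(1)]] g_zero_right[OF field_T[OF e(1)]]
      by (simp add: e(2))
    then obtain k where "\<And>t. g (\<gamma> t) (e i t) (e j t) = k"
      using has_vector_derivative_zero_constant[of UNIV "\<lambda>t. g (\<gamma> t) (e i t) (e j t)"] by auto
    moreover have "g (\<gamma> 0) (e i 0) (e j 0) = (if i = j then 1 else 0)"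
      using g_coord[OF c field_T[OF e(1)] field_T[OF e(1)], of i j] f[OF that] by (simp only: e(3) tvec_of_self[OF c])
    ultimately show ?thesis by metis
  qed
  with e show ?thesis by blast
qed

end

locale framed_geodesic = geodesic_curve M A g \<gamma>
  for M :: "'a::{t2_space, second_countable_topology} set" and A :: "('a, 'e::euclidean_space) chart set" and g \<gamma> +
  fixes e :: "'e \<Rightarrow> real \<Rightarrow> ('a, 'e) tvec"
  assumes e_field: "i \<in> Basis \<Longrightarrow> field (e i)"
    and e_parallel: "i \<in> Basis \<Longrightarrow> DD (e i) t = (\<lambda>c. 0)"
    and e_orth: "i \<in> Basis \<Longrightarrow> j \<in> Basis \<Longrightarrow> g (\<gamma> t) (e i t) (e j t) = (if i = j then 1 else 0)"
begin

text \<open>\<open>E t\<close> and \<open>co t\<close> turn out to be mutually inverse isometries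
  between the coordinate space and the tangent space at \<open>\<gamma> t\<close>, and
  \<open>K t\<close> is the operator \<open>Rv t\<close> read through them.\<close>

definition E :: "real \<Rightarrow> 'e \<Rightarrow> ('a, 'e) tvec" where "E t x = (\<lambda>c. \<Sum>i\<in>Basis. (x \<bullet> i) *\<^sub>R e i t c)"
definition co :: "real \<Rightarrow> ('a, 'e) tvec \<Rightarrow> 'e" where "co t X = (\<Sum>i\<in>Basis. g (\<gamma> t) X (e i t) *\<^sub>R i)"
abbreviation Rv where "Rv t X \<equiv> curvature A g (\<gamma> t) X (vel t) (vel t)"
definition kk where "kk t i j = g (\<gamma> t) (Rv t (e i t)) (e j t)"
definition K :: "real \<Rightarrow> 'e \<Rightarrow> 'e" where "K t x = (\<Sum>j\<in>Basis. (\<Sum>i\<in>Basis. (x \<bullet> i) * kk t i j) *\<^sub>R j)"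

lemma e_T: "i \<in> Basis \<Longrightarrow> e i t \<in> T (\<gamma> t)" using field_T e_field by blast

lemma E_T: "E t x \<in> T (\<gamma> t)" unfolding E_def by (intro T_sum T_scale e_T)

lemma Rv_T: "X \<in> T (\<gamma> t) \<Longrightarrow> Rv t X \<in> T (\<gamma> t)" using curvature_T vel_T by blast

lemma g_E: "w \<in> T (\<gamma> t) \<Longrightarrow> g (\<gamma> t) (E t x) w = (\<Sum>i\<in>Basis. (x \<bullet> i) * g (\<gamma> t) (e i t) w)"
  unfolding E_def by (subst g_sum[OF \<gamma>_M]) (auto simp: T_scale e_T g_scale[OF \<gamma>_M])

lemma co_inner: "i \<in> Basis \<Longrightarrow> co t X \<bullet> i = g (\<gamma> t) X (e i t)"
  by (simp add: co_def inner_sum_left inner_Basis if_distrib sum.delta' cong: if_cong)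

lemma co_E: "co t (E t x) = x"
proof (rule euclidean_eqI)
  fix j :: 'e assume j: "j \<in> Basis"
  have "(\<Sum>i\<in>Basis. (x \<bullet> i) * g (\<gamma> t) (e i t) (e j t)) = (\<Sum>i\<in>Basis. if i = j then x \<bullet> j else 0)"
    by (rule sum.cong) (auto simp: e_orth j)
  then show "co t (E t x) \<bullet> j = x \<bullet> j" using j by (simp add: co_inner g_E e_T)
qed

lemma E_co: assumes X: "X \<in> T (\<gamma> t)" shows "E t (co t X) = X"
proof -
  obtain c where c: "c \<in> ch (\<gamma> t)" using cover[OF \<gamma>_M] by blast
  then interpret coord_metric "cimg c" "Gc c" using coord_metric by (simp add: ch_iff)
  have "X c = (\<Sum>i\<in>Basis. Gc c (cmap c (\<gamma> t)) (X c) (e i t c) *\<^sub>R e i t c)"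
    by (rule orthonormal_expand[where f="\<lambda>i. e i t c", OF cmap_in[OF c]])
      (use e_orth g_coord[OF c e_T e_T] in metis)
  also have "\<dots> = (\<Sum>i\<in>Basis. (co t X \<bullet> i) *\<^sub>R e i t c)"
    by (rule sum.cong) (auto simp: co_inner g_coord[OF c X e_T])
  finally show ?thesis using T_eqI[OF E_T X c] by (simp add: E_def)
qed

lemma g_E_E: "g (\<gamma> t) (E t x) (E t y) = x \<bullet> y"
proof -
  have "g (\<gamma> t) (E t x) (E t y) = (\<Sum>i\<in>Basis. (x \<bullet> i) * g (\<gamma> t) (E t y) (e i t))"
    by (simp add: g_E E_T g_sym[OF \<gamma>_M e_T E_T])
  also have "\<dots> = (\<Sum>i\<in>Basis. (x \<bullet> i) * (y \<bullet> i))"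
    by (rule sum.cong) (use co_inner[of _ t "E t y"] in \<open>auto simp: co_E\<close>)
  finally show ?thesis by (simp add: euclidean_inner[of x y])
qed

lemma E_eq_0: "E t x = (\<lambda>c. 0) \<longleftrightarrow> x = 0"
proof -
  have "E t 0 = (\<lambda>c. 0)" by (simp add: E_def)
  then show ?thesis using co_E[of t x] co_E[of t 0] by metis
qed

lemma co_eq_0: "X \<in> T (\<gamma> t) \<Longrightarrow> co t X = 0 \<longleftrightarrow> X = (\<lambda>c. 0)"
  using E_co E_eq_0 by metis

lemma co_Rv_E: "co t (Rv t (E t x)) = K t x"
proof -
  have 1: "Rv t (E t x) = (\<lambda>c. \<Sum>i\<in>Basis. (x \<bullet> i) *\<^sub>R Rv t (e i t) c)"
    unfolding E_def curvature_sum[OF \<gamma>_M finite_Basis] curvature_linear(2)[OF \<gamma>_M] ..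
  have "g (\<gamma> t) (Rv t (E t x)) (e j t) = (\<Sum>i\<in>Basis. (x \<bullet> i) * kk t i j)" if "j \<in> Basis" for j
    unfolding 1 kk_def
    by (subst g_sum[OF \<gamma>_M]) (auto simp: T_scale Rv_T e_T that g_scale[OF \<gamma>_M])
  then show ?thesis by (simp add: co_def K_def)
qed

lemma E_K: "E t (K t x) = Rv t (E t x)"
  using E_co[OF Rv_T[OF E_T]] co_Rv_E by metis

lemma K_inner: "K t x \<bullet> y = g (\<gamma> t) (Rv t (E t x)) (E t y)"
  using g_E_E[of t "K t x" y] E_K by simp

lemma co_Rv: "X \<in> T (\<gamma> t) \<Longrightarrow> co t (Rv t X) = K t (co t X)"
  using co_Rv_E[of t "co t X"] E_co by simp

lemma Ck_K: "Ck_on k UNIV (\<lambda>t. K t v)"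
  unfolding K_def kk_def
  by (intro Ck_on_sum Ck_on_scaleR Ck_on_mult Ck_g curvature_field vel_field e_field open_UNIV Ck_on_const)

lemma second_order_K: "second_order K"
proof (rule second_order.intro)
  fix t u v
  show "linear (K t)" unfolding K_def
    by (intro linearI) (auto simp: inner_add_left distrib_right scaleR_add_left sum.distrib
      scaleR_sum_right sum_distrib_left mult.assoc)
  show "K t u \<bullet> v = u \<bullet> K t v"
    using curvature_self_adjoint[OF E_T vel_T E_T \<gamma>_M, of t u v] g_sym[OF \<gamma>_M E_T Rv_T[OF E_T], of t u v]
    by (simp add: K_inner inner_commute[of u])
  show "continuous_on UNIV (\<lambda>t. K t v)" by (rule Ck_on_imp_continuous_on[OF Ck_K[of 0]])
qed

section \<open>Jacobi fields as solutions of a second order system\<close>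

lemma co_deriv: assumes J: "field J"
  shows "((\<lambda>t. co t (J t)) has_vector_derivative co t (DD J t)) (at t)"
  unfolding co_def
proof (intro has_vector_derivative_sum)
  fix i :: 'e assume i: "i \<in> Basis"
  have "((\<lambda>t. g (\<gamma> t) (J t) (e i t)) has_vector_derivative g (\<gamma> t) (DD J t) (e i t)) (at t)"
    using g_deriv[OF J e_field[OF i], of t] g_zero_right[OF field_T[OF J]] by (simp add: e_parallel[OF i])
  then show "((\<lambda>t. g (\<gamma> t) (J t) (e i t) *\<^sub>R i) has_vector_derivative g (\<gamma> t) (DD J t) (e i t) *\<^sub>R i) (at t)"
    by (rule bounded_linear.has_vector_derivative[OF bounded_linear_scaleR_left])
qed

lemma jacobi_DD2:
  assumes "beta_jacobi_field A g \<beta> \<gamma> J"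
  shows "DD (DD J) t = (\<lambda>c. (- \<beta>) *\<^sub>R Rv t (J t) c)"
  using assms unfolding beta_jacobi_field_def by (auto simp: fun_eq_iff eq_neg_iff_add_eq_0)

lemma jacobi_to_sol:
  assumes J: "beta_jacobi_field A g \<beta> \<gamma> J"
  shows "jsol K \<beta> (\<lambda>t. co t (J t)) (\<lambda>t. co t (DD J t))"
proof -
  have f: "field J" using J by (simp add: beta_jacobi_field_def)
  have "co t (DD (DD J) t) = - (\<beta> *\<^sub>R K t (co t (J t)))" for t
  proof -
    have "co t (DD (DD J) t) = (- \<beta>) *\<^sub>R co t (Rv t (J t))"
      unfolding co_def jacobi_DD2[OF J] scaleR_sum_right
      by (rule sum.cong[OF refl]) (simp only: g_scale[OF \<gamma>_M Rv_T[OF field_T[OF f]] e_T] scaleR_scaleR)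
    then show ?thesis by (simp add: co_Rv[OF field_T[OF f]])
  qed
  then show ?thesis
    using co_deriv[OF f] co_deriv[OF DD_field[OF f]]
    by (simp add: second_order.sol_def[OF second_order_scale[OF second_order_K]])
qed

lemma Ck_E:
  assumes y: "Ck_on k UNIV y" and c: "c \<in> A" shows "Ck_on k (dom c) (\<lambda>t. E t (y t) c)"
  unfolding E_def
  by (intro Ck_on_sum Ck_on_scaleR Ck_on_inner dom_open[OF c] Ck_on_subset[OF y] field_Ck[OF e_field c] Ck_on_const) auto

lemma DD_E:
  assumes y: "(y has_vector_derivative y' t) (at t)" shows "DD (\<lambda>t. E t (y t)) t = E t (y' t)"
proof (rule DD_eqI[OF _ E_T])
  fix c assume c: "c \<in> ch (\<gamma> t)"
  then interpret coord_metric "cimg c" "Gc c" using coord_metric by (simp add: ch_iff)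
  let ?\<Gamma> = "\<lambda>v. \<Gamma> (cmap c (\<gamma> t)) (vel t c) v"
  have lin: "linear ?\<Gamma>" by (rule \<Gamma>_linear2[OF cmap_in[OF c]])
  have 1: "((\<lambda>s. y s \<bullet> i) has_vector_derivative y' t \<bullet> i) (at t)" for i
    by (rule bounded_linear.has_vector_derivative[OF bounded_linear_inner_left y])
  have 2: "((\<lambda>s. e i s c) has_vector_derivative - ?\<Gamma> (e i t c)) (at t)" if "i \<in> Basis" for i
    using field_deriv[OF e_field[OF that] c] e_parallel[OF that, of t] by simp
  have "((\<lambda>s. \<Sum>i\<in>Basis. (y s \<bullet> i) *\<^sub>R e i s c) has_vector_derivative
     (\<Sum>i\<in>Basis. (y t \<bullet> i) *\<^sub>R (- ?\<Gamma> (e i t c)) + (y' t \<bullet> i) *\<^sub>R e i t c)) (at t)"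
    by (intro has_vector_derivative_sum bounded_bilinear.has_vector_derivative[OF bounded_bilinear_scaleR] 1 2)
  then show "((\<lambda>s. E s (y s) c) has_vector_derivative E t (y' t) c - ?\<Gamma> (E t (y t) c)) (at t)"
    by (simp add: E_def linear_sum[OF lin] linear_scale[OF lin] sum.distrib sum_negf sum_subtractf)
qed

text \<open>A solution is a priori only differentiable, whereas a Jacobi field is smooth by
  definition; the regularity of \<open>y\<close> and \<open>y'\<close> is raised simultaneously,
  each feeding the other through the system.\<close>

lemma sol_to_jacobi:
  assumes y: "jsol K \<beta> y y'" shows "beta_jacobi_field A g \<beta> \<gamma> (\<lambda>t. E t (y t))"
proof -
  interpret S: second_order "\<lambda>t v. \<beta> *\<^sub>R K t v" by (rule second_order_scale[OF second_order_K])
  note dy = S.solD[OF y]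
  have Ck: "Ck_on k UNIV y \<and> Ck_on k UNIV y'" for k
  proof (induction k)
    case 0 then show ?case using S.sol_continuous[OF y] by simp
  next
    case (Suc k)
    have 1: "Ck_on (Suc k) UNIV y" by (rule Ck_on_Suc_real[OF open_UNIV dy(1)]) (use Suc in auto)
    have "Ck_on k UNIV (\<lambda>t. - (\<beta> *\<^sub>R K t (y t)))"
      by (intro Ck_on_uminus Ck_on_scaleR open_UNIV Ck_on_const
        Ck_on_family[OF open_UNIV second_order.P_linear[OF second_order_K] Ck_K]) (use Suc in auto)
    then have "Ck_on (Suc k) UNIV y'" by (rule Ck_on_Suc_real[OF open_UNIV dy(2)])
    with 1 show ?case by blast
  qed
  have f: "field (\<lambda>t. E t (y t))" by (rule fieldI[OF E_T]) (use Ck_E Ck in blast)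
  have D1: "DD (\<lambda>t. E t (y t)) = (\<lambda>t. E t (y' t))" by (rule ext, rule DD_E[where y=y and y'=y', OF dy(1)])
  have D2: "DD (\<lambda>t. E t (y' t)) t = E t (- (\<beta> *\<^sub>R K t (y t)))" for t by (rule DD_E[where y=y' and y'="\<lambda>t. - (\<beta> *\<^sub>R K t (y t))", OF dy(2)])
  have "E t (- (\<beta> *\<^sub>R K t (y t))) c = - (\<beta> *\<^sub>R Rv t (E t (y t)) c)" for t c
    unfolding E_K[symmetric] by (simp add: E_def sum_negf scaleR_sum_right)
  then show ?thesis unfolding beta_jacobi_field_def D1 D2 using f by simp
qed

text \<open>The tangential component has second derivative \<open>- \<beta>\<close> times the inner
  product of \<open>Rv t (J t)\<close> with the velocity, which is 0. It is thus an affine function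
  of time, and with two zeros it vanishes.\<close>

lemma jacobi_orthogonal:
  assumes J: "beta_jacobi_field A g \<beta> \<gamma> J" and z: "J a = (\<lambda>c. 0)" "J b = (\<lambda>c. 0)" "a \<noteq> b"
  shows "g (\<gamma> t) (J t) (vel t) = 0"
proof -
  have f: "field J" using J by (simp add: beta_jacobi_field_def)
  define h h' where "h = (\<lambda>t. g (\<gamma> t) (J t) (vel t))" and "h' = (\<lambda>t. g (\<gamma> t) (DD J t) (vel t))"
  have dh: "(h has_vector_derivative h' t) (at t)" for t unfolding h_def h'_def
    using g_deriv[OF f vel_field, of t] g_zero_right[OF field_T[OF f]] by (simp add: geo)
  have "g (\<gamma> t) (DD (DD J) t) (vel t) = 0" for t
    unfolding jacobi_DD2[OF J] g_scale[OF \<gamma>_M Rv_T[OF field_T[OF f]] vel_T]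
    by (simp add: curvature_self[OF field_T[OF f] vel_T \<gamma>_M])
  then have "(h' has_vector_derivative 0) (at t)" for t unfolding h'_def
    using g_deriv[OF DD_field[OF f] vel_field, of t] g_zero_right[OF DD_T[OF f]] by (simp add: geo)
  then obtain k where k: "\<And>t. h' t = k"
    using has_vector_derivative_zero_constant[of UNIV h'] by auto
  have "((\<lambda>t. h t - t * k) has_vector_derivative k - 1 * k) (at t)" for t
    using dh[of t] k by (intro has_vector_derivative_diff bounded_linear.has_vector_derivative[OF bounded_linear_mult_left])
      (auto simp: has_vector_derivative_id)
  then obtain m where m: "\<And>t. h t - t * k = m"
    using has_vector_derivative_zero_constant[of UNIV "\<lambda>t. h t - t * k"] by auto
  have "h a = 0" "h b = 0" using z g_zero[OF \<gamma>_M vel_T] by (auto simp: h_def)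
  then have "- (a * k) = m" "- (b * k) = m" using m[of a] m[of b] by auto
  then have "k = 0" using z(3) by (metis mult_cancel_right neg_equal_iff_equal)
  then have "m = 0" using \<open>- (a * k) = m\<close> by simp
  then show ?thesis using m[of t] \<open>k = 0\<close> by (simp add: h_def)
qed

end

section \<open>Invariance under shifts of time\<close>

lemma has_vector_derivative_shift:
  "((\<lambda>s. f (s + a)) has_vector_derivative D) (at t) \<longleftrightarrow> (f has_vector_derivative D) (at (t + a))"
proof -
  have sh: "((\<lambda>s. f (s + a)) has_vector_derivative D) (at t)" if "(f has_vector_derivative D) (at (t + a))" for f a t
  proof -
    have "((\<lambda>s. s + a) has_vector_derivative 1) (at t)"
      unfolding has_real_derivative_iff_has_vector_derivative[symmetric] by (auto intro!: derivative_eq_intros)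
    from vector_diff_chain_at[OF this that] show ?thesis by (simp add: o_def)
  qed
  show ?thesis using sh[of f t a] sh[of "\<lambda>s. f (s + a)" "t + a" "- a"] by auto
qed

lemma vector_derivative_shift: "vector_derivative (\<lambda>s. f (s + a)) (at t) = vector_derivative f (at (t + a))"
  by (simp add: vector_derivative_def has_vector_derivative_shift)

lemma smooth_on_shift:
  fixes f :: "real \<Rightarrow> 'v::real_normed_vector"
  assumes "open S" "smooth_on S f" shows "smooth_on ((\<lambda>s. s + a) -` S) (\<lambda>s. f (s + a))"
proof (rule smooth_onI)
  fix k
  have o: "open ((\<lambda>s. s + a) -` S)" by (intro open_vimage assms continuous_intros)
  show "Ck_on k ((\<lambda>s. s + a) -` S) (\<lambda>s. f (s + a))"
    by (rule Ck_on_compose[OF o Ck_on_add[OF Ck_on_bounded_linear[OF bounded_linear_ident] Ck_on_const o]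
        smooth_onD[OF assms(2)] assms(1)]) auto
qed

lemma velocity_shift: "velocity A (\<lambda>s. \<gamma> (s + a)) t = velocity A \<gamma> (t + a)"
proof
  fix c show "velocity A (\<lambda>s. \<gamma> (s + a)) t c = velocity A \<gamma> (t + a) c"
    using vector_derivative_shift[of "\<lambda>s. cmap c (\<gamma> s)" a t] by (simp add: velocity_def o_def)
qed

lemma covariant_derivative_shift:
  "covariant_derivative A g (\<lambda>s. \<gamma> (s + a)) (\<lambda>s. J (s + a)) t = covariant_derivative A g \<gamma> J (t + a)"
proof
  fix c show "covariant_derivative A g (\<lambda>s. \<gamma> (s + a)) (\<lambda>s. J (s + a)) t c = covariant_derivative A g \<gamma> J (t + a) c"
    using vector_derivative_shift[of "\<lambda>s. J s c" a t] by (simp add: covariant_derivative_def velocity_shift)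
qed

context geodesic_curve
begin

text \<open>\<open>free_of_conjugate_points\<close> tests only fields vanishing at time 0;
  reparametrizing the geodesic brings any other zero there.\<close>

lemma geodesic_shift: "unit_speed_geodesic M A g (\<lambda>s. \<gamma> (s + a))"
  unfolding unit_speed_geodesic_def
proof (intro conjI allI)
  show "smooth_curve M A (\<lambda>s. \<gamma> (s + a))" unfolding smooth_curve_def
  proof (intro conjI ballI)
    show "range (\<lambda>s. \<gamma> (s + a)) \<subseteq> M" using \<gamma>_M by auto
    show "continuous_on UNIV (\<lambda>s. \<gamma> (s + a))"
      by (rule continuous_on_compose2[OF \<gamma>_cont[of UNIV]]) (auto intro: continuous_intros)
    fix c assume c: "c \<in> A"
    then have "smooth_on (dom c) (cmap c \<circ> \<gamma>)" using smooth by (simp add: smooth_curve_def)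
    from smooth_on_shift[OF dom_open[OF c] this, of a]
    show "smooth_on ((\<lambda>s. \<gamma> (s + a)) -` cdom c) (cmap c \<circ> (\<lambda>s. \<gamma> (s + a)))"
      by (simp add: o_def vimage_def)
  qed
  fix t
  have v: "velocity A (\<lambda>s. \<gamma> (s + a)) = (\<lambda>t. vel (t + a))" by (rule ext, rule velocity_shift)
  show "covariant_derivative A g (\<lambda>s. \<gamma> (s + a)) (velocity A (\<lambda>s. \<gamma> (s + a))) t = (\<lambda>c. 0)"
    unfolding v covariant_derivative_shift by (rule geo)
  show "g (\<gamma> (t + a)) (velocity A (\<lambda>s. \<gamma> (s + a)) t) (velocity A (\<lambda>s. \<gamma> (s + a)) t) = 1"
    unfolding v by (rule unit)
qed

lemma jacobi_shift:
  assumes J: "beta_jacobi_field A g \<beta> \<gamma> J"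
  shows "beta_jacobi_field A g \<beta> (\<lambda>s. \<gamma> (s + a)) (\<lambda>s. J (s + a))"
  unfolding beta_jacobi_field_def
proof (intro conjI allI)
  have f: "field J" using J by (simp add: beta_jacobi_field_def)
  show "smooth_field_along A (\<lambda>s. \<gamma> (s + a)) (\<lambda>s. J (s + a))" unfolding smooth_field_along_def
  proof (intro conjI ballI allI)
    show "J (t + a) \<in> T (\<gamma> (t + a))" for t by (rule field_T[OF f])
    fix c assume c: "c \<in> A"
    then have "smooth_on (dom c) (\<lambda>t. J t c)" using f by (simp add: smooth_field_along_def)
    from smooth_on_shift[OF dom_open[OF c] this, of a]
    show "smooth_on ((\<lambda>s. \<gamma> (s + a)) -` cdom c) (\<lambda>t. J (t + a) c)" by (simp add: vimage_def)
  qed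
  fix t c
  have D: "covariant_derivative A g (\<lambda>s. \<gamma> (s + a)) (\<lambda>s. J (s + a)) = (\<lambda>t. DD J (t + a))" for J
    by (rule ext, rule covariant_derivative_shift)
  show "covariant_derivative A g (\<lambda>s. \<gamma> (s + a)) (covariant_derivative A g (\<lambda>s. \<gamma> (s + a)) (\<lambda>s. J (s + a))) t c
     + \<beta> *\<^sub>R curvature A g (\<gamma> (t + a)) (J (t + a)) (velocity A (\<lambda>s. \<gamma> (s + a)) t) (velocity A (\<lambda>s. \<gamma> (s + a)) t) c = 0"
    unfolding D velocity_shift using J unfolding beta_jacobi_field_def by blast
qed

end

context framed_geodesic
begin

text \<open>A nontrivial solution with zeros \<open>a\<close> and \<open>b\<close> becomes, shifted
  by \<open>a\<close>, a field along a unit speed geodesic vanishing at times 0 and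
  \<open>b - a\<close>. Its orthogonality comes for free from the two zeros.\<close>

lemma free_imp_disconjugate:
  assumes "free_of_conjugate_points M A g \<beta>" shows "jdisc K \<beta>"
  unfolding second_order.disconjugate_def[OF second_order_scale[OF second_order_K]]
proof (intro allI impI, elim conjE)
  fix y y' a b t
  assume y: "jsol K \<beta> y y'" "y a = 0" "y b = 0" "a \<noteq> b"
  note J = sol_to_jacobi[OF y(1)]
  show "y t = 0"
  proof (rule ccontr)
    assume nz: "y t \<noteq> 0"
    have "\<forall>s. E (s + a) (y (s + a)) = (\<lambda>c. 0) \<longrightarrow> s = 0"
    proof (intro allI impI)
      fix s assume s: "E (s + a) (y (s + a)) = (\<lambda>c. 0)"
      show "s = 0"
      proof (rule assms[unfolded free_of_conjugate_points_def, rule_format, of "\<lambda>s. \<gamma> (s + a)" "\<lambda>s. E (s + a) (y (s + a))" s], intro conjI allI)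
        show "unit_speed_geodesic M A g (\<lambda>s. \<gamma> (s + a))" by (rule geodesic_shift)
        show "beta_jacobi_field A g \<beta> (\<lambda>s. \<gamma> (s + a)) (\<lambda>s. E (s + a) (y (s + a)))"
          using jacobi_shift[OF J] .
        show "g (\<gamma> (s + a)) (E (s + a) (y (s + a))) (velocity A (\<lambda>s. \<gamma> (s + a)) s) = 0" for s
          unfolding velocity_shift by (rule jacobi_orthogonal[OF J, of a b]) (use y in \<open>auto simp: E_eq_0\<close>)
        show "\<exists>s. E (s + a) (y (s + a)) \<noteq> (\<lambda>c. 0)"
          using nz by (intro exI[of _ "t - a"]) (simp add: E_eq_0)
        show "E (0 + a) (y (0 + a)) = (\<lambda>c. 0)" using y by (simp add: E_eq_0)
        show "E (s + a) (y (s + a)) = (\<lambda>c. 0)" by (rule s)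
      qed
    qed
    then have "b - a = 0" using y(3) by (metis E_eq_0 diff_add_cancel)
    then show False using y(4) by simp
  qed
qed

end

context rmfd
begin

lemma geodesic_framed:
  assumes "unit_speed_geodesic M A g \<gamma>"
  obtains e where "framed_geodesic M A g \<gamma> e"
proof -
  interpret geodesic_curve M A g \<gamma>
    using assms by unfold_locales (auto simp: unit_speed_geodesic_def)
  obtain e :: "'e \<Rightarrow> real \<Rightarrow> ('a, 'e) tvec" where "\<forall>i\<in>Basis. field (e i) \<and> (\<forall>t. DD (e i) t = (\<lambda>c. 0))"
     "\<forall>i\<in>Basis. \<forall>j\<in>Basis. \<forall>t. g (\<gamma> t) (e i t) (e j t) = (if i = j then 1 else 0)"
    using parallel_frame by blast
  then have "framed_geodesic M A g \<gamma> e" by unfold_locales auto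
  then show thesis by (rule that)
qed

end

section \<open>Existence of geodesics\<close>

lemma Ck_on_Pair:
  assumes "open S" "Ck_on k S f" "Ck_on k S h" shows "Ck_on k S (\<lambda>x. (f x, h x))"
proof -
  have "bounded_linear (\<lambda>a. (a, 0))" "bounded_linear (\<lambda>b. (0, b))"
    by (intro bounded_linear_Pair bounded_linear_ident bounded_linear_zero)+
  from Ck_on_add[OF Ck_on_linear_comp[OF this(1) assms(1,2)] Ck_on_linear_comp[OF this(2) assms(1,3)] assms(1)]
  show ?thesis by simp
qed

lemma Ck_on_lipschitz:
  fixes f :: "'x::euclidean_space \<Rightarrow> 'y::real_normed_vector"
  assumes "Ck_on 1 S f" "K \<subseteq> S" "compact K" "convex K"
  obtains L where "L > 0" "\<And>x y. x \<in> K \<Longrightarrow> y \<in> K \<Longrightarrow> norm (f x - f y) \<le> L * norm (x - y)"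
proof -
  have d: "f differentiable at x" if "x \<in> K" for x using assms(1,2) that by auto
  obtain L where L: "L > 0" "\<And>x v. x \<in> K \<Longrightarrow> norm (dd f x v) \<le> L * norm v"
    by (rule linear_family_bound[of K "\<lambda>x v. dd f x v"])
      (use linear_dd[OF d] assms in \<open>auto intro: continuous_on_subset\<close>)
  have "norm (f x - f y) \<le> L * norm (x - y)" if "x \<in> K" "y \<in> K" for x y
  proof (rule differentiable_bound[OF assms(4) _ _ that])
    fix z assume z: "z \<in> K"
    show "(f has_derivative (\<lambda>v. dd f z v)) (at z within K)"
      by (rule has_derivative_at_withinI[OF has_derivative_dd[OF d[OF z]]])
    show "onorm (\<lambda>v. dd f z v) \<le> L" by (rule onorm_le) (rule L(2)[OF z])
  qed
  with L(1) that show thesis by blast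
qed

lemma (in coord_metric) smooth_family2_product:
  fixes F :: "'e \<Rightarrow> 'e \<Rightarrow> 'e \<Rightarrow> 'v::real_normed_vector"
  assumes "\<And>v w. Ck_on k U (\<lambda>x. F x v w)" "\<And>x v. x \<in> U \<Longrightarrow> linear (F x v)" "\<And>x w. x \<in> U \<Longrightarrow> linear (\<lambda>v. F x v w)"
  shows "Ck_on k (U \<times> UNIV) (\<lambda>p. F (fst p) (snd p) (snd p))"
proof (rule Ck_on_family2[where F="\<lambda>p. F (fst p)" and u=snd and w=snd])
  show o: "open (U \<times> (UNIV :: 'e set))" using open_U by (intro open_Times) auto
  show "Ck_on k (U \<times> (UNIV :: 'e set)) (\<lambda>p. F (fst p) v w)" for v w
    by (rule Ck_on_compose[where g="\<lambda>x. F x v w" and T=U, OF o Ck_on_bounded_linear[OF bounded_linear_fst] assms(1) open_U]) auto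
qed (use assms in \<open>auto intro: Ck_on_bounded_linear bounded_linear_snd\<close>)

text \<open>Turns unit length for the metric into a bound on the coordinates of a velocity, uniform
  over a compact set; \<open>m\<close> is the minimum of the quadratic form over \<open>C\<close>
  times the unit sphere.\<close>

lemma (in coord_metric) uniform_lower_bound:
  assumes "compact C" "C \<subseteq> U" "C \<noteq> {}"
  obtains m where "m > 0" "\<And>x u. x \<in> C \<Longrightarrow> m * (norm u)\<^sup>2 \<le> G x u u"
proof -
  have "Ck_on 0 (U \<times> UNIV) (\<lambda>p. G (fst p) (snd p) (snd p))"
    by (rule smooth_family2_product) (use smooth_onD[OF smooth_G] G_linear G_linear2 in auto)
  then have "continuous_on (C \<times> sphere 0 1) (\<lambda>p. G (fst p) (snd p) (snd p))"
    using assms(2) by (auto intro: continuous_on_subset)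
  moreover have "compact (C \<times> sphere (0::'e) 1)" using assms(1) by (intro compact_Times) auto
  moreover obtain b :: 'e where "b \<in> Basis" using nonempty_Basis by blast
  then have "C \<times> sphere (0::'e) 1 \<noteq> {}" using assms(3) by force
  ultimately have "\<exists>p\<in>C \<times> sphere 0 1. \<forall>q\<in>C \<times> sphere 0 1. G (fst p) (snd p) (snd p) \<le> G (fst q) (snd q) (snd q)"
    by (intro continuous_attains_inf)
  then obtain p where p: "p \<in> C \<times> sphere 0 1"
    "\<And>q. q \<in> C \<times> sphere 0 1 \<Longrightarrow> G (fst p) (snd p) (snd p) \<le> G (fst q) (snd q) (snd q)" by blast
  define m where "m = G (fst p) (snd p) (snd p)"
  have "snd p \<noteq> 0" using p(1) by auto
  then have "m > 0" unfolding m_def using p(1) assms(2) by (intro G_pos) auto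
  moreover have "m * (norm u)\<^sup>2 \<le> G x u u" if x: "x \<in> C" for x u
  proof (cases "u = 0")
    case True then show ?thesis using x assms(2) G_zero[of x] by auto
  next
    case False
    have xU: "x \<in> U" using x assms(2) by blast
    have "m \<le> G x ((1 / norm u) *\<^sub>R u) ((1 / norm u) *\<^sub>R u)"
      unfolding m_def using p(2)[of "(x, (1 / norm u) *\<^sub>R u)"] x False by auto
    also have "\<dots> = G x u u / (norm u)\<^sup>2" by (simp add: G_scale[OF xU] power2_eq_square)
    finally show ?thesis using False by (simp add: field_simps)
  qed
  ultimately show thesis using that by blast
qed

context rmfd
begin

definition unit_tangent :: "('a \<times> ('a, 'e) tvec) set" where
  "unit_tangent = {s. fst s \<in> M \<and> snd s \<in> T (fst s) \<and> g (fst s) (snd s) (snd s) = 1}"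

text \<open>The geodesic equation as a first order system for point and velocity, required in all
  charts so that solutions can be glued. Membership in \<open>unit_tangent\<close> is included
  because it is the set of admissible states for the continuation argument.\<close>

definition gsol :: "real \<Rightarrow> real \<Rightarrow> (real \<Rightarrow> 'a \<times> ('a, 'e) tvec) \<Rightarrow> bool" where
  "gsol a b s \<longleftrightarrow> continuous_on {a..b} (\<lambda>t. fst (s t)) \<and> (\<forall>t\<in>{a..b}. s t \<in> unit_tangent \<and> (\<forall>c\<in>ch (fst (s t)).
     ((\<lambda>r. cmap c (fst (s r))) has_vector_derivative snd (s t) c) (at t within {a..b}) \<and>
     ((\<lambda>r. snd (s r) c) has_vector_derivative
        - chris (Gc c) (cmap c (fst (s t))) (snd (s t) c) (snd (s t) c)) (at t within {a..b})))"

lemma gsol_subset: "gsol a b s \<Longrightarrow> {a'..b'} \<subseteq> {a..b} \<Longrightarrow> gsol a' b' s"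
  unfolding gsol_def
  by (meson continuous_on_subset has_vector_derivative_within_subset subsetD)

text \<open>The existence time is the same for all starting points near \<open>p\<close> and all
  unit vectors there, as the compactness argument requires.\<close>

lemma local_geodesic:
  assumes p: "p \<in> M"
  shows "\<exists>O' \<epsilon>. open O' \<and> p \<in> O' \<and> \<epsilon> > 0 \<and> (\<forall>q v t0. q \<in> O' \<and> (q, v) \<in> unit_tangent \<longrightarrow>
    (\<exists>s. gsol (t0 - \<epsilon>) (t0 + \<epsilon>) s \<and> s t0 = (q, v)))"
proof -
  obtain c where c: "c \<in> ch p" using cover[OF p] by blast
  then have cA: "c \<in> A" by (simp add: ch_iff)
  interpret coord_metric "cimg c" "Gc c" by (rule coord_metric[OF cA])
  define x0 where "x0 = cmap c p"
  obtain r0 where r0: "r0 > 0" "cball x0 r0 \<subseteq> cimg c"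
    using open_contains_cball[of "cimg c"] open_U cmap_in[OF c] unfolding x0_def by blast
  \<comment> \<open>Starting points lie within \<open>r\<close> of \<open>x0\<close> and solutions
    move by at most \<open>r\<close>, so the estimates are needed on the ball of radius
    \<open>2 * r\<close>.\<close>
  define r where "r = r0 / 2"
  have r: "r > 0" "cball x0 (2 * r) \<subseteq> cimg c" using r0 by (auto simp: r_def)
  obtain m where m: "m > 0" "\<And>x u. x \<in> cball x0 (2 * r) \<Longrightarrow> m * (norm u)\<^sup>2 \<le> Gc c x u u"
    using uniform_lower_bound[OF compact_cball r(2)] r(1) by auto
  \<comment> \<open>A bound for the coordinates of unit vectors; \<open>C\<close> allows a further
    \<open>r\<close> for the motion of the velocity.\<close>
  define B where "B = sqrt (1 / m)"
  define F where "F = (\<lambda>z :: 'e \<times> 'e. (snd z, - \<Gamma> (fst z) (snd z) (snd z)))"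
  have o: "open (cimg c \<times> (UNIV :: 'e set))" using open_U by (intro open_Times) auto
  have CkF: "Ck_on k (cimg c \<times> UNIV) F" for k unfolding F_def
    by (intro Ck_on_Pair o Ck_on_uminus Ck_on_bounded_linear bounded_linear_snd smooth_family2_product Ck_\<Gamma> \<Gamma>_linear \<Gamma>_linear2)
  define C where "C = cball x0 (2 * r) \<times> cball (0::'e) (B + r)"
  have C: "compact C" "convex C" "C \<subseteq> cimg c \<times> UNIV"
    unfolding C_def using r(2) by (auto intro!: compact_Times convex_Times)
  obtain L where L: "L > 0" "\<And>x y. x \<in> C \<Longrightarrow> y \<in> C \<Longrightarrow> norm (F x - F y) \<le> L * norm (x - y)"
    using Ck_on_lipschitz[OF CkF C(3,1,2)] by blast
  have FC: "continuous_on C F" using Ck_on_imp_continuous_on[OF CkF[of 0]] continuous_on_subset C(3) by blast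
  then have "bounded (F ` C)" using C(1) compact_continuous_image compact_imp_bounded by blast
  then obtain N where N: "N > 0" "\<And>z. z \<in> C \<Longrightarrow> norm (F z) \<le> N" unfolding bounded_pos by blast
  \<comment> \<open>The first bound keeps the solution in the ball, the second makes the integral
    operator a contraction.\<close>
  define \<epsilon> where "\<epsilon> = min (r / N) (1 / (2 * L))"
  have \<epsilon>: "\<epsilon> > 0" "\<epsilon> * N \<le> r" "\<epsilon> * L < 1" using r(1) N(1) L(1) by (auto simp: \<epsilon>_def min_def field_simps)
  obtain O' where O': "open O'" "cdom c \<inter> cmap c -` ball x0 r = M \<inter> O'"
  proof -
    have "openin (top_of_set (cdom c)) (cdom c \<inter> cmap c -` ball x0 r)"
      using continuous_openin_preimage_gen[OF cmap_cont[OF cA]] by blast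
    then have "openin (top_of_set M) (cdom c \<inter> cmap c -` ball x0 r)"
      using cdom_open[OF cA] openin_trans by blast
    then show ?thesis using that unfolding openin_open by blast
  qed
  have "p \<in> O'" using O'(2) c r(1) by (auto simp: x0_def ch_iff)
  moreover have "\<exists>s. gsol (t0 - \<epsilon>) (t0 + \<epsilon>) s \<and> s t0 = (q, v)" if q: "q \<in> O'" and v: "(q, v) \<in> unit_tangent" for q v t0
  proof -
    let ?I = "{t0 - \<epsilon>..t0 + \<epsilon>}"
    have qM: "q \<in> M" "v \<in> T q" "g q v v = 1" using v by (auto simp: unit_tangent_def)
    have cq: "c \<in> ch q" and xq: "cmap c q \<in> ball x0 r" using O'(2) q qM cA by (auto simp: ch_iff)
    define z0 where "z0 = (cmap c q, v c)"
    have "m * (norm (v c))\<^sup>2 \<le> 1" using m(2)[of "cmap c q" "v c"] xq r(1) g_coord[OF cq qM(2) qM(2)] qM(3) by auto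
    then have "(norm (v c))\<^sup>2 \<le> 1 / m" using m(1) by (simp add: field_simps)
    then have vB: "norm (v c) \<le> B" unfolding B_def by (rule real_le_rsqrt)
    have sub: "cball z0 r \<subseteq> C"
    proof
      fix z assume z: "z \<in> cball z0 r"
      have "dist (fst z0) (fst z) \<le> r" "dist (snd z0) (snd z) \<le> r"
        using z dist_fst_le[of z0 z] dist_snd_le[of z0 z] by auto
      moreover have "dist x0 (fst z) \<le> dist x0 (fst z0) + dist (fst z0) (fst z)" by (rule dist_triangle)
      moreover have "norm (snd z) \<le> norm (snd z0) + dist (snd z0) (snd z)"
        by (metis dist_norm norm_minus_commute norm_triangle_sub)
      ultimately show "z \<in> C" using xq vB by (cases z) (auto simp: C_def z0_def)
    qed
    obtain z where z: "z t0 = z0" "\<And>t. t \<in> ?I \<Longrightarrow> z t \<in> cball z0 r"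
      "\<And>t. t \<in> ?I \<Longrightarrow> (z has_vector_derivative F (z t)) (at t within ?I)"
    proof (rule picard[of \<epsilon> r L t0 z0 "\<lambda>t. F" N])
      show "continuous_on (?I \<times> cball z0 r) (\<lambda>p. F (snd p))"
        by (rule continuous_on_compose2[OF FC]) (use sub in \<open>auto intro: continuous_intros\<close>)
      show "norm (F y) \<le> N" if "y \<in> cball z0 r" for y using N(2) sub that by blast
      show "norm (F y - F y') \<le> L * norm (y - y')" if "y \<in> cball z0 r" "y' \<in> cball z0 r" for y y'
        using L(2) sub that by blast
    qed (use \<epsilon> r L in auto)
    define x u where "x = (\<lambda>t. fst (z t))" and "u = (\<lambda>t. snd (z t))"
    have dx: "(x has_vector_derivative u t) (at t within ?I)"
      and du: "(u has_vector_derivative - \<Gamma> (x t) (u t) (u t)) (at t within ?I)" if "t \<in> ?I" for t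
      using bounded_linear.has_vector_derivative[OF bounded_linear_fst z(3)[OF that]]
        bounded_linear.has_vector_derivative[OF bounded_linear_snd z(3)[OF that]] by (auto simp: x_def u_def F_def)
    have xU: "x t \<in> cimg c" if "t \<in> ?I" for t
    proof -
      have "z t \<in> cimg c \<times> UNIV" using z(2)[OF that] sub C(3) by blast
      then show ?thesis by (simp add: x_def mem_Times_iff)
    qed
    define \<gamma> w where "\<gamma> = (\<lambda>t. cinv c (x t))" and "w = (\<lambda>t. tvec_of A c (\<gamma> t) (u t))"
    have \<gamma>c: "c \<in> ch (\<gamma> t)" "cmap c (\<gamma> t) = x t" if "t \<in> ?I" for t
      using cinv_in[OF cA xU[OF that]] cmap_cinv[OF cA xU[OF that]] by (auto simp: \<gamma>_def)
    have wT: "w t \<in> T (\<gamma> t)" and wc: "w t c = u t" if "t \<in> ?I" for t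
      unfolding w_def using tvec_of_T tvec_of_self \<gamma>c(1)[OF that] by auto
    have x_cont: "continuous_on ?I x" by (rule continuous_on_vector_derivative[OF dx])
    have \<gamma>_cont: "continuous_on ?I \<gamma>" unfolding \<gamma>_def
      by (rule continuous_on_compose2[OF cinv_cont[OF cA] x_cont]) (use xU in auto)
    have t0: "t0 \<in> ?I" using \<epsilon> by auto
    have \<gamma>0: "\<gamma> t0 = q" by (simp add: \<gamma>_def x_def z(1) z0_def cinv_cmap[OF cq])
    have w0: "w t0 = v" unfolding w_def \<gamma>0 by (simp add: u_def z(1) z0_def tvec_of_eq[OF cq qM(2)])
    \<comment> \<open>Conservation of speed: by \<open>compat\<close> the derivative of the metric
      coefficients cancels the acceleration terms.\<close>
    have unit: "Gc c (x t) (u t) (u t) = 1" if t: "t \<in> ?I" for t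
    proof -
      have "((\<lambda>t. Gc c (x t) (u t) (u t)) has_derivative (\<lambda>h. 0)) (at t within ?I)" if t: "t \<in> ?I" for t
      proof -
        have "((\<lambda>t. Gc c (x t) (u t) (u t)) has_derivative
          (\<lambda>h. dd (\<lambda>y. Gc c y (u t) (u t)) (x t) (h *\<^sub>R u t) + Gc c (x t) (h *\<^sub>R (- \<Gamma> (x t) (u t) (u t))) (u t)
            + Gc c (x t) (u t) (h *\<^sub>R (- \<Gamma> (x t) (u t) (u t))))) (at t within ?I)"
          by (rule has_derivative_family2[where F="Gc c" and f=x and t=t and u=u and w=u, OF open_U xU[OF t]])
            (use G_linear G_linear2 G_diffable[OF xU[OF t]] dx[OF t] du[OF t] t in \<open>auto simp: has_vector_derivative_def\<close>)
        moreover have "dd (\<lambda>y. Gc c y (u t) (u t)) (x t) (h *\<^sub>R u t) = h * dG (x t) (u t) (u t) (u t)" for h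
          unfolding dG_def using linear_scale[OF linear_dd[OF G_diffable[OF xU[OF t]]]] by simp
        ultimately show ?thesis
          by (simp add: compat[OF xU[OF t]] G_scale[OF xU[OF t]] G_neg[OF xU[OF t]] algebra_simps)
      qed
      then obtain k where k: "\<And>t. t \<in> ?I \<Longrightarrow> Gc c (x t) (u t) (u t) = k"
        using has_derivative_zero_constant[of ?I "\<lambda>t. Gc c (x t) (u t) (u t)"] by blast
      have "Gc c (x t0) (u t0) (u t0) = 1"
        using qM g_coord[OF cq qM(2) qM(2)] by (simp add: x_def u_def z(1) z0_def)
      then show ?thesis using k t t0 by metis
    qed
    have M: "\<gamma> ` ?I \<subseteq> M" using \<gamma>c(1) ch_M by blast
    have "gsol (t0 - \<epsilon>) (t0 + \<epsilon>) (\<lambda>t. (\<gamma> t, w t))" unfolding gsol_def fst_conv snd_conv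
    proof (intro conjI ballI)
      show "continuous_on ?I \<gamma>" by (rule \<gamma>_cont)
      fix t assume t: "t \<in> ?I"
      have "g (\<gamma> t) (w t) (w t) = 1"
        using g_coord[OF \<gamma>c(1)[OF t] wT[OF t] wT[OF t]] unit[OF t] by (simp add: \<gamma>c(2)[OF t] wc[OF t])
      then show "(\<gamma> t, w t) \<in> unit_tangent" using wT[OF t] M t by (auto simp: unit_tangent_def)
      fix d assume d: "d \<in> ch (\<gamma> t)"
      have ct: "continuous (at t within ?I) \<gamma>" using \<gamma>_cont t by (simp add: continuous_on_eq_continuous_within)
      have 1: "((\<lambda>s. cmap c (\<gamma> s)) has_vector_derivative u t) (at t within ?I)"
        by (rule has_vector_derivative_transform[OF t \<gamma>c(2) dx[OF t]])
      have "((\<lambda>s. w s c) has_vector_derivative - \<Gamma> (x t) (u t) (u t)) (at t within ?I)"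
        by (rule has_vector_derivative_transform[OF t wc du[OF t]])
      then have 2: "((\<lambda>s. w s c) has_vector_derivative 0 - \<Gamma> (cmap c (\<gamma> t)) (u t) (w t c)) (at t within ?I)"
        by (simp add: \<gamma>c(2)[OF t] wc[OF t])
      have Du: "D c d (\<gamma> t) (u t) = w t d" using T_D[OF wT[OF t] \<gamma>c(1)[OF t] d] wc[OF t] by simp
      show "((\<lambda>s. cmap d (\<gamma> s)) has_vector_derivative w t d) (at t within ?I)"
        using covariant_transfer_velocity[OF t ct M \<gamma>c(1)[OF t] d 1] unfolding Du .
      show "((\<lambda>s. w s d) has_vector_derivative - chris (Gc d) (cmap d (\<gamma> t)) (w t d) (w t d)) (at t within ?I)"
        using covariant_transfer_field[OF t ct M \<gamma>c(1)[OF t] d 1 wT 2] linear_0[OF D_linear[OF \<gamma>c(1)[OF t] d]]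
        unfolding Du by simp
    qed
    then show ?thesis using \<gamma>0 w0 by auto
  qed
  ultimately show ?thesis using O'(1) \<epsilon>(1) by blast
qed

text \<open>Compactness of \<open>M\<close>: finitely many of the neighbourhoods cover it, and the
  least of their existence times serves every unit vector.\<close>

lemma uniform_local_geodesic:
  "\<exists>\<epsilon>>0. \<forall>s0\<in>unit_tangent. \<forall>t0. \<exists>s. gsol (t0 - \<epsilon>) (t0 + \<epsilon>) s \<and> s t0 = s0"
proof -
  obtain N \<epsilon> where N: "\<And>p. p \<in> M \<Longrightarrow> open (N p) \<and> p \<in> N p \<and> \<epsilon> p > (0::real)"
    and sol: "\<And>p q v t0. p \<in> M \<Longrightarrow> q \<in> N p \<Longrightarrow> (q, v) \<in> unit_tangent \<Longrightarrow>
      \<exists>s. gsol (t0 - \<epsilon> p) (t0 + \<epsilon> p) s \<and> s t0 = (q, v)"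
    using local_geodesic by metis
  obtain F where F: "F \<subseteq> M" "finite F" "M \<subseteq> (\<Union>p\<in>F. N p)"
    using compactE_image[OF compact_M, of M N] N by blast
  \<comment> \<open>The inserted 1 keeps \<open>Min\<close> meaningful when \<open>F\<close> is
    empty.\<close>
  define \<delta> where "\<delta> = Min (insert 1 (\<epsilon> ` F))"
  have \<delta>: "\<delta> > 0" "\<And>p. p \<in> F \<Longrightarrow> \<delta> \<le> \<epsilon> p" using F N by (auto simp: \<delta>_def Min_gr_iff)
  have "\<exists>s. gsol (t0 - \<delta>) (t0 + \<delta>) s \<and> s t0 = s0" if s0: "s0 \<in> unit_tangent" for s0 t0
  proof -
    have "fst s0 \<in> M" using s0 by (simp add: unit_tangent_def)
    then obtain p where p: "p \<in> F" "fst s0 \<in> N p" using F by blast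
    then obtain s where "gsol (t0 - \<epsilon> p) (t0 + \<epsilon> p) s" "s t0 = s0"
      using sol[of p "fst s0" "snd s0" t0] F(1) s0 unfolding prod.collapse by blast
    then show ?thesis using \<delta>(2)[OF p(1)] gsol_subset[of "t0 - \<epsilon> p" "t0 + \<epsilon> p" s "t0 - \<delta>" "t0 + \<delta>"] by auto
  qed
  with \<delta>(1) show ?thesis by blast
qed

text \<open>Geodesic completeness: the uniform existence time is the state-independent length
  demanded by the continuation principle.\<close>

lemma global_gsol:
  assumes s0: "s0 \<in> unit_tangent"
  shows "\<exists>s. s 0 = s0 \<and> (\<forall>n::nat. gsol (0 - n) (0 + n) s)"
proof (rule global_from_local[where V="\<lambda>t. unit_tangent"])
  fix a b :: real and s s' assume S: "gsol a b s" and e: "\<And>t. a \<le> t \<Longrightarrow> t \<le> b \<Longrightarrow> s t = s' t"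
  have c: "continuous_on {a..b} (\<lambda>t. fst (s' t)) \<longleftrightarrow> continuous_on {a..b} (\<lambda>t. fst (s t))"
    by (rule continuous_on_cong) (auto simp: e)
  have d1: "((\<lambda>r. cmap c (fst (s' r))) has_vector_derivative D) (at t within {a..b})"
    if "((\<lambda>r. cmap c (fst (s r))) has_vector_derivative D) (at t within {a..b})" "t \<in> {a..b}" for c D t
    by (rule has_vector_derivative_transform[OF that(2) _ that(1)]) (auto simp: e)
  have d2: "((\<lambda>r. snd (s' r) c) has_vector_derivative D) (at t within {a..b})"
    if "((\<lambda>r. snd (s r) c) has_vector_derivative D) (at t within {a..b})" "t \<in> {a..b}" for c D t
    by (rule has_vector_derivative_transform[OF that(2) _ that(1)]) (auto simp: e)
  show "gsol a b s'" unfolding gsol_def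
  proof (intro conjI ballI)
    show "continuous_on {a..b} (\<lambda>t. fst (s' t))" using S c by (simp add: gsol_def)
    fix t assume t: "t \<in> {a..b}"
    have st: "s t = s' t" using e t by auto
    show "s' t \<in> unit_tangent" using S t st unfolding gsol_def by metis
    fix c assume "c \<in> ch (fst (s' t))"
    then have ch: "c \<in> ch (fst (s t))" using st by simp
    have S1: "((\<lambda>r. cmap c (fst (s r))) has_vector_derivative snd (s t) c) (at t within {a..b})"
     and S2: "((\<lambda>r. snd (s r) c) has_vector_derivative
        - chris (Gc c) (cmap c (fst (s t))) (snd (s t) c) (snd (s t) c)) (at t within {a..b})"
      using S t ch unfolding gsol_def by blast+
    show "((\<lambda>r. cmap c (fst (s' r))) has_vector_derivative snd (s' t) c) (at t within {a..b})"
      using d1[OF S1 t] st by simp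
    show "((\<lambda>r. snd (s' r) c) has_vector_derivative
        - chris (Gc c) (cmap c (fst (s' t))) (snd (s' t) c) (snd (s' t) c)) (at t within {a..b})"
      using d2[OF S2 t] st by simp
  qed
next
  fix a b c :: real and s assume S: "gsol a b s" "gsol b c s" "a \<le> b" "b \<le> c"
  show "gsol a c s" unfolding gsol_def
  proof (intro conjI ballI)
    have "continuous_on ({a..b} \<union> {b..c}) (\<lambda>t. fst (s t))"
      using S by (intro continuous_on_closed_Un) (auto simp: gsol_def)
    moreover have "{a..b} \<union> {b..c} = {a..c}" using S(3,4) by auto
    ultimately show "continuous_on {a..c} (\<lambda>t. fst (s t))" by simp
    fix t assume t: "t \<in> {a..c}"
    then show "s t \<in> unit_tangent" using S unfolding gsol_def by (cases "t \<le> b") auto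
    fix d assume d: "d \<in> ch (fst (s t))"
    show "((\<lambda>r. cmap d (fst (s r))) has_vector_derivative snd (s t) d) (at t within {a..c})"
      using S d unfolding gsol_def by (intro has_vector_derivative_glue[OF S(3,4) t]) blast+
    show "((\<lambda>r. snd (s r) d) has_vector_derivative
        - chris (Gc d) (cmap d (fst (s t))) (snd (s t) d) (snd (s t) d)) (at t within {a..c})"
      using S d unfolding gsol_def by (intro has_vector_derivative_glue[OF S(3,4) t]) blast+
  qed
next
  fix a b t :: real and s assume "gsol a b s" "a \<le> t" "t \<le> b"
  then show "s t \<in> unit_tangent" by (auto simp: gsol_def)
next
  fix t :: real
  obtain \<epsilon> where \<epsilon>: "\<epsilon> > 0" "\<And>s0 t0. s0 \<in> unit_tangent \<Longrightarrow> \<exists>s. gsol (t0 - \<epsilon>) (t0 + \<epsilon>) s \<and> s t0 = s0"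
    using uniform_local_geodesic by blast
  show "\<exists>d>0. \<forall>a b. a \<le> t \<and> t \<le> b \<and> b - a < d \<longrightarrow>
      (\<forall>x\<in>unit_tangent. \<exists>s. gsol a b s \<and> s a = x) \<and> (\<forall>x\<in>unit_tangent. \<exists>s. gsol a b s \<and> s b = x)"
  proof (intro exI[of _ \<epsilon>] conjI allI impI ballI)
    fix a b x assume ab: "a \<le> t \<and> t \<le> b \<and> b - a < \<epsilon>" and x: "x \<in> unit_tangent"
    have *: "\<exists>s. gsol a b s \<and> s r = x" if "r = a \<or> r = b" for r
      using \<epsilon>(2)[OF x, of r] that ab \<epsilon>(1) gsol_subset[of "r - \<epsilon>" "r + \<epsilon>" _ a b] by fastforce
    show "\<exists>s. gsol a b s \<and> s a = x" "\<exists>s. gsol a b s \<and> s b = x" using * by auto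
  qed (rule \<epsilon>)
qed (rule s0)

text \<open>The global solution has only first derivatives to begin with; position and velocity
  coordinates gain regularity together, and then the second component is identified with
  \<open>velocity A \<gamma>\<close>.\<close>

lemma geodesic_exists:
  assumes "p \<in> M" "v \<in> T p" "g p v v = 1"
  shows "\<exists>\<gamma>. unit_speed_geodesic M A g \<gamma> \<and> \<gamma> 0 = p \<and> velocity A \<gamma> 0 = v"
proof -
  have "(p, v) \<in> unit_tangent" using assms by (simp add: unit_tangent_def)
  then obtain s where s: "s 0 = (p, v)" "\<And>n::nat. gsol (0 - n) (0 + n) s"
    using global_gsol by blast
  define \<gamma> w where "\<gamma> = (\<lambda>t. fst (s t))" and "w = (\<lambda>t. snd (s t))"
  have interval: "\<exists>n::nat. t \<in> {- real n<..<real n}" for t :: real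
  proof -
    obtain n :: nat where "\<bar>t\<bar> < n" using reals_Archimedean2 by blast
    then show ?thesis by (intro exI[of _ n]) auto
  qed
  have ut: "\<gamma> t \<in> M" "w t \<in> T (\<gamma> t)" "g (\<gamma> t) (w t) (w t) = 1" for t
  proof -
    obtain n :: nat where "t \<in> {- real n<..<real n}" using interval by blast
    then have "s t \<in> unit_tangent" using s(2)[of n] by (auto simp: gsol_def)
    then show "\<gamma> t \<in> M" "w t \<in> T (\<gamma> t)" "g (\<gamma> t) (w t) (w t) = 1" by (auto simp: unit_tangent_def \<gamma>_def w_def)
  qed
  have d\<gamma>: "((\<lambda>r. cmap c (\<gamma> r)) has_vector_derivative w t c) (at t)"
    and dw: "((\<lambda>r. w r c) has_vector_derivative - chris (Gc c) (cmap c (\<gamma> t)) (w t c) (w t c)) (at t)"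
    if c: "c \<in> ch (\<gamma> t)" for c t
    using s(2) c unfolding gsol_def \<gamma>_def w_def
    by (intro has_vector_derivative_exhaustion[of t 0]; blast)+
  have "continuous (at t) \<gamma>" for t
  proof -
    obtain n :: nat where n: "t \<in> {- real n<..<real n}" using interval by blast
    have "continuous_on {- real n..real n} \<gamma>" using s(2)[of n] by (simp add: gsol_def \<gamma>_def)
    then have "continuous_on {- real n<..<real n} \<gamma>" by (rule continuous_on_subset) auto
    then show ?thesis using n by (simp only: continuous_on_eq_continuous_at[OF open_greaterThanLessThan])
  qed
  then have cont: "continuous_on UNIV \<gamma>" by (simp add: continuous_on_eq_continuous_at)
  have Ck: "Ck_on k (\<gamma> -` cdom c) (\<lambda>t. cmap c (\<gamma> t)) \<and> Ck_on k (\<gamma> -` cdom c) (\<lambda>t. w t c)" if c: "c \<in> A" for c k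
  proof -
    interpret coord_metric "cimg c" "Gc c" by (rule coord_metric[OF c])
    obtain B where B: "open B" "cdom c = M \<inter> B" using cdom_open[OF c] unfolding openin_open by blast
    have "\<gamma> -` cdom c = \<gamma> -` B" using B ut(1) by auto
    then have o: "open (\<gamma> -` cdom c)" using open_vimage[OF B(1) cont] by simp
    have chc: "c \<in> ch (\<gamma> t)" if "t \<in> \<gamma> -` cdom c" for t using that c by (simp add: ch_iff)
    have xU: "cmap c (\<gamma> t) \<in> cimg c" if "t \<in> \<gamma> -` cdom c" for t using that by auto
    show ?thesis
    proof (induction k)
      case 0
      show ?case using d\<gamma>[OF chc] dw[OF chc]
        by (auto intro!: continuous_at_imp_continuous_on has_vector_derivative_continuous simp del: vimage_eq)
    next
      case (Suc k)
      have "Ck_on k (\<gamma> -` cdom c) (\<lambda>t. \<Gamma> (cmap c (\<gamma> t)) (w t c) (w t c))"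
      proof (rule Ck_on_family2[where F="\<lambda>t. \<Gamma> (cmap c (\<gamma> t))", OF o])
        show "Ck_on k (\<gamma> -` cdom c) (\<lambda>t. \<Gamma> (cmap c (\<gamma> t)) a b)" for a b
          by (rule Ck_on_compose[OF o conjunct1[OF Suc] Ck_\<Gamma> open_U]) (use xU in auto)
      qed (use \<Gamma>_linear \<Gamma>_linear2 xU Suc in auto)
      then have 1: "Ck_on k (\<gamma> -` cdom c) (\<lambda>t. - \<Gamma> (cmap c (\<gamma> t)) (w t c) (w t c))" by (rule Ck_on_uminus[OF o])
      have "Ck_on (Suc k) (\<gamma> -` cdom c) (\<lambda>t. w t c)"
        by (rule Ck_on_Suc_real[OF o dw[OF chc]]) (use 1 in auto)
      moreover have "Ck_on (Suc k) (\<gamma> -` cdom c) (\<lambda>t. cmap c (\<gamma> t))"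
        by (rule Ck_on_Suc_real[OF o d\<gamma>[OF chc]]) (use Suc in auto)
      ultimately show ?case by blast
    qed
  qed
  have "smooth_curve M A \<gamma>"
    using ut(1) cont Ck by (auto simp: smooth_curve_def smooth_on_def o_def)
  then interpret mcurve M A g \<gamma> by unfold_locales
  have vel: "vel = w"
  proof (intro ext)
    fix t c show "vel t c = w t c"
    proof (cases "c \<in> ch (\<gamma> t)")
      case True then show ?thesis using vector_derivative_unique_at[OF vel_deriv d\<gamma>] by blast
    next
      case False then show ?thesis using T_out[OF ut(2)] by (simp add: velocity_def)
    qed
  qed
  have "DD vel t = (\<lambda>c. 0)" for t
  proof (rule DD_eqI[OF _ T_0])
    fix c assume "c \<in> ch (\<gamma> t)"
    from dw[OF this] show "((\<lambda>r. vel r c) has_vector_derivative 0 - chris (Gc c) (cmap c (\<gamma> t)) (vel t c) (vel t c)) (at t)"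
      unfolding vel by simp
  qed
  then have "unit_speed_geodesic M A g \<gamma>"
    using smooth ut(3) by (simp add: unit_speed_geodesic_def vel)
  moreover have "\<gamma> 0 = p" "vel 0 = v" unfolding vel by (auto simp: \<gamma>_def w_def s(1))
  ultimately show ?thesis by blast
qed

end

section \<open>The terminator value\<close>

context rmfd
begin

text \<open>Sectional curvature constrains orthonormal pairs, so orthogonality of \<open>J\<close>
  and its normalization yield the sign along the solution. The case \<beta> = 0, free of any
  curvature assumption, puts 0 among the admissible parameters.\<close>

lemma free_of_nonpositive:
  assumes \<beta>: "\<beta> \<ge> 0" "\<beta> = 0 \<or> nonpositive_sectional_curvature M A g"
  shows "free_of_conjugate_points M A g \<beta>"
  unfolding free_of_conjugate_points_def
proof (intro allI impI, elim conjE)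
  fix \<gamma> J t
  assume \<gamma>: "unit_speed_geodesic M A g \<gamma>" and J: "beta_jacobi_field A g \<beta> \<gamma> J"
    and orth: "\<forall>t. g (\<gamma> t) (J t) (velocity A \<gamma> t) = 0"
    and nz: "\<exists>t. J t \<noteq> (\<lambda>c. 0)" and J0: "J 0 = (\<lambda>c. 0)" and Jt: "J t = (\<lambda>c. 0)"
  obtain e where "framed_geodesic M A g \<gamma> e" by (rule geodesic_framed[OF \<gamma>])
  then interpret framed_geodesic M A g \<gamma> e .
  have f: "field J" using J by (simp add: beta_jacobi_field_def)
  have JT: "J s \<in> T (\<gamma> s)" for s by (rule field_T[OF f])
  let ?y = "\<lambda>s. co s (J s)"
  have curv: "\<beta> * (K s (?y s) \<bullet> ?y s) \<le> 0" for s
  proof (cases "\<beta> = 0 \<or> J s = (\<lambda>c. 0)")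
    case True
    then show ?thesis using co_eq_0[OF JT, of s] by auto
  next
    case False
    then have np: "nonpositive_sectional_curvature M A g" and Js: "J s \<noteq> (\<lambda>c. 0)" using \<beta> by auto
    define n where "n = sqrt (g (\<gamma> s) (J s) (J s))"
    have n: "n > 0" "n * n = g (\<gamma> s) (J s) (J s)" using g_pos[OF \<gamma>_M JT Js] by (auto simp: n_def)
    define w where "w = (\<lambda>c. (1 / n) *\<^sub>R J s c)"
    have wT: "w \<in> T (\<gamma> s)" unfolding w_def by (rule T_scale[OF JT])
    have gw: "g (\<gamma> s) w z = g (\<gamma> s) (J s) z / n" if "z \<in> T (\<gamma> s)" for z
      unfolding w_def using g_scale[OF \<gamma>_M JT that] by simp
    have gw2: "g (\<gamma> s) z w = g (\<gamma> s) z (J s) / n" if "z \<in> T (\<gamma> s)" for z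
      using gw[OF that] g_sym[OF \<gamma>_M] that wT JT by metis
    have "g (\<gamma> s) w w = 1" unfolding gw[OF wT] gw2[OF JT] n(2)[symmetric] using n(1) by simp
    moreover have "g (\<gamma> s) (vel s) w = 0"
      unfolding gw2[OF vel_T] using orth g_sym[OF \<gamma>_M vel_T JT, of s] by simp
    ultimately have "g (\<gamma> s) (Rv s w) w \<le> 0"
      using np unit[of s] \<gamma>_M vel_T wT unfolding nonpositive_sectional_curvature_def by blast
    moreover have "Rv s w = (\<lambda>c. (1 / n) *\<^sub>R Rv s (J s) c)" unfolding w_def by (rule curvature_linear(2)[OF \<gamma>_M])
    ultimately have "g (\<gamma> s) (Rv s (J s)) (J s) / n / n \<le> 0"
      using gw2[OF Rv_T[OF wT]] g_scale[OF \<gamma>_M Rv_T[OF JT] JT, of s "1 / n"] by simp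
    then have "g (\<gamma> s) (Rv s (J s)) (J s) \<le> 0" using mult_pos_pos[OF n(1) n(1)]
      by (auto simp: divide_le_0_iff)
    then have "K s (?y s) \<bullet> ?y s \<le> 0" by (simp add: K_inner E_co[OF JT])
    then show ?thesis using \<beta>(1) by (simp add: mult_nonneg_nonpos)
  qed
  show "t = 0"
  proof (rule ccontr)
    assume "t \<noteq> 0"
    \<comment> \<open>The second zero may lie before time 0, so the two zeros are put in
      order.\<close>
    define a b where "a = min 0 t" and "b = max 0 t"
    have "a < b" "J a = (\<lambda>c. 0)" "J b = (\<lambda>c. 0)" using \<open>t \<noteq> 0\<close> J0 Jt by (auto simp: a_def b_def min_def max_def)
    then have "a < b" "?y a = 0" "?y b = 0" using co_eq_0[OF JT, THEN iffD2] by blast+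
    then have "?y s = 0" for s
      using nonpositive_imp_no_conjugate[where y="?y", OF second_order_K \<beta>(1) jacobi_to_sol[OF J] _ _ _ curv, of a b s]
      by blast
    then show False using nz co_eq_0[OF JT] by blast
  qed
qed

text \<open>The numbers \<open>I1\<close> and \<open>I2\<close> come from a test field for
  \<open>K\<close>, which does not involve \<beta>; hence the failure at one parameter yields an
  inequality for every parameter that is free.\<close>

lemma not_free_imp_index:
  assumes "\<not> free_of_conjugate_points M A g \<beta>"
  obtains I1 I2 where "I1 - \<beta> * I2 < 0"
    "\<And>\<beta>'. free_of_conjugate_points M A g \<beta>' \<Longrightarrow> I1 - \<beta>' * I2 \<ge> 0"
proof -
  obtain \<gamma> J t where \<gamma>: "unit_speed_geodesic M A g \<gamma>" and J: "beta_jacobi_field A g \<beta> \<gamma> J"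
    and nz: "\<exists>t. J t \<noteq> (\<lambda>c. 0)" and J0: "J 0 = (\<lambda>c. 0)" and Jt: "J t = (\<lambda>c. 0)" "t \<noteq> 0"
    using assms unfolding free_of_conjugate_points_def by blast
  obtain e where "framed_geodesic M A g \<gamma> e" by (rule geodesic_framed[OF \<gamma>])
  then interpret framed_geodesic M A g \<gamma> e .
  have f: "field J" using J by (simp add: beta_jacobi_field_def)
  note JT = field_T[OF f]
  note sol = jacobi_to_sol[OF J]
  define a b where "a = min 0 t" and "b = max 0 t"
  have ab: "a < b" "co a (J a) = 0" "co b (J b) = 0"
    using Jt J0 by (auto simp: a_def b_def min_def max_def co_eq_0[OF JT])
  have "\<exists>s. co s (J s) \<noteq> 0" using nz co_eq_0[OF JT] by blast
  then have "co b (DD J b) \<noteq> 0"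
    using second_order.sol_eq_0_iff[OF second_order_scale[OF second_order_K] sol, of b] ab(3) by blast
  from conjugate_imp_negative_index[OF second_order_K sol ab(2,3,1) this]
  obtain I1 I2 where "index_pair K I1 I2" "I1 - \<beta> * I2 < 0" by blast
  then show thesis
    using that index_pair_nonneg[OF second_order_K _ free_imp_disconjugate] by blast
qed

lemma positive_curvature_imp_index:
  assumes "\<not> nonpositive_sectional_curvature M A g"
  obtains I1 I2 :: real where "I2 > 0"
    "\<And>\<beta>. free_of_conjugate_points M A g \<beta> \<Longrightarrow> I1 - \<beta> * I2 \<ge> 0"
proof -
  obtain p v w where p: "p \<in> M" "v \<in> T p" "w \<in> T p" "g p v v = 1" "g p (curvature A g p w v v) w > 0"
    using assms unfolding nonpositive_sectional_curvature_def by force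
  obtain \<gamma> where \<gamma>: "unit_speed_geodesic M A g \<gamma>" "\<gamma> 0 = p" "velocity A \<gamma> 0 = v"
    using geodesic_exists[OF p(1,2,4)] by blast
  obtain e where "framed_geodesic M A g \<gamma> e" by (rule geodesic_framed[OF \<gamma>(1)])
  then interpret framed_geodesic M A g \<gamma> e .
  have "E 0 (co 0 w) = w" using E_co[of w 0] p(3) \<gamma>(2) by simp
  then have "K 0 (co 0 w) \<bullet> co 0 w > 0" using p(5) \<gamma> by (simp add: K_inner)
  from positive_curvature_index[OF second_order_K this]
  obtain I1 I2 where "index_pair K I1 I2" "I2 > 0" by blast
  then show thesis
    using that index_pair_nonneg[OF second_order_K _ free_imp_disconjugate] by blast
qed

abbreviation Ter where "Ter \<equiv> terminator_value M A g"

lemma free_le_Ter: "\<beta> \<ge> 0 \<Longrightarrow> free_of_conjugate_points M A g \<beta> \<Longrightarrow> ennreal \<beta> \<le> Ter"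
  unfolding terminator_value_def by (rule Sup_upper) blast

lemma less_Ter_imp_free:
  assumes "0 \<le> x" "ennreal x < Ter"
  obtains \<beta> where "\<beta> > x" "ennreal \<beta> \<le> Ter" "free_of_conjugate_points M A g \<beta>"
proof -
  obtain \<beta> where \<beta>: "0 \<le> \<beta>" "free_of_conjugate_points M A g \<beta>" "ennreal x < ennreal \<beta>"
    using assms(2) unfolding terminator_value_def less_Sup_iff by blast
  then have "\<beta> > x" using assms(1) by (simp add: ennreal_less_iff)
  then show thesis using that \<beta> free_le_Ter by blast
qed

lemma free_at_Ter:
  assumes "Ter < \<infinity>" shows "free_of_conjugate_points M A g (enn2real Ter)"
proof (rule ccontr)
  define b where "b = enn2real Ter"
  have b: "b \<ge> 0" "ennreal b = Ter" using assms by (auto simp: b_def)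
  assume "\<not> free_of_conjugate_points M A g (enn2real Ter)"
  then obtain I1 I2 where I: "I1 - b * I2 < 0"
    "\<And>\<beta>'. free_of_conjugate_points M A g \<beta>' \<Longrightarrow> I1 - \<beta>' * I2 \<ge> 0"
    using not_free_imp_index unfolding b_def by blast
  \<comment> \<open>Lowering the parameter by less than \<eta> changes the index by at most \<eta>
    times the modulus of \<open>I2\<close>, which is less than the deficit
    \<open>b * I2 - I1\<close>.\<close>
  define \<eta> where "\<eta> = (b * I2 - I1) / (\<bar>I2\<bar> + 1)"
  have \<eta>: "\<eta> > 0" "b * I2 - I1 = \<eta> * (\<bar>I2\<bar> + 1)" using I(1) by (auto simp: \<eta>_def)
  obtain \<beta>' where \<beta>': "free_of_conjugate_points M A g \<beta>'" "b - \<eta> < \<beta>'" "\<beta>' \<le> b"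
  \<comment> \<open>If \<open>b - \<eta>\<close> is negative, in particular if \<open>b\<close> is
    0, the parameter 0 is close enough to \<open>b\<close> and is always free; otherwise the
    supremum supplies a free parameter above \<open>b - \<eta>\<close>.\<close>
  proof (cases "b - \<eta> < 0")
    case True
    then show ?thesis using that[of 0] b(1) free_of_nonpositive[of 0] by simp
  next
    case False
    then have "ennreal (b - \<eta>) < Ter" unfolding b(2)[symmetric] using \<eta>(1) by (simp add: ennreal_less_iff)
    then obtain \<beta>' where "\<beta>' > b - \<eta>" "ennreal \<beta>' \<le> ennreal b" "free_of_conjugate_points M A g \<beta>'"
      using less_Ter_imp_free[of "b - \<eta>"] False b(2) by (metis not_less)
    then show ?thesis using that b(1) by (simp add: ennreal_le_iff)
  qed
  have "(b - \<beta>') * I2 \<le> \<eta> * \<bar>I2\<bar>"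
  proof -
    have "(b - \<beta>') * I2 \<le> (b - \<beta>') * \<bar>I2\<bar>" using \<beta>' by (intro mult_left_mono) auto
    also have "\<dots> \<le> \<eta> * \<bar>I2\<bar>" using \<beta>' by (intro mult_right_mono) auto
    finally show ?thesis .
  qed
  moreover have "I1 - \<beta>' * I2 = (b - \<beta>') * I2 - \<eta> * \<bar>I2\<bar> - \<eta>" using \<eta>(2) by (simp add: algebra_simps)
  ultimately show False using I(2)[OF \<beta>'(1)] \<eta>(1) by linarith
qed

lemma Ter_infinite_iff: "Ter = \<infinity> \<longleftrightarrow> nonpositive_sectional_curvature M A g"
proof
  assume inf: "Ter = \<infinity>"
  show "nonpositive_sectional_curvature M A g"
  proof (rule ccontr)
    assume "\<not> nonpositive_sectional_curvature M A g"
    then obtain I1 I2 where I: "I2 > 0"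
      "\<And>\<beta>. free_of_conjugate_points M A g \<beta> \<Longrightarrow> I1 - \<beta> * I2 \<ge> 0"
      using positive_curvature_imp_index by blast
    \<comment> \<open>Beyond \<open>I1 / I2\<close> the index is negative; the maximum with 0 meets
      the sign condition of \<open>less_Ter_imp_free\<close>.\<close>
    obtain \<beta> where \<beta>: "\<beta> > max 0 (I1 / I2)" "free_of_conjugate_points M A g \<beta>"
      using less_Ter_imp_free[of "max 0 (I1 / I2)"] inf by auto
    then have "I1 < \<beta> * I2" using I(1) by (simp add: field_simps)
    then show False using I(2)[OF \<beta>(2)] by simp
  qed
next
  assume np: "nonpositive_sectional_curvature M A g"
  show "Ter = \<infinity>"
  proof (rule ccontr)
    assume "Ter \<noteq> \<infinity>"
    then have e: "ennreal (enn2real Ter) = Ter" by (simp add: less_top)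
    \<comment> \<open>Nonpositive curvature makes every nonnegative parameter free, in particular
      one exceeding the supposedly finite supremum.\<close>
    have "ennreal (enn2real Ter + 1) \<le> Ter"
      by (intro free_le_Ter free_of_nonpositive) (auto simp: np)
    then have "ennreal (enn2real Ter + 1) \<le> ennreal (enn2real Ter)" using e by simp
    then show False by (simp add: ennreal_le_iff)
  qed
qed

end

theorem lemma6p11:
  fixes M :: "'a::{t2_space, second_countable_topology} set"
    and A :: "('a, 'e::euclidean_space) chart set"
    and g :: "('a, 'e) metric"
  assumes "closed_riemannian_manifold M A g"
    and "DIM('e) \<ge> 2"
  shows "(terminator_value M A g < \<infinity> \<longrightarrow>
            free_of_conjugate_points M A g (enn2real (terminator_value M A g))) \<and>
         (terminator_value M A g = \<infinity> \<longleftrightarrow> nonpositive_sectional_curvature M A g)"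
proof -
  interpret rmfd M A g by unfold_locales (rule assms(1))
  show ?thesis using free_at_Ter Ter_infinite_iff by blast
qed

end
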